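(* For any countable group $G$ the following conditions on a subgroup $H\subset G$ are equivalent: (i) there exists a non-degenerate probability measure $\mu$ on $G$ such that the stabilizer of almost every point of the Poisson boundary $\partial_\mu G$ is $H$; (ii) there exists a non-degenerate probability measure $\mu$ on $G$ such that the pointwise stabilizer of the Poisson boundary $\partial_\mu G$ is $H$ (i.e., $H$ is the intersection of almost all point stabilizers); (iii) $H$ is an amenable normal subgroup of $G$ with the property that the quotient $G/H$ is either an ICC group or the trivial group.
   Context: A group is ICC if the conjugacy class of every non-identity element is infinite. A probability measure $\mu$ on a countable group $G$ is non-degenerate if its support generates $G$ as a semigroup. The random walk $(G,\mu)$ is the Markov chain on $G$ with transitions $g\mapsto gh$, $h$ sampled from $\mu$; its sample paths are $\boldsymbol y=(y_0,y_1,\dots)$ with $y_n=y_0x_1\cdots x_n$, where $(x_n)$ are independent and $\mu$-distributed. $\mathbf P_g$ is the measure on $G^{\mathbb Z_+}$ for the starting point $y_0=g$, and $\mathbf P_\#=\sum_{g\in G}\mathbf P_g$. Let $T$ be the time shift on $G^{\mathbb Z_+}$. The exit $\sigma$-algebra consists of all measurable subsets of $(G^{\mathbb Z_+},\mathbf P_\#)$ that are ($\mathbf P_\#$-mod 0) $T$-invariant, i.e., unions of classes of the relation $\boldsymbol y\sim\boldsymbol y'\iff T^n\boldsymbol y=T^{n'}\boldsymbol y'$ for some $n,n'\ge0$. The Poisson boundary $\partial_\mu G$ is the corresponding quotient measure space, with quotient map $\operatorname{bnd}$ and harmonic measures $\nu_g=\operatorname{bnd}\mathbf P_g$. "Almost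 every" point of $\partial_\mu G$ refers to the common class of the measures $\sum_g\theta(g)\nu_g$, where $\theta$ is a probability measure with full support on $G$. The coordinate-wise left action of $G$ on paths descends to an action on $\partial_\mu G$ preserving this measure class. The stabilizer of $\zeta\in\partial_\mu G$ is $\{g\in G: g\zeta=\zeta\}$. The pointwise stabilizer of $\partial_\mu G$ is the set of all $g\in G$ such that $g\zeta=\zeta$ for almost every $\zeta\in\partial_\mu G$. *)

theory Defs
  imports "HOL-Probability.Probability" "HOL-Algebra.Coset"
begin

section \<open>Groups\<close>

definition icc_group :: "('a, 'b) monoid_scheme \<Rightarrow> bool" where
  "icc_group G \<longleftrightarrow> group G \<and>
     (\<forall>x \<in> carrier G. x \<noteq> \<one>\<^bsub>G\<^esub> \<longrightarrow>
        infinite {g \<otimes>\<^bsub>G\<^esub> x \<otimes>\<^bsub>G\<^esub> inv\<^bsub>G\<^esub> g | g. g \<in> carrier G})"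

text \<open>Amenability of a discrete group: a left-invariant finitely additive probability
  measure on all subsets.\<close>

definition amenable_group :: "('a, 'b) monoid_scheme \<Rightarrow> bool" where
  "amenable_group G \<longleftrightarrow> group G \<and>
     (\<exists>m :: 'a set \<Rightarrow> real.
        m (carrier G) = 1 \<and>
        (\<forall>A. A \<subseteq> carrier G \<longrightarrow> 0 \<le> m A) \<and>
        (\<forall>A B. A \<subseteq> carrier G \<longrightarrow> B \<subseteq> carrier G \<longrightarrow> A \<inter> B = {} \<longrightarrow> m (A \<union> B) = m A + m B) \<and>
        (\<forall>g \<in> carrier G. \<forall>A. A \<subseteq> carrier G \<longrightarrow> m (g <#\<^bsub>G\<^esub> A) = m A))"

inductive_set generated_semigroup :: "('a, 'b) monoid_scheme \<Rightarrow> 'a set \<Rightarrow> 'a set"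
  for G (structure) and S where
  incl: "s \<in> S \<Longrightarrow> s \<in> generated_semigroup G S"
| mult: "a \<in> generated_semigroup G S \<Longrightarrow> b \<in> generated_semigroup G S \<Longrightarrow>
    a \<otimes> b \<in> generated_semigroup G S"


section \<open>Random walks\<close>

definition prob_measure_on :: "('a, 'b) monoid_scheme \<Rightarrow> 'a measure \<Rightarrow> bool" where
  "prob_measure_on G \<mu> \<longleftrightarrow> prob_space \<mu> \<and> sets \<mu> = Pow (carrier G)"

definition support :: "('a, 'b) monoid_scheme \<Rightarrow> 'a measure \<Rightarrow> 'a set" where
  "support G \<mu> = {g \<in> carrier G. measure \<mu> {g} > 0}"

definition nondegenerate :: "('a, 'b) monoid_scheme \<Rightarrow> 'a measure \<Rightarrow> bool" where
  "nondegenerate G \<mu> \<longleftrightarrow> prob_measure_on G \<mu> \<and> generated_semigroup G (support G \<mu>) = carrier G"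

definition path_space :: "('a, 'b) monoid_scheme \<Rightarrow> (nat \<Rightarrow> 'a) measure" where
  "path_space G = (\<Pi>\<^sub>M n \<in> (UNIV :: nat set). count_space (carrier G))"

text \<open>The path issued from \<^term>\<open>g\<close> with increments \<^term>\<open>x\<close>; the increment from
  time \<^term>\<open>n\<close> to time \<^term>\<open>Suc n\<close> is \<^term>\<open>x n\<close>.\<close>

primrec walk :: "('a, 'b) monoid_scheme \<Rightarrow> 'a \<Rightarrow> (nat \<Rightarrow> 'a) \<Rightarrow> nat \<Rightarrow> 'a" where
  "walk G g x 0 = g"
| "walk G g x (Suc n) = walk G g x n \<otimes>\<^bsub>G\<^esub> x n"

definition path_measure :: "('a, 'b) monoid_scheme \<Rightarrow> 'a measure \<Rightarrow> 'a \<Rightarrow> (nat \<Rightarrow> 'a) measure" where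
  "path_measure G \<mu> g = distr (\<Pi>\<^sub>M n \<in> (UNIV :: nat set). \<mu>) (path_space G) (walk G g)"

text \<open>The infinite measure \<open>P_# = \<Sum>g. P_g\<close>: binding with the counting measure
  integrates the kernel against it, i.e. sums over the starting points.\<close>

definition path_measure_all :: "('a, 'b) monoid_scheme \<Rightarrow> 'a measure \<Rightarrow> (nat \<Rightarrow> 'a) measure" where
  "path_measure_all G \<mu> = Giry_Monad.bind (count_space (carrier G)) (path_measure G \<mu>)"

definition shift :: "(nat \<Rightarrow> 'a) \<Rightarrow> nat \<Rightarrow> 'a" where
  "shift y = (\<lambda>n. y (Suc n))"

definition translate :: "('a, 'b) monoid_scheme \<Rightarrow> 'a \<Rightarrow> (nat \<Rightarrow> 'a) \<Rightarrow> nat \<Rightarrow> 'a" where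
  "translate G g y = (\<lambda>n. g \<otimes>\<^bsub>G\<^esub> y n)"


section \<open>The Poisson boundary\<close>

text \<open>The exit \<open>\<sigma>\<close>-algebra: measurable sets \<open>A\<close> with \<open>T\<^sup>-\<^sup>1 A = A\<close> modulo \<open>P_#\<close>.\<close>

definition exit_sets :: "('a, 'b) monoid_scheme \<Rightarrow> 'a measure \<Rightarrow> (nat \<Rightarrow> 'a) set set" where
  "exit_sets G \<mu> = {A \<in> sets (path_space G).
     AE y in path_measure_all G \<mu>. y \<in> A \<longleftrightarrow> shift y \<in> A}"

text \<open>The quotient of the path space by the exit \<open>\<sigma>\<close>-algebra is taken in the sense of
  measure spaces: a countable family generating the exit \<open>\<sigma>\<close>-algebra modulo \<open>P_#\<close> is chosen,
  and the points of the quotient are the classes of paths not separated by this family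
  (the elements of the measurable partition corresponding to the exit \<open>\<sigma>\<close>-algebra).
  The family is required to be invariant under the countable group \<open>G\<close>, so that the action of
  \<open>G\<close> on paths descends to all points of the quotient and not just to almost all of them.
  Different choices lead to equivariantly isomorphic (mod 0) quotients; the lemma
  \<open>exit_base_exists\<close> below shows that there is always such a family.\<close>

definition is_exit_base ::
  "('a, 'b) monoid_scheme \<Rightarrow> 'a measure \<Rightarrow> (nat \<Rightarrow> 'a) set set \<Rightarrow> bool" where
  "is_exit_base G \<mu> \<A> \<longleftrightarrow>
     countable \<A> \<and> \<A> \<subseteq> exit_sets G \<mu> \<and>
     (\<forall>g \<in> carrier G. \<forall>A \<in> \<A>. translate G g ` A \<in> \<A>) \<and>
     (\<forall>E \<in> exit_sets G \<mu>. \<exists>B \<in> sigma_sets (space (path_space G)) \<A>.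
        AE y in path_measure_all G \<mu>. y \<in> E \<longleftrightarrow> y \<in> B)"

definition exit_base :: "('a, 'b) monoid_scheme \<Rightarrow> 'a measure \<Rightarrow> (nat \<Rightarrow> 'a) set set" where
  "exit_base G \<mu> = (SOME \<A>. is_exit_base G \<mu> \<A>)"

definition bnd :: "('a, 'b) monoid_scheme \<Rightarrow> 'a measure \<Rightarrow> (nat \<Rightarrow> 'a) \<Rightarrow> (nat \<Rightarrow> 'a) set" where
  "bnd G \<mu> y = {y' \<in> space (path_space G). \<forall>A \<in> exit_base G \<mu>. y' \<in> A \<longleftrightarrow> y \<in> A}"

definition poisson_boundary :: "('a, 'b) monoid_scheme \<Rightarrow> 'a measure \<Rightarrow> (nat \<Rightarrow> 'a) set measure" where
  "poisson_boundary G \<mu> =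
     sigma (bnd G \<mu> ` space (path_space G))
       {E. E \<subseteq> bnd G \<mu> ` space (path_space G) \<and>
           bnd G \<mu> -` E \<inter> space (path_space G) \<in> exit_sets G \<mu>}"

definition harmonic_measure ::
  "('a, 'b) monoid_scheme \<Rightarrow> 'a measure \<Rightarrow> 'a \<Rightarrow> (nat \<Rightarrow> 'a) set measure" where
  "harmonic_measure G \<mu> g = distr (path_measure G \<mu> g) (poisson_boundary G \<mu>) (bnd G \<mu>)"

text \<open>The measures \<open>\<Sum>g. \<theta>(g) \<nu>_g\<close> for \<open>\<theta>\<close> of full support are all equivalent (and such
  \<open>\<theta>\<close> exist, see \<open>full_support_exists\<close> below), so quantifying over all \<open>\<theta>\<close> is the same as
  choosing one.\<close>

definition boundary_AE ::
  "('a, 'b) monoid_scheme \<Rightarrow> 'a measure \<Rightarrow> ((nat \<Rightarrow> 'a) set \<Rightarrow> bool) \<Rightarrow> bool" where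
  "boundary_AE G \<mu> P \<longleftrightarrow>
     (\<forall>\<theta>. prob_measure_on G \<theta> \<and> support G \<theta> = carrier G \<longrightarrow>
        (AE \<zeta> in Giry_Monad.bind \<theta> (harmonic_measure G \<mu>). P \<zeta>))"

definition boundary_action ::
  "('a, 'b) monoid_scheme \<Rightarrow> 'a \<Rightarrow> (nat \<Rightarrow> 'a) set \<Rightarrow> (nat \<Rightarrow> 'a) set" where
  "boundary_action G g \<zeta> = translate G g ` \<zeta>"

definition point_stabilizer :: "('a, 'b) monoid_scheme \<Rightarrow> (nat \<Rightarrow> 'a) set \<Rightarrow> 'a set" where
  "point_stabilizer G \<zeta> = {g \<in> carrier G. boundary_action G g \<zeta> = \<zeta>}"

definition pointwise_stabilizer :: "('a, 'b) monoid_scheme \<Rightarrow> 'a measure \<Rightarrow> 'a set" where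
  "pointwise_stabilizer G \<mu> = {g \<in> carrier G. boundary_AE G \<mu> (\<lambda>\<zeta>. boundary_action G g \<zeta> = \<zeta>)}"


section \<open>Well-definedness of the boundary and of the action on it\<close>

lemma space_path_space: "space (path_space G) = UNIV \<rightarrow>\<^sub>E carrier G"
  by (simp add: path_space_def space_PiM)

lemma measurable_path_space_component [measurable]:
  "(\<lambda>y. y n) \<in> path_space G \<rightarrow>\<^sub>M count_space (carrier G)"
  unfolding path_space_def by measurable

lemma measurable_to_path_space:
  assumes "\<And>n. (\<lambda>x. f x n) \<in> M \<rightarrow>\<^sub>M count_space (carrier G)"
  shows "f \<in> M \<rightarrow>\<^sub>M path_space G"
  unfolding path_space_def
  proof (rule measurable_PiM_single')
  show "f \<in> space M \<rightarrow> UNIV \<rightarrow>\<^sub>E space (count_space (carrier G))"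
  proof (rule funcsetI, rule PiE_I)
    fix x n assume "x \<in> space M"
    then show "f x n \<in> space (count_space (carrier G))" by (rule measurable_space[OF assms])
  qed simp
qed (rule assms)

lemma measurable_mult_count_space:
  assumes "group G" "countable (carrier G)"
    and f: "f \<in> M \<rightarrow>\<^sub>M count_space (carrier G)" and h: "h \<in> M \<rightarrow>\<^sub>M count_space (carrier G)"
  shows "(\<lambda>x. f x \<otimes>\<^bsub>G\<^esub> h x) \<in> M \<rightarrow>\<^sub>M count_space (carrier G)"
proof (rule measurable_compose_countable'[OF _ f assms(2)])
  fix a assume a: "a \<in> carrier G"
  have "(\<lambda>b. a \<otimes>\<^bsub>G\<^esub> b) \<in> count_space (carrier G) \<rightarrow>\<^sub>M count_space (carrier G)"
    using assms(1) a by (auto intro: monoid.m_closed group.is_monoid)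
  from measurable_compose[OF h this] show "(\<lambda>x. a \<otimes>\<^bsub>G\<^esub> h x) \<in> M \<rightarrow>\<^sub>M count_space (carrier G)" .
qed

lemma measurable_translate:
  assumes "group G" "countable (carrier G)" "g \<in> carrier G"
  shows "translate G g \<in> path_space G \<rightarrow>\<^sub>M path_space G"
  unfolding translate_def
  using assms by (intro measurable_to_path_space measurable_mult_count_space) auto

lemma measurable_shift: "shift \<in> path_space G \<rightarrow>\<^sub>M path_space G"
  unfolding shift_def by (intro measurable_to_path_space) measurable

lemma measurable_walk:
  assumes "group G" "countable (carrier G)" "prob_measure_on G \<mu>" "g \<in> carrier G"
  shows "walk G g \<in> (\<Pi>\<^sub>M n \<in> (UNIV :: nat set). \<mu>) \<rightarrow>\<^sub>M path_space G"
proof (rule measurable_to_path_space)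
  fix n
  have s: "sets (count_space (carrier G)) = sets \<mu>"
    using assms(3) by (simp add: prob_measure_on_def)
  have comp: "(\<lambda>x. x k) \<in> (\<Pi>\<^sub>M n \<in> (UNIV :: nat set). \<mu>) \<rightarrow>\<^sub>M count_space (carrier G)" for k
    by (subst measurable_cong_sets[OF refl s]) measurable
  show "(\<lambda>x. walk G g x n) \<in> (\<Pi>\<^sub>M n \<in> (UNIV :: nat set). \<mu>) \<rightarrow>\<^sub>M count_space (carrier G)"
  proof (induction n)
    case 0
    then show ?case using assms(4) by simp
  next
    case (Suc n)
    then show ?case
      using measurable_mult_count_space[OF assms(1,2) Suc comp] by simp
  qed
qed

lemma sets_path_measure [simp, measurable_cong]: "sets (path_measure G \<mu> g) = sets (path_space G)"
  by (simp add: path_measure_def)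

lemma prob_space_path_measure:
  assumes "group G" "countable (carrier G)" "prob_measure_on G \<mu>" "g \<in> carrier G"
  shows "prob_space (path_measure G \<mu> g)"
proof -
  interpret prob_space \<mu> using assms(3) by (simp add: prob_measure_on_def)
  have "prob_space (\<Pi>\<^sub>M n \<in> (UNIV :: nat set). \<mu>)"
    by (intro prob_space_PiM prob_space_axioms)
  then show ?thesis
    unfolding path_measure_def by (rule prob_space.prob_space_distr) (rule measurable_walk[OF assms])
qed

lemma path_measure_kernel:
  assumes "group G" "countable (carrier G)" "prob_measure_on G \<mu>" "sets M = Pow (carrier G)"
  shows "path_measure G \<mu> \<in> M \<rightarrow>\<^sub>M subprob_algebra (path_space G)"
proof -
  have s: "sets M = sets (count_space (carrier G))" using assms(4) by simp
  then show ?thesis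
    using prob_space_path_measure[OF assms(1-3)]
    by (simp add: measurable_cong_sets[OF s refl] space_subprob_algebra
        prob_space_imp_subprob_space)
qed

lemma sets_path_measure_all:
  assumes "group G"
  shows "sets (path_measure_all G \<mu>) = sets (path_space G)"
proof -
  have "carrier G \<noteq> {}" using assms by (metis group.is_monoid monoid.one_closed empty_iff)
  then show ?thesis unfolding path_measure_all_def by (intro sets_bind) auto
qed

lemma emeasure_path_measure_all:
  assumes "group G" "countable (carrier G)" "prob_measure_on G \<mu>" "A \<in> sets (path_space G)"
  shows "emeasure (path_measure_all G \<mu>) A =
    (\<integral>\<^sup>+ g. emeasure (path_measure G \<mu> g) A \<partial>count_space (carrier G))"
proof -
  have "carrier G \<noteq> {}" using assms by (metis group.is_monoid monoid.one_closed empty_iff)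
  then show ?thesis unfolding path_measure_all_def
    by (intro emeasure_bind[OF _ path_measure_kernel[OF assms(1-3)]]) (use assms in auto)
qed

lemma AE_path_measure_all:
  assumes "group G" "countable (carrier G)" "prob_measure_on G \<mu>" "Measurable.pred (path_space G) P"
  shows "(AE y in path_measure_all G \<mu>. P y) \<longleftrightarrow>
    (\<forall>g \<in> carrier G. AE y in path_measure G \<mu> g. P y)"
  unfolding path_measure_all_def using assms
  by (subst AE_bind[OF path_measure_kernel]) (auto simp: AE_count_space)

lemma full_support_exists:
  assumes "group G" "countable (carrier G)"
  shows "\<exists>\<theta>. prob_measure_on G \<theta> \<and> support G \<theta> = carrier G"
proof -
  have ne: "carrier G \<noteq> {}" using assms by (metis group.is_monoid monoid.one_closed empty_iff)
  define f where "f = from_nat_into (carrier G)"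
  have fr: "range f = carrier G" unfolding f_def using ne assms(2) by (rule range_from_nat_into)
  define p where "p = geometric_pmf (1/2)"
  have sp: "set_pmf p = UNIV" unfolding p_def by (simp add: set_pmf_geometric)
  define \<theta> where "\<theta> = distr (measure_pmf p) (count_space (carrier G)) f"
  have fm: "f \<in> measure_pmf p \<rightarrow>\<^sub>M count_space (carrier G)" using fr by auto
  have 1: "prob_measure_on G \<theta>"
    unfolding prob_measure_on_def \<theta>_def using fm by (auto intro: prob_space.prob_space_distr measure_pmf.prob_space_axioms)
  have "measure \<theta> {g} > 0" if g: "g \<in> carrier G" for g
  proof -
    obtain n where n: "f n = g" using g fr by (metis rangeE)
    have "0 < pmf p n" using sp by (simp add: pmf_positive)
    also have "pmf p n = measure (measure_pmf p) {n}" by (simp add: measure_pmf_single)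
    also have "\<dots> \<le> measure (measure_pmf p) (f -` {g})"
      using n by (intro measure_pmf.finite_measure_mono) auto
    also have "\<dots> = measure \<theta> {g}"
      unfolding \<theta>_def using g fm by (subst measure_distr) auto
    finally show ?thesis .
  qed
  then show ?thesis using 1 by (auto simp: support_def)
qed

lemma AE_full_support:
  assumes "prob_measure_on G \<theta>" "support G \<theta> = carrier G" "countable (carrier G)"
  shows "(AE g in \<theta>. P g) \<longleftrightarrow> (\<forall>g \<in> carrier G. P g)"
proof -
  have sp: "space \<theta> = carrier G" 
    using assms(1) by (metis prob_measure_on_def sets_eq_imp_space_eq sets_count_space space_count_space)
  interpret prob_space \<theta> using assms(1) by (simp add: prob_measure_on_def)
  show ?thesis
  proof
    assume "AE g in \<theta>. P g"
    then obtain N where N: "{g \<in> space \<theta>. \<not> P g} \<subseteq> N" "emeasure \<theta> N = 0" "N \<in> sets \<theta>"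
      by (rule AE_E)
    show "\<forall>g \<in> carrier G. P g"
    proof (rule ballI, rule ccontr)
      fix g assume g: "g \<in> carrier G" "\<not> P g"
      then have "{g} \<subseteq> N" using N sp by auto
      then have "measure \<theta> {g} \<le> measure \<theta> N" using N by (intro finite_measure_mono) auto
      also have "\<dots> = 0" using N(2) by (simp add: measure_def)
      finally show False using assms(2) g unfolding support_def by (metis (mono_tags, lifting) mem_Collect_eq not_le)
    qed
  qed (use sp in \<open>auto intro!: AE_I2\<close>)
qed

lemma path_measure_translate:
  assumes "group G" "countable (carrier G)" "prob_measure_on G \<mu>" "g \<in> carrier G" "h \<in> carrier G"
  shows "path_measure G \<mu> (h \<otimes>\<^bsub>G\<^esub> g) = distr (path_measure G \<mu> g) (path_space G) (translate G h)"
proof -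
  interpret group G by fact
  let ?X = "\<Pi>\<^sub>M n \<in> (UNIV :: nat set). \<mu>"
  have sp: "space \<mu> = carrier G" 
    using assms(3) by (metis prob_measure_on_def sets_eq_imp_space_eq sets_count_space space_count_space)
  have "walk G (h \<otimes>\<^bsub>G\<^esub> g) x = translate G h (walk G g x)" if "x \<in> space ?X" for x
  proof -
    have x: "x n \<in> carrier G" for n using that sp by (auto simp: space_PiM)
    have w: "walk G g x n \<in> carrier G" for n by (induction n) (use x assms in auto)
    have "walk G (h \<otimes>\<^bsub>G\<^esub> g) x n = h \<otimes>\<^bsub>G\<^esub> walk G g x n" for n
      by (induction n) (use x w assms in \<open>auto simp: m_assoc\<close>)
    then show ?thesis by (auto simp: translate_def)
  qed
  then have "path_measure G \<mu> (h \<otimes>\<^bsub>G\<^esub> g) = distr ?X (path_space G) (translate G h \<circ> walk G g)"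
    unfolding path_measure_def by (intro distr_cong) auto
  also have "\<dots> = distr (path_measure G \<mu> g) (path_space G) (translate G h)"
    unfolding path_measure_def 
    by (rule distr_distr[symmetric]) (rule measurable_translate measurable_walk, fact+)+
  finally show ?thesis .
qed

lemma translate_image_eq:
  assumes "group G" "g \<in> carrier G" "A \<subseteq> space (path_space G)"
  shows "translate G g ` A = translate G (inv\<^bsub>G\<^esub> g) -` A \<inter> space (path_space G)"
proof -
  interpret group G by fact
  have inv1: "translate G (inv\<^bsub>G\<^esub> g) (translate G g y) = y" "translate G g (translate G (inv\<^bsub>G\<^esub> g) y) = y"
    if "y \<in> space (path_space G)" for y
    using that assms(2)
    by (auto simp: translate_def space_path_space PiE_iff m_assoc[symmetric] fun_eq_iff)
  have sp: "translate G h y \<in> space (path_space G)" if "h \<in> carrier G" "y \<in> space (path_space G)" for h y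
    using that by (auto simp: translate_def space_path_space)
  show ?thesis
  proof (intro equalityI subsetI)
    fix y assume "y \<in> translate G g ` A"
    then show "y \<in> translate G (inv\<^bsub>G\<^esub> g) -` A \<inter> space (path_space G)"
      using assms sp inv1 by auto
  next
    fix y assume y: "y \<in> translate G (inv\<^bsub>G\<^esub> g) -` A \<inter> space (path_space G)"
    then have "y = translate G g (translate G (inv\<^bsub>G\<^esub> g) y)" using inv1(2)[of y] by simp
    then show "y \<in> translate G g ` A" using y by blast
  qed
qed

lemma exit_sets_translate:
  assumes "group G" "countable (carrier G)" "prob_measure_on G \<mu>" "g \<in> carrier G" "A \<in> exit_sets G \<mu>"
  shows "translate G g ` A \<in> exit_sets G \<mu>"
proof -
  interpret group G by fact
  have A: "A \<in> sets (path_space G)" and inv: "AE y in path_measure_all G \<mu>. y \<in> A \<longleftrightarrow> shift y \<in> A"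
    using assms(5) by (auto simp: exit_sets_def)
  note [measurable] = A measurable_shift
  let ?t = "translate G (inv\<^bsub>G\<^esub> g)"
  have t[measurable]: "?t \<in> path_space G \<rightarrow>\<^sub>M path_space G"
    using assms by (intro measurable_translate) auto
  have eq: "translate G g ` A = ?t -` A \<inter> space (path_space G)"
    using assms sets.sets_into_space[OF A] by (intro translate_image_eq)
  have m: "translate G g ` A \<in> sets (path_space G)" unfolding eq by measurable
  note [measurable] = m
  have "AE y in path_measure_all G \<mu>. y \<in> translate G g ` A \<longleftrightarrow> shift y \<in> translate G g ` A"
  proof (subst AE_path_measure_all[OF assms(1-3)], measurable, rule ballI)
    fix k assume k: "k \<in> carrier G"
    have "AE y in path_measure G \<mu> (inv\<^bsub>G\<^esub> g \<otimes>\<^bsub>G\<^esub> k). y \<in> A \<longleftrightarrow> shift y \<in> A"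
      using inv assms k by (subst (asm) AE_path_measure_all[OF assms(1-3)]) auto
    then have "AE y in path_measure G \<mu> k. ?t y \<in> A \<longleftrightarrow> shift (?t y) \<in> A"
      using assms k by (subst (asm) path_measure_translate, simp_all, subst (asm) AE_distr_iff) auto
    moreover have "AE y in path_measure G \<mu> k. y \<in> space (path_space G)"
      using sets_eq_imp_space_eq[OF sets_path_measure] by (metis AE_space)
    ultimately show "AE y in path_measure G \<mu> k. y \<in> translate G g ` A \<longleftrightarrow> shift y \<in> translate G g ` A"
    proof eventually_elim
      case (elim y)
      have "shift y \<in> space (path_space G)" using elim(2) measurable_space[OF measurable_shift] by blast
      moreover have "?t (shift y) = shift (?t y)" by (simp add: shift_def translate_def)
      ultimately show ?case unfolding eq using elim by auto
    qed
  qed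
  then show ?thesis using m by (simp add: exit_sets_def)
qed

lemma (in finite_measure) approx_by_algebra:
  assumes alg: "algebra (space M) \<C>" and gen: "sets M = sigma_sets (space M) \<C>"
    and "A \<in> sets M" "e > (0::real)"
  shows "\<exists>C \<in> \<C>. measure M (sym_diff A C) < e"
proof -
  interpret C: algebra "space M" \<C> by fact
  have sub: "\<C> \<subseteq> sets M" unfolding gen by auto
  have "\<forall>e>0. \<exists>C \<in> \<C>. measure M (sym_diff A C) < e"
    using C.Int_stable C.space_closed \<open>A \<in> sets M\<close>[unfolded gen]
  proof (induction rule: sigma_sets_induct_disjoint)
    case (basic A)
    then show ?case by (intro allI impI bexI[of _ A]) auto
  next
    case empty
    show ?case by (intro allI impI bexI[of _ "{}"]) auto
  next
    case (compl A)
    show ?case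
    proof (intro allI impI)
      fix e :: real assume "e > 0"
      then obtain C where C: "C \<in> \<C>" "measure M (sym_diff A C) < e" using compl by blast
      have "sym_diff (space M - A) (space M - C) \<subseteq> sym_diff A C" by auto
      moreover have "A \<in> sets M" "C \<in> sets M" using compl(1) C(1) sub gen by auto
      then have "sym_diff A C \<in> sets M" by auto
      ultimately have "measure M (sym_diff (space M - A) (space M - C)) \<le> measure M (sym_diff A C)"
        by (intro finite_measure_mono)
      then show "\<exists>C\<in>\<C>. measure M (sym_diff (space M - A) C) < e"
        using C by (intro bexI[of _ "space M - C"]) auto
    qed
  next
    case (union A)
    have Am: "\<And>i. A i \<in> sets M" using union gen by auto
    show ?case
    proof (intro allI impI)
      fix e :: real assume e: "e > 0"
      define U where "U n = (\<Union>i<n. A i)" for n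
      have Um: "U n \<in> sets M" for n unfolding U_def using Am by auto
      have "(\<lambda>n. measure M (U n)) \<longlonglongrightarrow> measure M (\<Union>n. U n)"
        by (rule finite_Lim_measure_incseq) (use Um in \<open>auto simp: U_def incseq_def\<close>, fastforce)
      moreover have UU: "(\<Union>n. U n) = (\<Union>i. A i)" unfolding U_def by auto
      ultimately have "(\<lambda>n. measure M (U n)) \<longlonglongrightarrow> measure M (\<Union>i. A i)" by simp
      from order_tendstoD(1)[OF this, of "measure M (\<Union>i. A i) - e/2"] e
      have "\<exists>n. measure M (U n) > measure M (\<Union>i. A i) - e/2"
        by (auto simp: eventually_sequentially)
      then obtain n where n: "measure M (U n) > measure M (\<Union>i. A i) - e/2" by blast
      have "\<forall>i. \<exists>C \<in> \<C>. measure M (sym_diff (A i) C) < e / (2 * (real n + 1))"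
        using union(3) e by simp
      then obtain C where C: "\<And>i. C i \<in> \<C>" "\<And>i. measure M (sym_diff (A i) (C i)) < e / (2 * (real n + 1))"
        by metis
      define D where "D = (\<Union>i<n. C i)"
      have D: "D \<in> \<C>" unfolding D_def using C(1) by auto
      have sm: "sym_diff (A i) (C i) \<in> sets M" for i
      proof -
        have "C i \<in> sets M" using C(1) sub by blast
        then show ?thesis using Am[of i] by simp
      qed
      have "sym_diff (\<Union>i. A i) D \<subseteq> ((\<Union>i. A i) - U n) \<union> (\<Union>i<n. sym_diff (A i) (C i))"
        unfolding D_def U_def by auto
      then have "measure M (sym_diff (\<Union>i. A i) D)
          \<le> measure M (((\<Union>i. A i) - U n) \<union> (\<Union>i<n. sym_diff (A i) (C i)))"
        using Am Um sm by (intro finite_measure_mono) auto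
      also have "\<dots> \<le> measure M ((\<Union>i. A i) - U n) + measure M (\<Union>i<n. sym_diff (A i) (C i))"
        using Am Um sm by (intro measure_Un_le) auto
      also have "measure M ((\<Union>i. A i) - U n) = measure M (\<Union>i. A i) - measure M (U n)"
        using Am Um by (intro finite_measure_Diff) (auto simp: U_def)
      also have "measure M (\<Union>i<n. sym_diff (A i) (C i)) \<le> (\<Sum>i<n. measure M (sym_diff (A i) (C i)))"
        using sm by (intro finite_measure_subadditive_finite) auto
      also have "\<dots> \<le> (\<Sum>i<n. e / (2 * (real n + 1)))"
        using C(2) by (intro sum_mono) (auto intro: less_imp_le)
      also have "\<dots> \<le> e / 2" using e by (simp add: field_simps)
      finally have "measure M (sym_diff (\<Union>i. A i) D) < e" using n by simp
      then show "\<exists>C\<in>\<C>. measure M (sym_diff (\<Union>i. A i) C) < e" using D by blast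
    qed
  qed
  then show ?thesis using assms(4) by blast
qed

lemma countable_algebra:
  assumes "countable S" "S \<subseteq> Pow \<Omega>"
  shows "\<exists>\<C>. countable \<C> \<and> S \<subseteq> \<C> \<and> \<C> \<subseteq> sigma_sets \<Omega> S \<and> algebra \<Omega> \<C>"
proof -
  define step where "step X = X \<union> (\<lambda>a. \<Omega> - a) ` X \<union> (\<lambda>(a, b). a \<union> b) ` (X \<times> X)" for X :: "'a set set"
  define X where "X n = (step ^^ n) (insert {} S)" for n
  have X0: "X 0 = insert {} S" and XS: "X (Suc n) = step (X n)" for n by (simp_all add: X_def)
  have mono: "X m \<subseteq> X n" if "m \<le> n" for m n
    using that by (rule lift_Suc_mono_le[rotated]) (auto simp: XS step_def)
  have cnt: "countable (X n)" for n
    by (induction n) (auto simp: X0 XS step_def assms(1))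
  have sub: "X n \<subseteq> sigma_sets \<Omega> S" for n
  proof (induction n)
    case 0
    then show ?case by (auto simp: X0 sigma_sets.Empty)
  next
    case (Suc n)
    then show ?case by (auto simp: XS step_def intro: sigma_sets.Compl sigma_sets_Un)
  qed
  have "algebra \<Omega> (\<Union>n. X n)"
    unfolding algebra_iff_Un
  proof (intro conjI ballI)
    show "(\<Union>n. X n) \<subseteq> Pow \<Omega>" using sub sigma_sets_into_sp[OF assms(2)] by blast
    show "{} \<in> (\<Union>n. X n)" using X0 by blast
  next
    fix a assume "a \<in> (\<Union>n. X n)"
    then obtain n where "a \<in> X n" by blast
    then have "\<Omega> - a \<in> X (Suc n)" by (auto simp: XS step_def)
    then show "\<Omega> - a \<in> (\<Union>n. X n)" by blast
  next
    fix a b assume "a \<in> (\<Union>n. X n)" "b \<in> (\<Union>n. X n)"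
    then obtain n m where "a \<in> X n" "b \<in> X m" by blast
    then have "a \<in> X (max n m)" "b \<in> X (max n m)" using mono[of n "max n m"] mono[of m "max n m"] by auto
    then have "a \<union> b \<in> X (Suc (max n m))" by (force simp: XS step_def)
    then show "a \<union> b \<in> (\<Union>n. X n)" by blast
  qed
  then show ?thesis using cnt sub X0 by (intro exI[of _ "\<Union>n. X n"]) blast
qed

lemma path_space_countably_generated:
  assumes "countable (carrier G)"
  shows "\<exists>\<C>. countable \<C> \<and> algebra (space (path_space G)) \<C> \<and>
    sets (path_space G) = sigma_sets (space (path_space G)) \<C>"
proof -
  let ?\<Omega> = "space (path_space G)"
  define S where "S = (\<lambda>(n, g). {y \<in> ?\<Omega>. y n = g}) ` (UNIV \<times> carrier G)"
  have "countable S" "S \<subseteq> Pow ?\<Omega>" unfolding S_def using assms by auto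
  from countable_algebra[OF this] obtain \<C> where C: "countable \<C>" "S \<subseteq> \<C>" "\<C> \<subseteq> sigma_sets ?\<Omega> S" "algebra ?\<Omega> \<C>"
    by (elim exE conjE)
  have S_sets: "S \<subseteq> sets (path_space G)"
  proof
    fix A assume "A \<in> S"
    then obtain n g where A: "g \<in> carrier G" "A = {y \<in> ?\<Omega>. y n = g}" by (auto simp: S_def)
    have "A = (\<lambda>y. y n) -` {g} \<inter> ?\<Omega>" using A by auto
    also have "\<dots> \<in> sets (path_space G)"
      using A by (intro measurable_sets[OF measurable_path_space_component]) auto
    finally show "A \<in> sets (path_space G)" .
  qed
  have "sets (path_space G) \<subseteq> sigma_sets ?\<Omega> S"
  proof -
    have "sets (path_space G) = sigma_sets ?\<Omega> {{f \<in> ?\<Omega>. f i \<in> A} | i A. A \<subseteq> carrier G}"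
      unfolding path_space_def by (subst sets_PiM_single) (simp add: space_PiM)
    also have "\<dots> \<subseteq> sigma_sets ?\<Omega> S"
    proof (rule sigma_sets_mono, rule subsetI)
      fix B assume "B \<in> {{f \<in> ?\<Omega>. f i \<in> A} | i A. A \<subseteq> carrier G}"
      then obtain i A where A: "A \<subseteq> carrier G" "B = {f \<in> ?\<Omega>. f i \<in> A}" by blast
      then have "B = (\<Union>g\<in>A. {f \<in> ?\<Omega>. f i = g})" by auto
      also have "\<dots> \<in> sigma_sets ?\<Omega> S"
        by (rule sigma_sets_UNION) (use A assms countable_subset[OF A(1)] in \<open>force simp: S_def intro: sigma_sets.Basic\<close>)+
      finally show "B \<in> sigma_sets ?\<Omega> S" .
    qed
    finally show ?thesis .
  qed
  moreover have "sigma_sets ?\<Omega> S \<subseteq> sigma_sets ?\<Omega> \<C>" using C(2) by (rule sigma_sets_mono')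
  moreover have "sigma_sets ?\<Omega> \<C> \<subseteq> sets (path_space G)"
    using C(3) S_sets by (intro sets.sigma_sets_subset) (meson sets.sigma_sets_subset subset_trans)
  ultimately show ?thesis using C(1,4) by blast
qed

lemma (in finite_measure) separable_subfamily:
  assumes alg: "algebra (space M) \<C>" and gen: "sets M = sigma_sets (space M) \<C>" and cnt: "countable \<C>"
    and F: "\<F> \<subseteq> sets M"
  shows "\<exists>\<D>. countable \<D> \<and> \<D> \<subseteq> \<F> \<and>
    (\<forall>E \<in> \<F>. \<exists>B \<in> sigma_sets (space M) \<D>. AE x in M. x \<in> E \<longleftrightarrow> x \<in> B)"
proof -
  define ok where "ok C n E \<longleftrightarrow> E \<in> \<F> \<and> measure M (sym_diff E C) < (1/2)^n" for C E and n :: nat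
  define d where "d = (\<lambda>(C, n). SOME E. ok C n E)"
  define I where "I = {(C, n) | C n. C \<in> \<C> \<and> (\<exists>E. ok C n E)}"
  have d: "ok C n (d (C, n))" if "(C, n) \<in> I" for C n
    using that someI_ex[of "ok C n"] by (auto simp: I_def d_def)
  have sub: "\<C> \<subseteq> sets M" unfolding gen by auto
  have "countable I" by (rule countable_subset[of _ "\<C> \<times> UNIV"]) (auto simp: I_def cnt)
  then have "countable (d ` I)" by blast
  moreover have "d ` I \<subseteq> \<F>" using d by (auto simp: ok_def)
  moreover have "\<exists>B \<in> sigma_sets (space M) (d ` I). AE x in M. x \<in> E \<longleftrightarrow> x \<in> B" if E: "E \<in> \<F>" for E
  proof -
    have Em: "E \<in> sets M" using E F by blast
    have "\<forall>n::nat. \<exists>C \<in> \<C>. measure M (sym_diff E C) < (1/2)^n"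
      using approx_by_algebra[OF alg gen Em] by simp
    then obtain C where C: "\<And>n. C n \<in> \<C>" "\<And>n. measure M (sym_diff E (C n)) < (1/2)^n" by metis
    have I: "(C n, n) \<in> I" for n using C E by (auto simp: I_def ok_def)
    define D where "D n = d (C n, n)" for n
    have okD: "ok (C n) n (D n)" for n unfolding D_def using I by (rule d)
    then have Dm: "D n \<in> sets M" for n using F by (auto simp: ok_def)
    have Cm: "C n \<in> sets M" for n using C sub by auto
    have bound: "measure M (sym_diff E (D n)) \<le> 2 * (1/2)^n" for n
    proof -
      have "measure M (sym_diff E (D n)) \<le> measure M (sym_diff E (C n) \<union> sym_diff (D n) (C n))"
        using Em Dm Cm by (intro finite_measure_mono) auto
      also have "\<dots> \<le> measure M (sym_diff E (C n)) + measure M (sym_diff (D n) (C n))"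
        using Em Dm Cm by (intro measure_Un_le) auto
      also have "\<dots> \<le> 2 * (1/2)^n" using C(2)[of n] okD[of n] by (simp add: ok_def)
      finally show ?thesis .
    qed
    have ae: "AE x in M. eventually (\<lambda>n. x \<in> space M - sym_diff E (D n)) sequentially"
    proof (rule borel_cantelli_AE1)
      show "sym_diff E (D n) \<in> sets M" for n using Em Dm by auto
      show "emeasure M (sym_diff E (D n)) < \<infinity>" for n
        by (simp add: less_top[symmetric])
      show "summable (\<lambda>n. measure M (sym_diff E (D n)))"
        by (rule summable_comparison_test'[of "\<lambda>n. 2 * (1/2)^n" 0])
           (use bound in \<open>auto intro!: summable_mult summable_geometric\<close>)
    qed
    define B where "B = (\<Union>m. \<Inter>n\<in>{m..}. D n)"
    from ae have "AE x in M. x \<in> E \<longleftrightarrow> x \<in> B"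
    proof eventually_elim
      case (elim x)
      then obtain N where N: "\<And>n. n \<ge> N \<Longrightarrow> x \<in> E \<longleftrightarrow> x \<in> D n"
        by (auto simp: eventually_sequentially)
      show ?case
      proof
        assume "x \<in> E"
        then show "x \<in> B" unfolding B_def using N by blast
      next
        assume "x \<in> B"
        then obtain m where m: "\<And>n. n \<ge> m \<Longrightarrow> x \<in> D n" unfolding B_def by blast
        show "x \<in> E" using N[of "max m N"] m[of "max m N"] by simp
      qed
    qed
    moreover have "B \<in> sigma_sets (space M) (d ` I)"
    proof -
      have cl: "d ` I \<subseteq> Pow (space M)" using \<open>d ` I \<subseteq> \<F>\<close> F sets.space_closed by blast
      interpret S: sigma_algebra "space M" "sigma_sets (space M) (d ` I)"
        using cl by (rule sigma_algebra_sigma_sets)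
      have "D n \<in> sigma_sets (space M) (d ` I)" for n unfolding D_def using I by blast
      then show ?thesis unfolding B_def by (intro S.countable_UN S.countable_INT'') auto
    qed
    ultimately show ?thesis by blast
  qed
  ultimately show ?thesis by (intro exI[of _ "d ` I"] conjI ballI)
qed

theorem exit_base_exists:
  assumes "group G" "countable (carrier G)" "prob_measure_on G \<mu>"
  shows "\<exists>\<A>. is_exit_base G \<mu> \<A>"
proof -
  interpret group G by fact
  obtain \<theta> where \<theta>: "prob_measure_on G \<theta>" "support G \<theta> = carrier G"
    using full_support_exists[OF assms(1,2)] by blast
  have sets\<theta>: "sets \<theta> = Pow (carrier G)" and P\<theta>: "prob_space \<theta>" using \<theta>(1) by (auto simp: prob_measure_on_def)
  then have sp\<theta>: "space \<theta> = carrier G"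
    by (metis sets_eq_imp_space_eq sets_count_space space_count_space)
  have ker: "path_measure G \<mu> \<in> \<theta> \<rightarrow>\<^sub>M subprob_algebra (path_space G)"
    using assms sets\<theta> by (rule path_measure_kernel)
  define P where "P = Giry_Monad.bind \<theta> (path_measure G \<mu>)"
  have setsP: "sets P = sets (path_space G)"
    unfolding P_def by (rule sets_bind) (use sp\<theta> in auto)
  then have spP: "space P = space (path_space G)" by (rule sets_eq_imp_space_eq)
  interpret P: finite_measure P
  proof
    have "emeasure P (space P) = (\<integral>\<^sup>+ g. emeasure (path_measure G \<mu> g) (space P) \<partial>\<theta>)"
      unfolding P_def spP[unfolded P_def] by (rule emeasure_bind[OF _ ker]) (use sp\<theta> in auto)
    also have "\<dots> \<le> (\<integral>\<^sup>+ g. 1 \<partial>\<theta>)"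
      by (intro nn_integral_mono prob_space.measure_le_1 prob_space_path_measure[OF assms]) (simp add: sp\<theta>)
    also have "\<dots> = 1" using P\<theta> by (simp add: prob_space.emeasure_space_1)
    finally show "emeasure P (space P) \<noteq> \<infinity>" by (auto simp: top_unique)
  qed
  have AEP: "(AE y in P. Q y) \<longleftrightarrow> (AE y in path_measure_all G \<mu>. Q y)"
    if "Measurable.pred (path_space G) Q" for Q
    unfolding P_def using that
    by (subst AE_bind[OF ker]) (simp_all add: AE_full_support[OF \<theta> assms(2)] AE_path_measure_all[OF assms])
  obtain \<C> where C: "countable \<C>" "algebra (space P) \<C>" "sets P = sigma_sets (space P) \<C>"
    using path_space_countably_generated[OF assms(2)] unfolding setsP spP by blast
  have "exit_sets G \<mu> \<subseteq> sets P" unfolding setsP by (auto simp: exit_sets_def)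
  from P.separable_subfamily[OF C(2,3,1) this] obtain \<D> where D: "countable \<D>" "\<D> \<subseteq> exit_sets G \<mu>"
    "\<And>E. E \<in> exit_sets G \<mu> \<Longrightarrow> \<exists>B \<in> sigma_sets (space P) \<D>. AE x in P. x \<in> E \<longleftrightarrow> x \<in> B"
    by blast
  define \<A> where "\<A> = (\<lambda>(g, A). translate G g ` A) ` (carrier G \<times> \<D>)"
  have sets_D: "A \<subseteq> space (path_space G)" if "A \<in> \<D>" for A
    using that D(2) by (auto simp: exit_sets_def dest: sets.sets_into_space)
  have "countable \<A>" unfolding \<A>_def using D(1) assms(2) by auto
  moreover have A_exit: "\<A> \<subseteq> exit_sets G \<mu>"
    unfolding \<A>_def using D(2) exit_sets_translate[OF assms] by auto
  moreover have "translate G g ` A \<in> \<A>" if "g \<in> carrier G" "A \<in> \<A>" for g A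
  proof -
    obtain h B where B: "h \<in> carrier G" "B \<in> \<D>" "A = translate G h ` B"
      using \<open>A \<in> \<A>\<close> unfolding \<A>_def by force
    have "translate G g ` A = translate G (g \<otimes>\<^bsub>G\<^esub> h) ` B"
      unfolding B(3) image_image
    proof (rule image_cong[OF refl])
      fix y assume "y \<in> B"
      then have "y n \<in> carrier G" for n using sets_D[OF B(2)] by (auto simp: space_path_space)
      then show "translate G g (translate G h y) = translate G (g \<otimes>\<^bsub>G\<^esub> h) y"
        using that B by (auto simp: translate_def m_assoc)
    qed
    then show ?thesis unfolding \<A>_def using B that by force
  qed
  moreover have "\<exists>B \<in> sigma_sets (space (path_space G)) \<A>. AE y in path_measure_all G \<mu>. y \<in> E \<longleftrightarrow> y \<in> B"
    if E: "E \<in> exit_sets G \<mu>" for E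
  proof -
    have "\<D> \<subseteq> \<A>"
    proof
      fix A assume A: "A \<in> \<D>"
      have "translate G \<one>\<^bsub>G\<^esub> ` A = (\<lambda>y. y) ` A"
      proof (rule image_cong[OF refl])
        fix y assume "y \<in> A"
        then have "y n \<in> carrier G" for n using sets_D[OF A] by (auto simp: space_path_space)
        then show "translate G \<one>\<^bsub>G\<^esub> y = y" by (auto simp: translate_def)
      qed
      then show "A \<in> \<A>" unfolding \<A>_def using A by (intro image_eqI[of _ _ "(\<one>\<^bsub>G\<^esub>, A)"]) auto
    qed
    then have sub: "sigma_sets (space P) \<D> \<subseteq> sigma_sets (space (path_space G)) \<A>"
      unfolding spP by (rule sigma_sets_mono')
    obtain B where B: "B \<in> sigma_sets (space P) \<D>" "AE x in P. x \<in> E \<longleftrightarrow> x \<in> B" using D(3)[OF E] by blast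
    have "sigma_sets (space P) \<D> \<subseteq> sets P"
      using D(2) \<open>exit_sets G \<mu> \<subseteq> sets P\<close> by (intro sets.sigma_sets_subset) auto
    then have Bm: "B \<in> sets (path_space G)" using B(1) setsP by auto
    have Em: "E \<in> sets (path_space G)" using E by (simp add: exit_sets_def)
    have "Measurable.pred (path_space G) (\<lambda>x. x \<in> E \<longleftrightarrow> x \<in> B)" using Bm Em by measurable
    then have "AE y in path_measure_all G \<mu>. y \<in> E \<longleftrightarrow> y \<in> B" using AEP B(2) by simp
    then show ?thesis using subsetD[OF sub B(1)] by (intro bexI[of _ B])
  qed
  ultimately show ?thesis unfolding is_exit_base_def by (intro exI[of _ \<A>] conjI ballI)
qed

lemma is_exit_base_exit_base:
  assumes "group G" "countable (carrier G)" "prob_measure_on G \<mu>"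
  shows "is_exit_base G \<mu> (exit_base G \<mu>)"
  unfolding exit_base_def using exit_base_exists[OF assms] by (rule someI_ex)

lemma boundary_action_bnd:
  assumes "group G" "countable (carrier G)" "prob_measure_on G \<mu>" "g \<in> carrier G"
    and y: "y \<in> space (path_space G)"
  shows "boundary_action G g (bnd G \<mu> y) = bnd G \<mu> (translate G g y)"
proof -
  interpret group G by fact
  let ?\<Omega> = "space (path_space G)"
  have base: "is_exit_base G \<mu> (exit_base G \<mu>)" using assms by (intro is_exit_base_exit_base)
  have A: "translate G h ` A \<in> exit_base G \<mu>" "A \<subseteq> ?\<Omega>"
    if "A \<in> exit_base G \<mu>" "h \<in> carrier G" for A h
    using base that by (auto simp: is_exit_base_def exit_sets_def dest!: sets.sets_into_space)
  have sp: "translate G h z \<in> ?\<Omega>" if "h \<in> carrier G" "z \<in> ?\<Omega>" for h z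
    using that by (auto simp: translate_def space_path_space)
  have inv: "translate G h z \<in> A \<longleftrightarrow> z \<in> translate G (inv\<^bsub>G\<^esub> h) ` A"
    if "A \<in> exit_base G \<mu>" "h \<in> carrier G" "z \<in> ?\<Omega>" for A h z
    using translate_image_eq[OF assms(1), of "inv\<^bsub>G\<^esub> h" A] that A(2)[of A h] by auto
  have eq: "(\<forall>A \<in> exit_base G \<mu>. translate G h z \<in> A \<longleftrightarrow> translate G h w \<in> A) \<longleftrightarrow>
      (\<forall>A \<in> exit_base G \<mu>. z \<in> A \<longleftrightarrow> w \<in> A)" if h: "h \<in> carrier G" and "z \<in> ?\<Omega>" "w \<in> ?\<Omega>" for h z w
  proof
    assume L: "\<forall>A \<in> exit_base G \<mu>. translate G h z \<in> A \<longleftrightarrow> translate G h w \<in> A"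
    show "\<forall>A \<in> exit_base G \<mu>. z \<in> A \<longleftrightarrow> w \<in> A"
    proof
      fix A assume a: "A \<in> exit_base G \<mu>"
      have s: "translate G (inv\<^bsub>G\<^esub> h) ` (translate G h ` A) = A"
        using translate_image_eq[OF assms(1), of "inv\<^bsub>G\<^esub> h" "translate G h ` A"] h A[OF a h] sp
        using A(2)[OF A(1)[OF a h] h]
      proof -
        have "translate G (inv\<^bsub>G\<^esub> h) (translate G h v) = v" if "v \<in> A" for v
          using that A(2)[OF a h] h by (auto simp: translate_def space_path_space m_assoc[symmetric] fun_eq_iff PiE_iff subset_iff)
        then show ?thesis by (simp add: image_image)
      qed
      show "z \<in> A \<longleftrightarrow> w \<in> A"
        using L[rule_format, OF A(1)[OF a h]] inv[OF A(1)[OF a h] h] that s by simp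
    qed
  qed (use that inv A(1) in auto)
  show ?thesis
  proof -
    have "boundary_action G g (bnd G \<mu> y) = translate G (inv\<^bsub>G\<^esub> g) -` bnd G \<mu> y \<inter> ?\<Omega>"
      unfolding boundary_action_def by (rule translate_image_eq) (use assms in \<open>auto simp: bnd_def\<close>)
    also have "\<dots> = bnd G \<mu> (translate G g y)"
    proof -
      have yy: "translate G (inv\<^bsub>G\<^esub> g) (translate G g y) = y"
        using y assms(4) by (auto simp: translate_def space_path_space m_assoc[symmetric] fun_eq_iff PiE_iff)
      have "z \<in> translate G (inv\<^bsub>G\<^esub> g) -` bnd G \<mu> y \<longleftrightarrow> z \<in> bnd G \<mu> (translate G g y)" if z: "z \<in> ?\<Omega>" for z
        using eq[of "inv\<^bsub>G\<^esub> g" z "translate G g y"] z y sp[of g y] sp[of "inv\<^bsub>G\<^esub> g" z] assms(4) yy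
        by (simp add: bnd_def)
      moreover have "bnd G \<mu> (translate G g y) \<subseteq> ?\<Omega>" by (auto simp: bnd_def)
      ultimately show ?thesis by blast
    qed
    finally show ?thesis .
  qed
qed

lemma measurable_bnd: "bnd G \<mu> \<in> path_space G \<rightarrow>\<^sub>M poisson_boundary G \<mu>"
  unfolding poisson_boundary_def
  by (rule measurable_measure_of) (auto simp: exit_sets_def)

end

theory Submission
  imports Defs
begin

text \<open>
The boundary and the algebra of the group communicate through bounded harmonic functions: an
element fixes almost every point of the Poisson boundary exactly if left translation by it
preserves every bounded harmonic function (\<open>pointwise_stabilizer_harmonic\<close>). On the one hand a
bounded harmonic function is the expectation of its boundary values, an almost sure limit along
the paths (\<open>harmonic_boundary_values\<close>). On the other hand an exit set is determined modulo null
sets by the harmonic function of its probabilities (\<open>exit_sets_eq_AE\<close>).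

From (ii) to (iii). Let \<open>H\<close> be the pointwise stabilizer for \<open>\<mu>\<close>, and \<open>P\<close> the Markov operator.
Limits of the Cesaro averages of \<open>P\<^sup>k 1\<^sub>A\<close> are harmonic, hence \<open>H\<close>-invariant, and their values at the
identity are an \<open>H\<close>-invariant mean on \<open>G\<close>; so \<open>H\<close> is amenable (\<open>pointwise_stabilizer_amenable\<close>).
If \<open>f\<close> is bounded and harmonic, then \<open>f (y n \<otimes> z) - f (y n)\<close> tends to zero in mean square for every \<open>z\<close>. An
element \<open>g\<close> with a finite conjugacy class modulo \<open>H\<close> satisfies \<open>f (g \<otimes> y n) = f (y n \<otimes> c)\<close> with \<open>c\<close> in a
finite set, so it preserves \<open>f\<close> and lies in \<open>H\<close> (\<open>quotient_by_pointwise_stabilizer_icc\<close>).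

From (iii) to (i). A step is drawn in two stages: first a level \<open>n\<close>, from a distribution with
tail \<open>1/n\<close>, then \<open>g n \<otimes> l\<close> with \<open>l\<close> uniform in a finite set \<open>\<Lambda> n \<subseteq> H\<close>; with a small
probability that depends on \<open>n\<close>, the \<open>n\<close>-th element of an enumeration of \<open>G\<close> is taken instead,
which makes the measure non-degenerate. The tail is such that almost surely from some time on
every record of the levels is attained by a single step, which is not one of these exceptional
steps, and a record \<open>n\<close> is surpassed within a number of steps bounded in terms of \<open>n\<close>
(\<open>AE_eventually_good\<close>). Hence the positions just before a record step of level \<open>n\<close>, and the
products of the steps up to the next record, stay in a finite set that is known before \<open>g n\<close> and
\<open>\<Lambda> n\<close> are chosen. This leaves room for two requirements (\<open>step_design_exists\<close>):

  \<^item> Modulo \<open>H\<close>, the product \<open>u \<otimes> g n \<otimes> w\<close> of elements \<open>u\<close>, \<open>w\<close> of that finite set with \<open>g n\<close>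
    determines \<open>n\<close> and \<open>u\<close>. Then every position on the path remembers the positions before the past
    records, and translation by an element outside \<open>H\<close> changes this memory: it fixes almost
    no boundary point (\<open>outside_elements_move_boundary_points\<close>). Such \<open>g n\<close> exist because the
    conjugacy classes of \<open>G/H\<close> are infinite (\<open>decoding_element\<close>).

  \<^item> \<open>\<Lambda> n\<close> is almost invariant under the finitely many elements of \<open>H\<close> that result from moving a given
    element of \<open>H\<close> past \<open>u \<otimes> g n\<close>. Then a translation by an element of \<open>H\<close> is forgotten at the first step of a
    high level, so it preserves all bounded harmonic functions (\<open>harmonic_H_invariant\<close>). Such
    \<open>\<Lambda> n\<close> exist because \<open>H\<close> is amenable: an invariant finitely additive measure excludes
    paradoxical decompositions, and these would result from the marriage theorem if there were
    no Foelner sets (\<open>foelner_sets\<close>).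
\<close>

section \<open>The Markov operator and the Markov property\<close>

locale random_walk = group G for G (structure) +
  fixes \<mu> :: "'a measure"
  assumes countable_carrier: "countable (carrier G)"
    and prob_measure: "prob_measure_on G \<mu>"
begin

lemma sets_step: "sets \<mu> = Pow (carrier G)"
  using prob_measure by (simp add: prob_measure_on_def)

lemma space_step [simp]: "space \<mu> = carrier G"
  using sets_step by (metis sets_eq_imp_space_eq sets_count_space space_count_space)

sublocale step: prob_space \<mu>
  using prob_measure by (simp add: prob_measure_on_def)

sublocale steps: product_prob_space "\<lambda>_. \<mu>" "UNIV :: nat set"
  by unfold_locales

sublocale steps: sequence_space \<mu>
  by unfold_locales

lemma borel_measurable_step [measurable, simp]: "f \<in> borel_measurable \<mu>" for f :: "'a \<Rightarrow> 'c::topological_space"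
  by (simp add: measurable_def sets_step)

lemma integrable_step:
  fixes f :: "'a \<Rightarrow> real"
  assumes "\<And>s. s \<in> carrier G \<Longrightarrow> \<bar>f s\<bar> \<le> c"
  shows "integrable \<mu> f"
  by (rule step.integrable_const_bound[of _ c]) (use assms in \<open>auto intro!: AE_I2\<close>)

definition bounded_fun :: "('a \<Rightarrow> real) \<Rightarrow> bool" where
  "bounded_fun f \<longleftrightarrow> (\<exists>c. \<forall>x \<in> carrier G. \<bar>f x\<bar> \<le> c)"

definition markov_op :: "('a \<Rightarrow> real) \<Rightarrow> 'a \<Rightarrow> real" where
  "markov_op f x = (\<integral>s. f (x \<otimes> s) \<partial>\<mu>)"

definition harmonic :: "('a \<Rightarrow> real) \<Rightarrow> bool" where
  "harmonic f \<longleftrightarrow> bounded_fun f \<and> (\<forall>x \<in> carrier G. markov_op f x = f x)"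

lemma harmonicD: "harmonic f \<Longrightarrow> x \<in> carrier G \<Longrightarrow> markov_op f x = f x"
  by (simp add: harmonic_def)

lemma bounded_funE:
  assumes "bounded_fun f"
  obtains c where "0 < c" "\<And>x. x \<in> carrier G \<Longrightarrow> \<bar>f x\<bar> \<le> c"
proof -
  from assms obtain c where "\<forall>x \<in> carrier G. \<bar>f x\<bar> \<le> c" by (auto simp: bounded_fun_def)
  then show thesis by (intro that[of "max c 1"]) (auto intro: order_trans)
qed

lemma bounded_fun_translate: "bounded_fun f \<Longrightarrow> z \<in> carrier G \<Longrightarrow> bounded_fun (\<lambda>x. f (x \<otimes> z))"
  and bounded_fun_left: "bounded_fun f \<Longrightarrow> z \<in> carrier G \<Longrightarrow> bounded_fun (\<lambda>x. f (z \<otimes> x))"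
  by (auto simp: bounded_fun_def)

lemma bounded_fun_diff: "bounded_fun f \<Longrightarrow> bounded_fun g \<Longrightarrow> bounded_fun (\<lambda>x. f x - g x)"
  unfolding bounded_fun_def by (metis abs_triangle_ineq4 add_mono order_trans)

lemma bounded_fun_add: "bounded_fun f \<Longrightarrow> bounded_fun g \<Longrightarrow> bounded_fun (\<lambda>x. f x + g x)"
  unfolding bounded_fun_def by (metis abs_triangle_ineq add_mono order_trans)

lemma bounded_fun_mult: "bounded_fun f \<Longrightarrow> bounded_fun g \<Longrightarrow> bounded_fun (\<lambda>x. f x * g x)"
proof -
  assume "bounded_fun f" "bounded_fun g"
  then obtain a b where "0 < a" "0 < b" "\<And>x. x \<in> carrier G \<Longrightarrow> \<bar>f x\<bar> \<le> a" "\<And>x. x \<in> carrier G \<Longrightarrow> \<bar>g x\<bar> \<le> b"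
    by (metis bounded_funE)
  then show ?thesis unfolding bounded_fun_def
    by (intro exI[of _ "a * b"]) (auto simp: abs_mult intro: mult_mono)
qed

lemma bounded_fun_const: "bounded_fun (\<lambda>_. c)"
  by (auto simp: bounded_fun_def)

lemma bounded_fun_power2: "bounded_fun f \<Longrightarrow> bounded_fun (\<lambda>x. (f x)\<^sup>2)"
  using bounded_fun_mult[of f f] by (simp add: power2_eq_square)

lemma integrable_markov: "bounded_fun f \<Longrightarrow> x \<in> carrier G \<Longrightarrow> integrable \<mu> (\<lambda>s. f (x \<otimes> s))"
  by (erule bounded_funE) (rule integrable_step, auto)

lemma markov_op_cong:
  "(\<And>x. x \<in> carrier G \<Longrightarrow> f x = g x) \<Longrightarrow> x \<in> carrier G \<Longrightarrow> markov_op f x = markov_op g x"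
  unfolding markov_op_def by (intro Bochner_Integration.integral_cong) auto

lemma markov_op_mono:
  assumes "bounded_fun f" "bounded_fun g" "\<And>x. x \<in> carrier G \<Longrightarrow> f x \<le> g x" "x \<in> carrier G"
  shows "markov_op f x \<le> markov_op g x"
  unfolding markov_op_def using assms
  by (intro integral_mono integrable_markov) auto

lemma markov_op_const [simp]: "markov_op (\<lambda>_. c) x = c"
  by (simp add: markov_op_def step.prob_space[simplified])

lemma markov_op_diff:
  assumes "bounded_fun f" "bounded_fun g" "x \<in> carrier G"
  shows "markov_op (\<lambda>x. f x - g x) x = markov_op f x - markov_op g x"
  unfolding markov_op_def using assms by (intro Bochner_Integration.integral_diff integrable_markov)

lemma markov_op_add:
  assumes "bounded_fun f" "bounded_fun g" "x \<in> carrier G"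
  shows "markov_op (\<lambda>x. f x + g x) x = markov_op f x + markov_op g x"
  unfolding markov_op_def using assms by (intro Bochner_Integration.integral_add integrable_markov)

lemma markov_op_cmult: "markov_op (\<lambda>x. c * f x) x = c * markov_op f x"
  unfolding markov_op_def by simp

lemma abs_markov_op_le:
  assumes "\<And>x. x \<in> carrier G \<Longrightarrow> \<bar>f x\<bar> \<le> c" "x \<in> carrier G"
  shows "\<bar>markov_op f x\<bar> \<le> c"
proof -
  have f: "bounded_fun f" using assms(1) by (auto simp: bounded_fun_def)
  have "markov_op f x \<le> markov_op (\<lambda>_. c) x" "markov_op (\<lambda>_. - c) x \<le> markov_op f x"
    using assms by (intro markov_op_mono bounded_fun_const f; force simp: abs_le_iff)+
  then show ?thesis by simp
qed

lemma bounded_markov_op: "bounded_fun f \<Longrightarrow> bounded_fun (markov_op f)"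
  unfolding bounded_fun_def by (metis abs_markov_op_le)

lemma markov_op_left:
  assumes "z \<in> carrier G" "x \<in> carrier G"
  shows "markov_op (\<lambda>x. f (z \<otimes> x)) x = markov_op f (z \<otimes> x)"
  unfolding markov_op_def using assms
  by (intro Bochner_Integration.integral_cong) (auto simp: m_assoc)

lemma harmonic_left:
  assumes "harmonic f" "z \<in> carrier G"
  shows "harmonic (\<lambda>x. f (z \<otimes> x))"
  using assms by (simp add: harmonic_def bounded_fun_left markov_op_left)

lemma harmonic_diff:
  assumes "harmonic f" "harmonic g"
  shows "harmonic (\<lambda>x. f x - g x)"
  using assms by (simp add: harmonic_def bounded_fun_diff markov_op_diff)

lemma bounded_markov_pow: "bounded_fun f \<Longrightarrow> bounded_fun ((markov_op ^^ n) f)"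
  by (induction n) (simp_all add: bounded_markov_op)

lemma abs_markov_pow_le:
  assumes "\<And>x. x \<in> carrier G \<Longrightarrow> \<bar>f x\<bar> \<le> c" "x \<in> carrier G"
  shows "\<bar>(markov_op ^^ n) f x\<bar> \<le> c"
  using assms(2) by (induction n arbitrary: x) (simp_all add: assms(1) abs_markov_op_le)

lemma markov_pow_mono:
  assumes "bounded_fun f" "bounded_fun g" "\<And>x. x \<in> carrier G \<Longrightarrow> f x \<le> g x" "x \<in> carrier G"
  shows "(markov_op ^^ n) f x \<le> (markov_op ^^ n) g x"
  using assms(4) by (induction n arbitrary: x) (simp_all add: assms bounded_markov_pow markov_op_mono)

lemma markov_pow_add:
  assumes "bounded_fun f" "bounded_fun g" "x \<in> carrier G"
  shows "(markov_op ^^ n) (\<lambda>x. f x + g x) x = (markov_op ^^ n) f x + (markov_op ^^ n) g x"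
  using assms(3)
proof (induction n arbitrary: x)
  case (Suc n)
  have "(markov_op ^^ Suc n) (\<lambda>x. f x + g x) x
      = markov_op (\<lambda>x. (markov_op ^^ n) f x + (markov_op ^^ n) g x) x"
    using Suc by (auto intro: markov_op_cong)
  then show ?case using assms Suc by (simp add: markov_op_add bounded_markov_pow)
qed simp

lemma markov_pow_diff:
  assumes "bounded_fun f" "bounded_fun g" "x \<in> carrier G"
  shows "(markov_op ^^ n) (\<lambda>x. f x - g x) x = (markov_op ^^ n) f x - (markov_op ^^ n) g x"
  using assms(3)
proof (induction n arbitrary: x)
  case (Suc n)
  have "(markov_op ^^ Suc n) (\<lambda>x. f x - g x) x
      = markov_op (\<lambda>x. (markov_op ^^ n) f x - (markov_op ^^ n) g x) x"
    using Suc by (auto intro: markov_op_cong)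
  then show ?case using assms Suc by (simp add: markov_op_diff bounded_markov_pow)
qed simp

lemma markov_pow_cmult: "(markov_op ^^ n) (\<lambda>x. c * f x) = (\<lambda>x. c * (markov_op ^^ n) f x)"
proof (induction n)
  case (Suc n)
  then have "(markov_op ^^ Suc n) (\<lambda>x. c * f x) = markov_op (\<lambda>x. c * (markov_op ^^ n) f x)" by simp
  then show ?case by (simp add: fun_eq_iff markov_op_cmult)
qed simp

lemma markov_pow_sum:
  assumes "\<And>c. c \<in> C \<Longrightarrow> bounded_fun (F c)" "x \<in> carrier G"
  shows "(markov_op ^^ n) (\<lambda>x. \<Sum>c\<in>C. F c x) x = (\<Sum>c\<in>C. (markov_op ^^ n) (F c) x)"
proof -
  have bs: "bounded_fun (\<lambda>x. \<Sum>c\<in>A. F c x)" if "A \<subseteq> C" "finite A" for A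
    using that(2,1) by (induction A) (auto intro!: bounded_fun_const bounded_fun_add assms(1))
  have "finite A \<Longrightarrow> A \<subseteq> C \<Longrightarrow> (markov_op ^^ n) (\<lambda>x. \<Sum>c\<in>A. F c x) x = (\<Sum>c\<in>A. (markov_op ^^ n) (F c) x)" for A
  proof (induction A rule: finite_induct)
    case empty
    have "(markov_op ^^ n) (\<lambda>_. 0) x = 0" using markov_pow_cmult[of n 0 "\<lambda>_. 0"] by (simp add: fun_eq_iff)
    then show ?case by simp
  next
    case (insert a A)
    then show ?case using bs assms by (simp add: markov_pow_add)
  qed
  then show ?thesis
  proof (cases "finite C")
    case False
    have "(markov_op ^^ n) (\<lambda>_. 0) x = 0" using markov_pow_cmult[of n 0 "\<lambda>_. 0"] by (simp add: fun_eq_iff)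
    then show ?thesis using False by simp
  qed simp
qed

lemma harmonic_pow: "harmonic f \<Longrightarrow> x \<in> carrier G \<Longrightarrow> (markov_op ^^ n) f x = f x"
proof (induction n arbitrary: x)
  case (Suc n)
  have "(markov_op ^^ Suc n) f x = markov_op f x"
    using Suc by (auto intro: markov_op_cong)
  then show ?case using Suc by (simp add: harmonicD)
qed simp

abbreviation P :: "'a \<Rightarrow> (nat \<Rightarrow> 'a) measure" where
  "P \<equiv> path_measure G \<mu>"

abbreviation \<Omega> :: "(nat \<Rightarrow> 'a) set" where
  "\<Omega> \<equiv> space (path_space G)"

lemma space_P [simp]: "space (P g) = \<Omega>"
  by (rule sets_eq_imp_space_eq) (rule sets_path_measure)

lemma prob_space_P: "g \<in> carrier G \<Longrightarrow> prob_space (P g)"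
  by (intro prob_space_path_measure group_axioms countable_carrier prob_measure)

lemma measurable_walk' [measurable]:
  "g \<in> carrier G \<Longrightarrow> walk G g \<in> (\<Pi>\<^sub>M n \<in> (UNIV :: nat set). \<mu>) \<rightarrow>\<^sub>M path_space G"
  by (intro measurable_walk group_axioms countable_carrier prob_measure)

lemma walk_case_nat: "walk G g (case_nat s x) = case_nat g (walk G (g \<otimes> s) x)"
proof
  fix n
  show "walk G g (case_nat s x) n = case_nat g (walk G (g \<otimes> s) x) n"
  proof (induction n)
    case (Suc n)
    then show ?case by (cases n) auto
  qed simp
qed

lemma measurable_case_nat_path [measurable]:
  assumes "g \<in> carrier G"
  shows "case_nat g \<in> path_space G \<rightarrow>\<^sub>M path_space G"
proof (rule measurable_to_path_space)
  fix n show "(\<lambda>x. case n of 0 \<Rightarrow> g | Suc m \<Rightarrow> x m) \<in> path_space G \<rightarrow>\<^sub>M count_space (carrier G)"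
    using assms by (cases n) (auto intro: measurable_path_space_component)
qed

lemma measurable_first_step:
  "g \<in> carrier G \<Longrightarrow> (\<lambda>(s, x). walk G (g \<otimes> s) x) \<in> \<mu> \<Otimes>\<^sub>M (\<Pi>\<^sub>M n \<in> (UNIV :: nat set). \<mu>) \<rightarrow>\<^sub>M path_space G"
proof -
  assume g: "g \<in> carrier G"
  have s: "sets \<mu> = sets (count_space (carrier G))" by (simp add: sets_step)
  have fst: "fst \<in> \<mu> \<Otimes>\<^sub>M (\<Pi>\<^sub>M n \<in> (UNIV :: nat set). \<mu>) \<rightarrow>\<^sub>M count_space (carrier G)"
    by (subst measurable_cong_sets[OF refl s[symmetric]]) measurable
  have "(\<lambda>p. walk G (g \<otimes> fst p) (snd p)) \<in> \<mu> \<Otimes>\<^sub>M (\<Pi>\<^sub>M n \<in> (UNIV :: nat set). \<mu>) \<rightarrow>\<^sub>M path_space G"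
  proof (rule measurable_compose_countable'[OF _ fst countable_carrier])
    fix s assume "s \<in> carrier G"
    then show "(\<lambda>p. walk G (g \<otimes> s) (snd p)) \<in> \<mu> \<Otimes>\<^sub>M (\<Pi>\<^sub>M n \<in> (UNIV :: nat set). \<mu>) \<rightarrow>\<^sub>M path_space G"
      using g by (intro measurable_compose[OF measurable_snd measurable_walk']) auto
  qed
  then show ?thesis by (simp add: case_prod_beta')
qed

text \<open>The increments after the first one form an independent copy of the whole sequence of
  increments, so after its first step the path is a path from the new position.\<close>

lemma nn_integral_first_step:
  assumes [measurable]: "F \<in> borel_measurable (path_space G)" and g: "g \<in> carrier G"
  shows "(\<integral>\<^sup>+ y. F y \<partial>P g) = (\<integral>\<^sup>+ s. (\<integral>\<^sup>+ y. F (case_nat g y) \<partial>P (g \<otimes> s)) \<partial>\<mu>)"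
proof -
  note [measurable] = measurable_first_step[OF g] measurable_case_nat_path[OF g] measurable_walk'[OF g]
  let ?X = "\<Pi>\<^sub>M n \<in> (UNIV :: nat set). \<mu>"
  have "(\<integral>\<^sup>+ y. F y \<partial>P g) = (\<integral>\<^sup>+ x. F (walk G g x) \<partial>?X)"
    unfolding path_measure_def by (rule nn_integral_distr) auto
  also have "\<dots> = (\<integral>\<^sup>+ x. F (walk G g x) \<partial>distr (\<mu> \<Otimes>\<^sub>M ?X) ?X (\<lambda>(s, x). case_nat s x))"
    by (subst steps.PiM_iter) simp
  also have "\<dots> = (\<integral>\<^sup>+ p. F (walk G g (case_nat (fst p) (snd p))) \<partial>(\<mu> \<Otimes>\<^sub>M ?X))"
    by (subst nn_integral_distr) (auto simp: case_prod_beta')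
  also have "\<dots> = (\<integral>\<^sup>+ p. F (case_nat g (walk G (g \<otimes> fst p) (snd p))) \<partial>(\<mu> \<Otimes>\<^sub>M ?X))"
    by (simp add: walk_case_nat)
  also have "\<dots> = (\<integral>\<^sup>+ s. \<integral>\<^sup>+ x. F (case_nat g (walk G (g \<otimes> s) x)) \<partial>?X \<partial>\<mu>)"
    using measurable_first_step[OF g] by (subst steps.P.nn_integral_fst[symmetric]) (auto simp: case_prod_beta')
  also have "\<dots> = (\<integral>\<^sup>+ s. (\<integral>\<^sup>+ y. F (case_nat g y) \<partial>P (g \<otimes> s)) \<partial>\<mu>)"
  proof (rule nn_integral_cong)
    fix s assume "s \<in> space \<mu>"
    then show "(\<integral>\<^sup>+ x. F (case_nat g (walk G (g \<otimes> s) x)) \<partial>?X) = (\<integral>\<^sup>+ y. F (case_nat g y) \<partial>P (g \<otimes> s))"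
      unfolding path_measure_def using g by (subst nn_integral_distr) auto
  qed
  finally show ?thesis .
qed

end

section \<open>Boundary values of harmonic functions\<close>

lemma (in prob_space) AE_summable_of_expectation:
  fixes u :: "nat \<Rightarrow> 'a \<Rightarrow> real"
  assumes int: "\<And>k. integrable M (u k)" and pos: "\<And>k x. 0 \<le> u k x"
    and le: "\<And>k. expectation (u k) \<le> b k" and b: "summable b"
  shows "AE x in M. summable (\<lambda>k. u k x)"
proof -
  have [measurable]: "u k \<in> borel_measurable M" for k using int by auto
  have b0: "0 \<le> b k" for k using le[of k] pos Bochner_Integration.integral_nonneg[of M "u k"] by (meson order_trans)
  have "(\<integral>\<^sup>+ x. (\<Sum>k. ennreal (u k x)) \<partial>M) = (\<Sum>k. \<integral>\<^sup>+ x. ennreal (u k x) \<partial>M)"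
    by (rule nn_integral_suminf) auto
  also have "\<dots> = (\<Sum>k. ennreal (expectation (u k)))"
    using int pos by (simp add: nn_integral_eq_integral)
  also have "\<dots> \<le> (\<Sum>k. ennreal (b k))"
    using le by (intro suminf_le) (auto intro: ennreal_leI)
  also have "\<dots> = ennreal (\<Sum>k. b k)"
    using b b0 by (intro suminf_ennreal2) auto
  finally have "(\<integral>\<^sup>+ x. (\<Sum>k. ennreal (u k x)) \<partial>M) \<noteq> \<infinity>"
    by (auto simp: top_unique)
  then have "AE x in M. (\<Sum>k. ennreal (u k x)) \<noteq> \<infinity>"
    by (intro nn_integral_PInf_AE) auto
  then show ?thesis
    by eventually_elim (use pos in \<open>auto intro: summable_suminf_not_top\<close>)
qed

context random_walk
begin

lemma measurable_path_fun [measurable (raw)]: "(\<lambda>y. f (y n)) \<in> borel_measurable (path_space G)"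
  for f :: "'a \<Rightarrow> real"
  by (rule measurable_compose[OF measurable_path_space_component]) simp

lemma path_in_carrier: "y \<in> \<Omega> \<Longrightarrow> y n \<in> carrier G"
  by (auto simp: space_path_space)

lemma integrable_P:
  fixes F :: "(nat \<Rightarrow> 'a) \<Rightarrow> real"
  assumes "F \<in> borel_measurable (path_space G)" "\<And>y. y \<in> \<Omega> \<Longrightarrow> \<bar>F y\<bar> \<le> c" "g \<in> carrier G"
  shows "integrable (P g) F"
proof -
  interpret prob_space "P g" by (rule prob_space_P) fact
  show ?thesis using assms by (intro integrable_const_bound[of _ c]) (auto intro!: AE_I2)
qed

lemma integral_first_step:
  fixes F :: "(nat \<Rightarrow> 'a) \<Rightarrow> real"
  assumes F [measurable]: "F \<in> borel_measurable (path_space G)"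
    and bound: "\<And>y. y \<in> \<Omega> \<Longrightarrow> \<bar>F y\<bar> \<le> c" and g: "g \<in> carrier G"
  shows "(\<integral>y. F y \<partial>P g) = (\<integral>s. (\<integral>y. F (case_nat g y) \<partial>P (g \<otimes> s)) \<partial>\<mu>)"
proof -
  note [measurable] = measurable_first_step[OF g] measurable_case_nat_path[OF g] measurable_walk'[OF g]
  let ?X = "\<Pi>\<^sub>M n \<in> (UNIV :: nat set). \<mu>"
  have m: "(\<lambda>p. F (case_nat g (walk G (g \<otimes> fst p) (snd p)))) \<in> borel_measurable (\<mu> \<Otimes>\<^sub>M ?X)"
    using measurable_first_step[OF g] by (simp add: case_prod_beta')
  have int: "integrable (\<mu> \<Otimes>\<^sub>M ?X) (\<lambda>p. F (case_nat g (walk G (g \<otimes> fst p) (snd p))))"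
  proof -
    interpret prob_space "\<mu> \<Otimes>\<^sub>M ?X" by (rule prob_space_pair) unfold_locales
    show ?thesis
    proof (rule integrable_const_bound[of _ c])
      show "AE p in \<mu> \<Otimes>\<^sub>M ?X. norm (F (case_nat g (walk G (g \<otimes> fst p) (snd p)))) \<le> c"
      proof (rule AE_I2)
        fix p assume "p \<in> space (\<mu> \<Otimes>\<^sub>M ?X)"
        then have "case_nat g (walk G (g \<otimes> fst p) (snd p)) \<in> \<Omega>"
          using measurable_space[OF measurable_case_nat_path[OF g]] measurable_space[OF measurable_first_step[OF g]]
          by (auto simp: case_prod_beta')
        then show "norm (F (case_nat g (walk G (g \<otimes> fst p) (snd p)))) \<le> c" using bound by simp
      qed
    qed (rule m)
  qed
  have "(\<integral>y. F y \<partial>P g) = (\<integral>x. F (walk G g x) \<partial>?X)"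
    unfolding path_measure_def by (rule integral_distr) auto
  also have "\<dots> = (\<integral>x. F (walk G g x) \<partial>distr (\<mu> \<Otimes>\<^sub>M ?X) ?X (\<lambda>(s, x). case_nat s x))"
    by (subst steps.PiM_iter) simp
  also have "\<dots> = (\<integral>p. F (walk G g (case_nat (fst p) (snd p))) \<partial>(\<mu> \<Otimes>\<^sub>M ?X))"
    by (subst integral_distr) (auto simp: case_prod_beta')
  also have "\<dots> = (\<integral>p. F (case_nat g (walk G (g \<otimes> fst p) (snd p))) \<partial>(\<mu> \<Otimes>\<^sub>M ?X))"
    by (simp add: walk_case_nat)
  also have "\<dots> = (\<integral>s. \<integral>x. F (case_nat g (walk G (g \<otimes> s) x)) \<partial>?X \<partial>\<mu>)"
  proof -
    interpret pair_sigma_finite \<mu> ?X by unfold_locales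
    show ?thesis using integral_fst'[OF int] by simp
  qed
  also have "\<dots> = (\<integral>s. (\<integral>y. F (case_nat g y) \<partial>P (g \<otimes> s)) \<partial>\<mu>)"
  proof (rule Bochner_Integration.integral_cong[OF refl])
    fix s assume "s \<in> space \<mu>"
    then show "(\<integral>x. F (case_nat g (walk G (g \<otimes> s) x)) \<partial>?X) = (\<integral>y. F (case_nat g y) \<partial>P (g \<otimes> s))"
      unfolding path_measure_def using g by (subst integral_distr) auto
  qed
  finally show ?thesis .
qed

lemma AE_P_start: "g \<in> carrier G \<Longrightarrow> AE y in P g. y 0 = g"
proof -
  assume g: "g \<in> carrier G"
  have "AE y in distr (\<Pi>\<^sub>M n \<in> (UNIV :: nat set). \<mu>) (path_space G) (walk G g). y 0 = g"
    by (subst AE_distr_iff)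
       (use g in \<open>auto intro!: measurable_sets_Collect[of "\<lambda>y. y 0" _ "count_space (carrier G)" "\<lambda>x. x = g", OF measurable_path_space_component]\<close>)
  then show ?thesis unfolding path_measure_def .
qed

lemma expect_first_step:
  fixes \<phi> :: "(nat \<Rightarrow> 'a) \<Rightarrow> real"
  assumes [measurable]: "\<phi> \<in> borel_measurable (path_space G)"
    and bound: "\<And>y. y \<in> \<Omega> \<Longrightarrow> \<bar>\<phi> y\<bar> \<le> c" and g: "g \<in> carrier G"
  shows "(\<integral>y. \<phi> (shift y) \<partial>P g) = markov_op (\<lambda>x. \<integral>y. \<phi> y \<partial>P x) g"
proof -
  have [measurable]: "shift \<in> path_space G \<rightarrow>\<^sub>M path_space G" by (rule measurable_shift)
  have "shift y \<in> \<Omega>" if "y \<in> \<Omega>" for y using that by (auto simp: shift_def space_path_space)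
  then have "(\<integral>y. \<phi> (shift y) \<partial>P g) = (\<integral>s. (\<integral>y. \<phi> (shift (case_nat g y)) \<partial>P (g \<otimes> s)) \<partial>\<mu>)"
    using bound g by (intro integral_first_step[of _ c]) auto
  then show ?thesis by (simp add: shift_def markov_op_def)
qed

lemma expect_walk:
  assumes f: "bounded_fun f" and g: "g \<in> carrier G"
  shows "(\<integral>y. f (y n) \<partial>P g) = (markov_op ^^ n) f g"
  using g
proof (induction n arbitrary: g)
  case 0
  interpret prob_space "P g" using 0 by (rule prob_space_P)
  have "(\<integral>y. f (y 0) \<partial>P g) = (\<integral>y. f g \<partial>P g)"
    by (rule integral_cong_AE) (use AE_P_start[OF 0] in \<open>auto elim: eventually_mono simp: measurable_cong_sets[OF sets_path_measure refl]\<close>)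
  then show ?case using prob_space by simp
next
  case (Suc n)
  obtain c where c: "\<And>x. x \<in> carrier G \<Longrightarrow> \<bar>f x\<bar> \<le> c" using f by (metis bounded_funE)
  have "(\<integral>y. f (y (Suc n)) \<partial>P g) = (\<integral>y. f (shift y n) \<partial>P g)" by (simp add: shift_def)
  also have "\<dots> = markov_op (\<lambda>x. \<integral>y. f (y n) \<partial>P x) g"
    by (rule expect_first_step[of "\<lambda>y. f (y n)" c]) (use c Suc path_in_carrier in auto)
  also have "\<dots> = markov_op ((markov_op ^^ n) f) g"
    using Suc by (intro markov_op_cong) auto
  finally show ?case by simp
qed

text \<open>By the Markov property the general case reduces to \<open>n = 0\<close>, where \<open>f (y 0)\<close> is constant and
  \<open>f (y k)\<close> has this constant as its expectation. Consequently the increments of the martingale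
  \<open>f (y n)\<close> are orthogonal.\<close>

lemma expect_harmonic_product:
  assumes f: "harmonic f" and g: "g \<in> carrier G"
  shows "(\<integral>y. f (y n) * f (y (n + k)) \<partial>P g) = (markov_op ^^ n) (\<lambda>x. (f x)\<^sup>2) g"
  using g
proof (induction n arbitrary: g)
  case 0
  have b: "bounded_fun f" using f by (simp add: harmonic_def)
  have "(\<integral>y. f (y 0) * f (y (0 + k)) \<partial>P g) = (\<integral>y. f g * f (y k) \<partial>P g)"
    by (rule integral_cong_AE) (use AE_P_start[OF 0] in \<open>auto elim: eventually_mono simp: measurable_cong_sets[OF sets_path_measure refl]\<close>)
  also have "\<dots> = f g * f g" using expect_walk[OF b 0, of k] harmonic_pow[OF f 0] by simp
  finally show ?case by (simp add: power2_eq_square)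
next
  case (Suc n)
  have b: "bounded_fun f" using f by (simp add: harmonic_def)
  then obtain c where c0: "0 < c" and c: "\<And>x. x \<in> carrier G \<Longrightarrow> \<bar>f x\<bar> \<le> c" by (metis bounded_funE)
  have "(\<integral>y. f (y (Suc n)) * f (y (Suc n + k)) \<partial>P g) = (\<integral>y. f (shift y n) * f (shift y (n + k)) \<partial>P g)"
    by (simp add: shift_def)
  also have "\<dots> = markov_op (\<lambda>x. \<integral>y. f (y n) * f (y (n + k)) \<partial>P x) g"
    by (rule expect_first_step[of "\<lambda>y. f (y n) * f (y (n + k))" "c * c"])
       (use c Suc path_in_carrier c0 in \<open>auto simp: abs_mult intro!: mult_mono\<close>)
  also have "\<dots> = markov_op ((markov_op ^^ n) (\<lambda>x. (f x)\<^sup>2)) g"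
    using Suc by (intro markov_op_cong) auto
  finally show ?case by simp
qed

lemma expect_increment_square:
  assumes f: "harmonic f" and g: "g \<in> carrier G" and "m \<le> n"
  shows "(\<integral>y. (f (y n) - f (y m))\<^sup>2 \<partial>P g)
    = (markov_op ^^ n) (\<lambda>x. (f x)\<^sup>2) g - (markov_op ^^ m) (\<lambda>x. (f x)\<^sup>2) g"
proof -
  have b: "bounded_fun f" using f by (simp add: harmonic_def)
  then obtain c where c0: "0 < c" and c: "\<And>x. x \<in> carrier G \<Longrightarrow> \<bar>f x\<bar> \<le> c" by (metis bounded_funE)
  have int: "integrable (P g) (\<lambda>y. f (y i) * f (y j))" for i j
    by (rule integrable_P[of _ "c * c"]) (use c path_in_carrier c0 g in \<open>auto simp: abs_mult intro!: mult_mono\<close>)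
  have "(\<integral>y. (f (y n) - f (y m))\<^sup>2 \<partial>P g)
      = (\<integral>y. f (y n) * f (y n) - 2 * (f (y m) * f (y n)) + f (y m) * f (y m) \<partial>P g)"
    by (intro Bochner_Integration.integral_cong) (auto simp: power2_eq_square algebra_simps)
  also have "\<dots> = (\<integral>y. f (y n) * f (y n) \<partial>P g) - 2 * (\<integral>y. f (y m) * f (y n) \<partial>P g) + (\<integral>y. f (y m) * f (y m) \<partial>P g)"
    using int by simp
  finally show ?thesis
    using expect_harmonic_product[OF f g, of n 0] expect_harmonic_product[OF f g, of m 0]
      expect_harmonic_product[OF f g, of m "n - m"] \<open>m \<le> n\<close> by simp
qed

lemma markov_pow_square_mono:
  assumes f: "harmonic f" and g: "g \<in> carrier G" and "m \<le> n"
  shows "(markov_op ^^ m) (\<lambda>x. (f x)\<^sup>2) g \<le> (markov_op ^^ n) (\<lambda>x. (f x)\<^sup>2) g"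
proof -
  have "0 \<le> (\<integral>y. (f (y n) - f (y m))\<^sup>2 \<partial>P g)" by simp
  then show ?thesis using expect_increment_square[OF assms] by simp
qed

text \<open>The martingale \<open>f (y n)\<close> is bounded, so it is a Cauchy sequence in \<open>L\<^sup>2\<close> and converges almost surely along
  a subsequence. For a single function \<open>F\<close> one subsequence has to serve all starting
  points; it is found by averaging their second moments with positive weights.\<close>

theorem harmonic_boundary_values:
  assumes f: "harmonic f"
  obtains F :: "(nat \<Rightarrow> 'a) \<Rightarrow> real" where "F \<in> borel_measurable (path_space G)"
    "\<And>g. g \<in> carrier G \<Longrightarrow> AE y in P g. F (shift y) = F y"
    "\<And>g. g \<in> carrier G \<Longrightarrow> (\<integral>y. F y \<partial>P g) = f g"
proof -
  have b: "bounded_fun f" using f by (simp add: harmonic_def)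
  then obtain c where c0: "0 < c" and c: "\<And>x. x \<in> carrier G \<Longrightarrow> \<bar>f x\<bar> \<le> c" by (metis bounded_funE)
  let ?f2 = "\<lambda>n. (markov_op ^^ n) (\<lambda>x. (f x)\<^sup>2)"
  have f2_bound: "\<bar>?f2 n x\<bar> \<le> c\<^sup>2" if "x \<in> carrier G" for n x
    using that c c0 by (intro abs_markov_pow_le) (auto simp: abs_le_square_iff[symmetric] abs_of_pos)
  obtain \<theta> where \<theta>: "prob_measure_on G \<theta>" "support G \<theta> = carrier G"
    using full_support_exists[OF group_axioms countable_carrier] by blast
  interpret \<theta>: random_walk G \<theta> by unfold_locales (rule countable_carrier \<theta>(1))+
  have \<theta>_pos: "measure \<theta> {g} > 0" if "g \<in> carrier G" for g using \<theta>(2) that by (auto simp: support_def)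
  have \<theta>_point: "measure \<theta> {g} * \<phi> g \<le> (\<integral>x. \<phi> x \<partial>\<theta>)"
    if "\<And>x. x \<in> carrier G \<Longrightarrow> 0 \<le> \<phi> x" "\<And>x. x \<in> carrier G \<Longrightarrow> \<bar>\<phi> x\<bar> \<le> d" "g \<in> carrier G" for \<phi> :: "'a \<Rightarrow> real" and d g
  proof -
    have "measure \<theta> {g} * \<phi> g = (\<integral>x. \<phi> g * indicator {g} x \<partial>\<theta>)"
      using that by simp
    also have "\<dots> \<le> (\<integral>x. \<phi> x \<partial>\<theta>)"
      using that by (intro integral_mono \<theta>.integrable_step[of _ "\<bar>\<phi> g\<bar>"] \<theta>.integrable_step[of _ d])
        (auto simp: indicator_def)
    finally show ?thesis .
  qed
  define a where "a n = (\<integral>x. ?f2 n x \<partial>\<theta>)" for n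
  have int_f2: "integrable \<theta> (?f2 n)" for n by (rule \<theta>.integrable_step) (rule f2_bound)
  have "incseq a" unfolding a_def
    by (intro incseq_SucI integral_mono int_f2 markov_pow_square_mono f) auto
  moreover have "a n \<le> c\<^sup>2" for n
  proof -
    have "a n \<le> (\<integral>x. c\<^sup>2 \<partial>\<theta>)" unfolding a_def using f2_bound
      by (intro integral_mono int_f2 \<theta>.step.integrable_const) (auto simp: abs_le_iff)
    then show ?thesis by (simp add: \<theta>.step.prob_space[simplified])
  qed
  ultimately obtain L where L: "a \<longlonglongrightarrow> L" and aL: "\<And>n. a n \<le> L"
    by (metis incseq_convergent)
  have "\<forall>k. \<exists>n. L - a n < (1/4)^k"
  proof
    fix k :: nat
    have "L - (1/4)^k < L" by simp
    from order_tendstoD(1)[OF L this] obtain n where "L - (1/4)^k < a n"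
      by (auto simp: eventually_sequentially)
    then show "\<exists>n. L - a n < (1/4)^k" by (intro exI[of _ n]) simp
  qed
  then obtain q where q: "\<And>k. L - a (q k) < (1/4)^k" by metis
  \<comment> \<open>A nondecreasing sequence that dominates \<open>q\<close>.\<close>
  define r where "r k = (\<Sum>i\<le>k. Suc (q i))" for k
  have r_mono: "r k \<le> r (Suc k)" for k by (simp add: r_def)
  have r: "L - a (r k) < (1/4)^k" for k
  proof -
    have "q k \<le> r k" unfolding r_def by (rule order_trans[OF _ member_le_sum[of k]]) auto
    then have "a (q k) \<le> a (r k)" using \<open>incseq a\<close> by (auto simp: incseq_def)
    then show ?thesis using q[of k] by simp
  qed
  have ae: "AE y in P g. summable (\<lambda>k. \<bar>f (y (m k)) - f (y (r k))\<bar>)"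
    if g: "g \<in> carrier G" and m: "\<And>k. r k \<le> m k" for g m
  proof -
    interpret prob_space "P g" by (rule prob_space_P) fact
    let ?d = "\<lambda>k y. f (y (m k)) - f (y (r k))"
    have bd: "\<bar>?d k y\<bar> \<le> 2 * c" if "y \<in> \<Omega>" for k y
      using c[of "y (m k)"] c[of "y (r k)"] path_in_carrier[OF that] by (smt (verit))
    have sq: "expectation (\<lambda>y. (?d k y)\<^sup>2) \<le> (1/4)^k / measure \<theta> {g}" for k
    proof -
      have "measure \<theta> {g} * (?f2 (m k) g - ?f2 (r k) g) \<le> (\<integral>x. ?f2 (m k) x - ?f2 (r k) x \<partial>\<theta>)"
        using markov_pow_square_mono[OF f _ m] f2_bound g
        by (intro \<theta>_point[of _ "2 * c\<^sup>2"]) (auto, smt (verit))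
      also have "\<dots> = a (m k) - a (r k)" unfolding a_def by (intro Bochner_Integration.integral_diff int_f2)
      also have "\<dots> \<le> (1/4)^k" using r[of k] aL[of "m k"] by simp
      finally show ?thesis
        unfolding expect_increment_square[OF f g m] using \<theta>_pos[OF g] by (simp add: field_simps)
    qed
    have i1: "integrable (P g) (\<lambda>y. \<bar>?d k y\<bar>)" for k
      using bd g by (intro integrable_P[of _ "2 * c"]) auto
    have i2: "integrable (P g) (\<lambda>y. (?d k y)\<^sup>2)" for k
    proof (intro integrable_P[of _ "(2 * c)\<^sup>2"] g)
      fix y assume "y \<in> \<Omega>"
      then have "\<bar>?d k y\<bar> \<le> \<bar>2 * c\<bar>" using bd[of y k] c0 by simp
      then show "\<bar>(?d k y)\<^sup>2\<bar> \<le> (2 * c)\<^sup>2" by (simp add: abs_le_square_iff del: power_mult_distrib)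
    qed measurable
    show ?thesis
    proof (rule AE_summable_of_expectation[of "\<lambda>k y. \<bar>?d k y\<bar>" "\<lambda>k. (1/2)^k * (1 + 1 / measure \<theta> {g})"])
      fix k
      \<comment> \<open>Second moments of order \<open>4\<^sup>-\<^sup>k\<close> give first moments of order \<open>2\<^sup>-\<^sup>k\<close>.\<close>
      define u :: real where "u = 2^k"
      have u: "0 < u" "(1/2)^k = 1/u" "(1/4)^k = 1/(u * u)"
        by (simp_all add: u_def power_one_over power_mult_distrib[symmetric])
      have amgm: "\<bar>t\<bar> \<le> 1/u + u * t\<^sup>2" for t :: real
      proof -
        have "0 \<le> u * (\<bar>t\<bar> - 1/u)\<^sup>2" using u by simp
        also have "\<dots> = u * t\<^sup>2 - 2 * \<bar>t\<bar> + 1/u"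
          using u by (simp add: power2_diff right_diff_distrib distrib_left) (simp add: power2_eq_square)
        finally have "2 * \<bar>t\<bar> \<le> 1/u + u * t\<^sup>2" by simp
        then show ?thesis by linarith
      qed
      have "expectation (\<lambda>y. \<bar>?d k y\<bar>) \<le> expectation (\<lambda>y. 1/u + u * (?d k y)\<^sup>2)"
        by (intro integral_mono i1 Bochner_Integration.integrable_add integrable_mult_right i2 integrable_const amgm)
      also have "\<dots> = 1/u + u * expectation (\<lambda>y. (?d k y)\<^sup>2)"
        using i2 by (simp add: prob_space[simplified])
      also have "\<dots> \<le> 1/u + u * (1/(u * u) / measure \<theta> {g})"
        using sq[of k] u(1) unfolding u(3) by (intro add_left_mono mult_left_mono) auto
      also have "\<dots> = (1/2)^k * (1 + 1 / measure \<theta> {g})"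
        using u by (simp add: distrib_left)
      finally show "expectation (\<lambda>y. \<bar>?d k y\<bar>) \<le> (1/2)^k * (1 + 1 / measure \<theta> {g})" .
    qed (auto intro: i1 summable_mult2 summable_geometric)
  qed
  define F where "F y = lim (\<lambda>k. f (y (r k)))" for y
  have F_lim: "AE y in P g. (\<lambda>k. f (y (r k))) \<longlonglongrightarrow> F y" if g: "g \<in> carrier G" for g
    using ae[OF g, of "\<lambda>k. r (Suc k)", OF r_mono]
  proof eventually_elim
    case (elim y)
    then have "summable (\<lambda>k. f (y (r (Suc k))) - f (y (r k)))" by (rule summable_rabs_cancel)
    then have "convergent (\<lambda>n. \<Sum>k<n. f (y (r (Suc k))) - f (y (r k)))"
      by (simp add: summable_iff_convergent)
    then have "convergent (\<lambda>n. f (y (r n)) - f (y (r 0)))" by (simp only: sum_lessThan_telescope[of "\<lambda>n. f (y (r n))"])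
    then have "convergent (\<lambda>n. f (y (r n)))" using convergent_diff_const_right_iff by blast
    then show ?case unfolding F_def by (rule convergent_LIMSEQ_iff[THEN iffD1])
  qed
  have "AE y in P g. F (shift y) = F y" if g: "g \<in> carrier G" for g
    using F_lim[OF g] ae[OF g, of "\<lambda>k. Suc (r k)", OF le_SucI[OF order_refl]]
  proof eventually_elim
    case (elim y)
    have "(\<lambda>k. \<bar>f (y (Suc (r k))) - f (y (r k))\<bar>) \<longlonglongrightarrow> 0" by (rule summable_LIMSEQ_zero) fact
    then have "(\<lambda>k. f (y (Suc (r k))) - f (y (r k))) \<longlonglongrightarrow> 0" by (simp add: tendsto_rabs_zero_iff)
    from tendsto_add[OF this elim(1)] have "(\<lambda>k. f (shift y (r k))) \<longlonglongrightarrow> F y" by (simp add: shift_def)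
    then show ?case unfolding F_def[of "shift y"] by (rule limI)
  qed
  moreover have Fm [measurable]: "F \<in> borel_measurable (path_space G)"
    unfolding F_def by measurable
  moreover have "(\<integral>y. F y \<partial>P g) = f g" if g: "g \<in> carrier G" for g
  proof -
    interpret prob_space "P g" by (rule prob_space_P) fact
    have "(\<lambda>k. \<integral>y. f (y (r k)) \<partial>P g) \<longlonglongrightarrow> (\<integral>y. F y \<partial>P g)"
    proof (rule integral_dominated_convergence[where w = "\<lambda>_. c"])
      show "AE y in P g. norm (f (y (r k))) \<le> c" for k
        using c path_in_carrier by (auto intro!: AE_I2)
    qed (use F_lim[OF g] Fm in \<open>auto simp: measurable_cong_sets[OF sets_path_measure refl]\<close>)
    then show ?thesis
      using expect_walk[OF b g] harmonic_pow[OF f g] by (simp add: LIMSEQ_const_iff)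
  qed
  ultimately show thesis by (intro that)
qed

section \<open>Exit sets and bounded harmonic functions\<close>

lemma measurable_translate_P [measurable]:
  "h \<in> carrier G \<Longrightarrow> translate G h \<in> path_space G \<rightarrow>\<^sub>M path_space G"
  by (intro measurable_translate group_axioms countable_carrier)

lemma translate_in_space: "h \<in> carrier G \<Longrightarrow> y \<in> \<Omega> \<Longrightarrow> translate G h y \<in> \<Omega>"
  by (auto simp: translate_def space_path_space)

lemma shift_in_space: "y \<in> \<Omega> \<Longrightarrow> shift y \<in> \<Omega>"
  by (auto simp: shift_def space_path_space)

lemma P_translate:
  "g \<in> carrier G \<Longrightarrow> h \<in> carrier G \<Longrightarrow> P (h \<otimes> g) = distr (P g) (path_space G) (translate G h)"
  by (intro path_measure_translate group_axioms countable_carrier prob_measure)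

lemma measurable_P_cong: "measurable (P g) N = measurable (path_space G) N"
  by (rule measurable_cong_sets) (simp_all add: sets_path_measure)

lemma AE_translate:
  assumes Q: "Measurable.pred (path_space G) Q" and h: "h \<in> carrier G"
    and ae: "\<And>x. x \<in> carrier G \<Longrightarrow> AE y in P x. Q y" and x: "x \<in> carrier G"
  shows "AE y in P x. Q (translate G h y)"
proof -
  have "AE y in P (h \<otimes> x). Q y" using ae h x by auto
  then show ?thesis unfolding P_translate[OF x h]
    by (subst (asm) AE_distr_iff) (use Q h in \<open>auto simp: measurable_P_cong\<close>)
qed

lemma exit_sets_iff:
  "A \<in> exit_sets G \<mu> \<longleftrightarrow> A \<in> sets (path_space G) \<and> (\<forall>x \<in> carrier G. AE y in P x. y \<in> A \<longleftrightarrow> shift y \<in> A)"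
proof (cases "A \<in> sets (path_space G)")
  case True
  note [measurable] = True measurable_shift
  have "Measurable.pred (path_space G) (\<lambda>y. y \<in> A \<longleftrightarrow> shift y \<in> A)" by measurable
  then show ?thesis using True unfolding exit_sets_def
    by (simp add: AE_path_measure_all[OF group_axioms countable_carrier prob_measure])
qed (simp add: exit_sets_def)

lemma exit_sets_measurable: "A \<in> exit_sets G \<mu> \<Longrightarrow> A \<in> sets (path_space G)"
  by (simp add: exit_sets_iff)

lemma exit_sets_subset: "A \<in> exit_sets G \<mu> \<Longrightarrow> A \<subseteq> \<Omega>"
  using exit_sets_measurable sets.sets_into_space by blast

lemma exit_sets_AE: "A \<in> exit_sets G \<mu> \<Longrightarrow> x \<in> carrier G \<Longrightarrow> AE y in P x. y \<in> A \<longleftrightarrow> shift y \<in> A"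
  by (simp add: exit_sets_iff)

lemma AE_in_space: "AE y in P x. y \<in> \<Omega>"
  using AE_space[of "P x"] by simp

lemma sigma_algebra_exit_sets: "sigma_algebra \<Omega> (exit_sets G \<mu>)"
  unfolding sigma_algebra_iff2
proof (intro conjI ballI allI impI)
  show "exit_sets G \<mu> \<subseteq> Pow \<Omega>" using exit_sets_subset by blast
  show "{} \<in> exit_sets G \<mu>" by (simp add: exit_sets_iff)
next
  fix A assume A: "A \<in> exit_sets G \<mu>"
  show "\<Omega> - A \<in> exit_sets G \<mu>" unfolding exit_sets_iff
  proof (intro conjI ballI)
    show "\<Omega> - A \<in> sets (path_space G)" using exit_sets_measurable[OF A] by auto
    fix x assume "x \<in> carrier G"
    from exit_sets_AE[OF A this] AE_in_space[of x] show "AE y in P x. y \<in> \<Omega> - A \<longleftrightarrow> shift y \<in> \<Omega> - A"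
      by eventually_elim (auto dest: shift_in_space)
  qed
next
  fix A :: "nat \<Rightarrow> (nat \<Rightarrow> 'a) set" assume "range A \<subseteq> exit_sets G \<mu>"
  then have A: "A n \<in> exit_sets G \<mu>" for n by auto
  show "(\<Union>n. A n) \<in> exit_sets G \<mu>" unfolding exit_sets_iff
  proof (intro conjI ballI)
    show "(\<Union>n. A n) \<in> sets (path_space G)" using exit_sets_measurable[OF A] by auto
    fix x assume x: "x \<in> carrier G"
    have "AE y in P x. \<forall>n. y \<in> A n \<longleftrightarrow> shift y \<in> A n"
      unfolding AE_all_countable using exit_sets_AE[OF A x] by blast
    then show "AE y in P x. y \<in> (\<Union>n. A n) \<longleftrightarrow> shift y \<in> (\<Union>n. A n)"
      by eventually_elim auto
  qed
qed

lemma exit_sets_preimage_translate: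
  assumes h: "h \<in> carrier G" and A: "A \<in> exit_sets G \<mu>"
  shows "{y \<in> \<Omega>. translate G h y \<in> A} \<in> exit_sets G \<mu>"
proof -
  have "{y \<in> \<Omega>. translate G h y \<in> A} = translate G (inv h) ` A"
    using translate_image_eq[OF group_axioms, of "inv h" A] h exit_sets_subset[OF A] by auto
  then show ?thesis
    using exit_sets_translate[OF group_axioms countable_carrier prob_measure _ A] h by simp
qed

text \<open>The sublevel sets of the boundary values of \<open>f\<close> are exit sets. So the translation fixes these
  boundary values, and \<open>f\<close> is their expectation.\<close>

theorem harmonic_invariant_of_exit_invariant:
  assumes h: "h \<in> carrier G"
    and inv: "\<And>E x. E \<in> exit_sets G \<mu> \<Longrightarrow> x \<in> carrier G \<Longrightarrow> AE y in P x. translate G h y \<in> E \<longleftrightarrow> y \<in> E"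
    and f: "harmonic f" and x: "x \<in> carrier G"
  shows "f (h \<otimes> x) = f x"
proof -
  obtain F where F [measurable]: "F \<in> borel_measurable (path_space G)"
    and Fs: "\<And>g. g \<in> carrier G \<Longrightarrow> AE y in P g. F (shift y) = F y"
    and Fi: "\<And>g. g \<in> carrier G \<Longrightarrow> (\<integral>y. F y \<partial>P g) = f g"
    using harmonic_boundary_values[OF f] by blast
  have E: "{y \<in> \<Omega>. F y < of_rat q} \<in> exit_sets G \<mu>" for q
    unfolding exit_sets_iff
  proof (intro conjI ballI)
    fix g assume "g \<in> carrier G"
    from Fs[OF this] AE_in_space[of g]
    show "AE y in P g. y \<in> {y \<in> \<Omega>. F y < of_rat q} \<longleftrightarrow> shift y \<in> {y \<in> \<Omega>. F y < of_rat q}"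
      by eventually_elim (auto dest: shift_in_space)
  qed measurable
  have "AE y in P x. \<forall>q. translate G h y \<in> {y \<in> \<Omega>. F y < of_rat q} \<longleftrightarrow> y \<in> {y \<in> \<Omega>. F y < of_rat q}"
    unfolding AE_all_countable using inv[OF E x] by blast
  then have ae: "AE y in P x. F (translate G h y) = F y"
    using AE_in_space[of x]
  proof eventually_elim
    case (elim y)
    then have q: "F (translate G h y) < of_rat q \<longleftrightarrow> F y < of_rat q" for q
      using translate_in_space[OF h] by auto
    show ?case
    proof (rule linorder_cases[of "F (translate G h y)" "F y"])
      assume "F (translate G h y) < F y"
      from of_rat_dense[OF this] q show ?thesis by force
    next
      assume "F y < F (translate G h y)"
      from of_rat_dense[OF this] q show ?thesis by force
    qed
  qed
  have "f (h \<otimes> x) = (\<integral>y. F y \<partial>P (h \<otimes> x))" using Fi h x by simp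
  also have "\<dots> = (\<integral>y. F (translate G h y) \<partial>P x)"
    unfolding P_translate[OF x h] using h by (intro integral_distr) (auto simp: measurable_P_cong)
  also have "\<dots> = (\<integral>y. F y \<partial>P x)"
    using ae h by (intro integral_cong_AE) (auto simp: measurable_P_cong)
  finally show ?thesis using Fi x by simp
qed

text \<open>An exit set does not change under the shift, so conditioning on the first step affects only
  the first coordinate of the cylinder set.\<close>

lemma emeasure_exit_set_first_step:
  assumes A: "A \<in> exit_sets G \<mu>" and g: "g \<in> carrier G" and K: "\<And>i. K i \<in> sets (count_space (carrier G))"
  shows "emeasure (P g) {y \<in> A. \<forall>i<Suc n. y i \<in> K i}
    = indicator (K 0) g * (\<integral>\<^sup>+ s. emeasure (P (g \<otimes> s)) {y \<in> A. \<forall>i<n. y i \<in> K (Suc i)} \<partial>\<mu>)"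
proof -
  note [measurable] = exit_sets_measurable[OF A] measurable_shift
  have cyl [measurable]: "{y \<in> \<Omega>. \<forall>i<m. y i \<in> K' i} \<in> sets (path_space G)"
    if "\<And>i. K' i \<in> sets (count_space (carrier G))" for m K'
  proof -
    have "(\<lambda>y. y i) -` K' i \<inter> \<Omega> \<in> sets (path_space G)" for i
      using that by (intro measurable_sets[OF measurable_path_space_component])
    then have "{y \<in> \<Omega>. y i \<in> K' i} \<in> sets (path_space G)" for i
      by (simp add: vimage_def Collect_conj_eq Int_commute)
    then show ?thesis by (intro sets.sets_Collect) auto
  qed
  have cA: "{y \<in> A. \<forall>i<m. y i \<in> K' i} = A \<inter> {y \<in> \<Omega>. \<forall>i<m. y i \<in> K' i}" for m K'
    using exit_sets_subset[OF A] by auto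
  define C where "C = {y \<in> \<Omega>. \<forall>i<Suc n. y i \<in> K i}"
  define D where "D = {y \<in> \<Omega>. \<forall>i<n. y i \<in> K (Suc i)}"
  have [measurable]: "C \<in> sets (path_space G)" "D \<in> sets (path_space G)"
    using cyl K by (auto simp: C_def D_def simp del: sets_count_space)
  have "emeasure (P g) (A \<inter> C) = emeasure (P g) {y \<in> \<Omega>. shift y \<in> A \<and> y \<in> C}"
  proof (rule emeasure_eq_AE)
    show "AE y in P g. y \<in> A \<inter> C \<longleftrightarrow> y \<in> {y \<in> \<Omega>. shift y \<in> A \<and> y \<in> C}"
      using exit_sets_AE[OF A g] AE_in_space[of g] by eventually_elim auto
  qed measurable
  also have "\<dots> = (\<integral>\<^sup>+ y. indicator {y \<in> \<Omega>. shift y \<in> A \<and> y \<in> C} y \<partial>P g)"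
    by (rule nn_integral_indicator[symmetric]) measurable
  also have "\<dots> = (\<integral>\<^sup>+ s. (\<integral>\<^sup>+ y. indicator {y \<in> \<Omega>. shift y \<in> A \<and> y \<in> C} (case_nat g y) \<partial>P (g \<otimes> s)) \<partial>\<mu>)"
    by (rule nn_integral_first_step[OF _ g]) measurable
  also have "\<dots> = (\<integral>\<^sup>+ s. indicator (K 0) g * emeasure (P (g \<otimes> s)) (A \<inter> D) \<partial>\<mu>)"
  proof (rule nn_integral_cong)
    fix s assume "s \<in> space \<mu>"
    have "(\<integral>\<^sup>+ y. indicator {y \<in> \<Omega>. shift y \<in> A \<and> y \<in> C} (case_nat g y) \<partial>P (g \<otimes> s))
        = (\<integral>\<^sup>+ y. indicator (K 0) g * indicator (A \<inter> D) y \<partial>P (g \<otimes> s))"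
    proof (rule nn_integral_cong)
      fix y assume "y \<in> space (P (g \<otimes> s))"
      then have y: "y \<in> \<Omega>" by simp
      then have "case_nat g y \<in> \<Omega>" using measurable_space[OF measurable_case_nat_path[OF g]] by simp
      moreover have "shift (case_nat g y) = y" by (simp add: shift_def)
      moreover have "(\<forall>i<Suc n. case_nat g y i \<in> K i) \<longleftrightarrow> g \<in> K 0 \<and> (\<forall>i<n. y i \<in> K (Suc i))"
        by (auto simp: less_Suc_eq_0_disj)
      ultimately show "indicator {y \<in> \<Omega>. shift y \<in> A \<and> y \<in> C} (case_nat g y)
          = indicator (K 0) g * (indicator (A \<inter> D) y :: ennreal)"
        using y by (auto simp: C_def D_def indicator_def)
    qed
    also have "\<dots> = indicator (K 0) g * emeasure (P (g \<otimes> s)) (A \<inter> D)"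
      by (subst nn_integral_cmult) (auto simp: measurable_P_cong)
    finally show "(\<integral>\<^sup>+ y. indicator {y \<in> \<Omega>. shift y \<in> A \<and> y \<in> C} (case_nat g y) \<partial>P (g \<otimes> s))
        = indicator (K 0) g * emeasure (P (g \<otimes> s)) (A \<inter> D)" .
  qed
  also have "\<dots> = indicator (K 0) g * (\<integral>\<^sup>+ s. emeasure (P (g \<otimes> s)) (A \<inter> D) \<partial>\<mu>)"
    by (rule nn_integral_cmult) simp
  finally show ?thesis unfolding cA C_def D_def .
qed

text \<open>Induction on the length of a cylinder set \<open>C\<close> extends the equality of the probabilities to \<open>A \<inter> C\<close> and
  \<open>B \<inter> C\<close>, so the restrictions of \<open>P g\<close> to \<open>A\<close> and to \<open>B\<close> are the same measure.\<close>

lemma exit_sets_eq_AE: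
  assumes A: "A \<in> exit_sets G \<mu>" and B: "B \<in> exit_sets G \<mu>"
    and eq: "\<And>x. x \<in> carrier G \<Longrightarrow> emeasure (P x) A = emeasure (P x) B" and g: "g \<in> carrier G"
  shows "AE y in P g. y \<in> A \<longleftrightarrow> y \<in> B"
proof -
  note [measurable] = exit_sets_measurable[OF A] exit_sets_measurable[OF B]
  have cyl: "emeasure (P x) {y \<in> A. \<forall>i<n. y i \<in> K i} = emeasure (P x) {y \<in> B. \<forall>i<n. y i \<in> K i}"
    if "x \<in> carrier G" "\<And>i. K i \<in> sets (count_space (carrier G))" for n x K
    using that
  proof (induction n arbitrary: x K)
    case (Suc n)
    show ?case
      unfolding emeasure_exit_set_first_step[OF A Suc.prems] emeasure_exit_set_first_step[OF B Suc.prems]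
      by (intro arg_cong2[where f = "(*)"] refl nn_integral_cong Suc.IH) (use Suc.prems in auto)
  qed (simp add: eq)
  interpret prob_space "P g" by (rule prob_space_P) fact
  have dens: "emeasure (density (P g) (indicator C)) X = emeasure (P g) (C \<inter> X)"
    if "C \<in> sets (path_space G)" "X \<in> sets (path_space G)" for C X
  proof -
    have "emeasure (density (P g) (indicator C)) X = (\<integral>\<^sup>+ y. indicator C y * indicator X y \<partial>P g)"
      by (rule emeasure_density) (use that in \<open>auto simp: measurable_P_cong sets_path_measure\<close>)
    also have "\<dots> = (\<integral>\<^sup>+ y. indicator (C \<inter> X) y \<partial>P g)" by (simp only: indicator_inter_arith)
    also have "\<dots> = emeasure (P g) (C \<inter> X)"
      by (rule nn_integral_indicator) (use that in \<open>auto simp: sets_path_measure\<close>)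
    finally show ?thesis .
  qed
  have "density (P g) (indicator A) = density (P g) (indicator B)"
  proof (rule measure_eqI_PiM_infinite[where I = "UNIV :: nat set" and M = "\<lambda>_. count_space (carrier G)"])
    show "finite_measure (density (P g) (indicator A))"
    proof
      show "emeasure (density (P g) (indicator A)) (space (density (P g) (indicator A))) \<noteq> \<infinity>"
        using dens[of A \<Omega>] by (simp add: emeasure_eq_measure)
    qed
  next
    fix K :: "nat \<Rightarrow> 'a set" and J :: "nat set"
    assume J: "finite J" and K: "\<And>i. i \<in> J \<Longrightarrow> K i \<in> sets (count_space (carrier G))"
    let ?X = "prod_emb UNIV (\<lambda>_. count_space (carrier G)) J (Pi\<^sub>E J K)"
    obtain n where n: "J \<subseteq> {..<n}" using J by (metis finite_nat_iff_bounded)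
    define L where "L i = (if i \<in> J then K i else carrier G)" for i
    have L: "L i \<in> sets (count_space (carrier G))" for i using K by (simp add: L_def)
    have X: "C \<inter> ?X = {y \<in> C. \<forall>i<n. y i \<in> L i}" if "C \<subseteq> \<Omega>" for C
    proof -
      have "?X = {y \<in> \<Omega>. \<forall>i<n. y i \<in> L i}"
      proof (rule Set.set_eqI)
        fix y
        have "(\<forall>i \<in> J. y i \<in> K i) \<longleftrightarrow> (\<forall>i<n. y i \<in> L i)" if "y \<in> \<Omega>"
          using n that path_in_carrier by (auto simp: L_def)
        then show "y \<in> ?X \<longleftrightarrow> y \<in> {y \<in> \<Omega>. \<forall>i<n. y i \<in> L i}"
          by (auto simp: prod_emb_def space_path_space PiE_iff)
      qed
      then show ?thesis using that by auto
    qed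
    have Xm: "?X \<in> sets (path_space G)"
      unfolding path_space_def by (rule sets_PiM_I) (use J K in auto)
    show "emeasure (density (P g) (indicator A)) ?X = emeasure (density (P g) (indicator B)) ?X"
      using cyl[OF g L] by (simp add: dens Xm X exit_sets_subset A B)
  qed (simp_all add: sets_path_measure path_space_def[symmetric])
  then have d: "emeasure (P g) (A \<inter> X) = emeasure (P g) (B \<inter> X)" if "X \<in> sets (path_space G)" for X
    using dens[of A X] dens[of B X] that by simp
  have "emeasure (P g) (A - B) = 0" "emeasure (P g) (B - A) = 0"
  proof -
    have "A - B = A \<inter> (\<Omega> - B)" "B \<inter> (\<Omega> - B) = {}" "B - A = B \<inter> (\<Omega> - A)" "A \<inter> (\<Omega> - A) = {}"
      using exit_sets_subset[OF A] exit_sets_subset[OF B] by auto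
    then show "emeasure (P g) (A - B) = 0" "emeasure (P g) (B - A) = 0"
      using d[of "\<Omega> - B"] d[of "\<Omega> - A"] by simp_all
  qed
  then have "A - B \<in> null_sets (P g)" "B - A \<in> null_sets (P g)"
    by (auto simp: null_sets_def sets_path_measure)
  then have "AE y in P g. y \<notin> A - B" "AE y in P g. y \<notin> B - A"
    by (simp_all only: AE_not_in)
  then show ?thesis by eventually_elim auto
qed

lemma harmonic_exit_probability:
  assumes A: "A \<in> exit_sets G \<mu>"
  shows "harmonic (\<lambda>x. measure (P x) A)"
  unfolding harmonic_def
proof (intro conjI ballI)
  have p: "measure (P x) A \<le> 1" if "x \<in> carrier G" for x
    using prob_space.prob_le_1[OF prob_space_P[OF that]] .
  then show b: "bounded_fun (\<lambda>x. measure (P x) A)" by (auto simp: bounded_fun_def intro!: exI[of _ 1])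
  fix x assume x: "x \<in> carrier G"
  interpret prob_space "P x" by (rule prob_space_P) fact
  have K: "\<And>i. (\<lambda>_. carrier G) i \<in> sets (count_space (carrier G))" by simp
  have in_A: "{y \<in> A. \<forall>i<n. y i \<in> carrier G} = A" for n
    using exit_sets_subset[OF A] path_in_carrier by auto
  have "emeasure (P x) A = (\<integral>\<^sup>+ s. emeasure (P (x \<otimes> s)) A \<partial>\<mu>)"
    using emeasure_exit_set_first_step[OF A x K, of 0] x in_A[of 1] by simp
  also have "\<dots> = (\<integral>\<^sup>+ s. ennreal (measure (P (x \<otimes> s)) A) \<partial>\<mu>)"
  proof (rule nn_integral_cong)
    fix s assume "s \<in> space \<mu>"
    then interpret s: prob_space "P (x \<otimes> s)" by (intro prob_space_P) (use x in auto)
    show "emeasure (P (x \<otimes> s)) A = ennreal (measure (P (x \<otimes> s)) A)" by (rule s.emeasure_eq_measure)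
  qed
  also have "\<dots> = ennreal (markov_op (\<lambda>x. measure (P x) A) x)"
    unfolding markov_op_def by (rule nn_integral_eq_integral) (use integrable_markov[OF b x] in auto)
  finally show "markov_op (\<lambda>x. measure (P x) A) x = measure (P x) A"
    by (simp add: emeasure_eq_measure markov_op_def)
qed

text \<open>The probabilities of \<open>E\<close> and of its translate are the values at \<open>h \<otimes> x\<close> and at \<open>x\<close> of the same
  harmonic function.\<close>

theorem exit_invariant_of_harmonic_invariant:
  assumes h: "h \<in> carrier G"
    and inv: "\<And>f x. harmonic f \<Longrightarrow> x \<in> carrier G \<Longrightarrow> f (h \<otimes> x) = f x"
    and E: "E \<in> exit_sets G \<mu>" and x: "x \<in> carrier G"
  shows "AE y in P x. translate G h y \<in> E \<longleftrightarrow> y \<in> E"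
proof -
  let ?E' = "{y \<in> \<Omega>. translate G h y \<in> E}"
  note [measurable] = exit_sets_measurable[OF E]
  have eq: "emeasure (P g) ?E' = emeasure (P g) E" if g: "g \<in> carrier G" for g
  proof -
    have "emeasure (P (h \<otimes> g)) E = emeasure (P g) ?E'"
      unfolding P_translate[OF g h] using h
      by (subst emeasure_distr) (auto simp: measurable_P_cong vimage_def Int_def conj_commute)
    moreover have "measure (P (h \<otimes> g)) E = measure (P g) E"
      by (rule inv[OF harmonic_exit_probability[OF E] g])
    ultimately show ?thesis using g h
      by (simp add: finite_measure.emeasure_eq_measure prob_space_P prob_space.finite_measure)
  qed
  have "AE y in P x. y \<in> ?E' \<longleftrightarrow> y \<in> E"
    by (rule exit_sets_eq_AE[OF exit_sets_preimage_translate[OF h E] E eq x])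
  with AE_in_space[of x] show ?thesis by eventually_elim auto
qed

section \<open>Stabilizers of boundary points\<close>

lemma exit_base: "is_exit_base G \<mu> (exit_base G \<mu>)"
  by (intro is_exit_base_exit_base group_axioms countable_carrier prob_measure)

lemma exit_base_subset: "A \<in> exit_base G \<mu> \<Longrightarrow> A \<in> exit_sets G \<mu>"
  using exit_base by (auto simp: is_exit_base_def)

lemma countable_exit_base: "countable (exit_base G \<mu>)"
  using exit_base by (auto simp: is_exit_base_def)

lemma exit_set_mod_base:
  assumes "E \<in> exit_sets G \<mu>"
  obtains B where "B \<in> sigma_sets \<Omega> (exit_base G \<mu>)" "B \<in> exit_sets G \<mu>"
    "\<And>x. x \<in> carrier G \<Longrightarrow> AE y in P x. y \<in> E \<longleftrightarrow> y \<in> B"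
proof -
  obtain B where B: "B \<in> sigma_sets \<Omega> (exit_base G \<mu>)" "AE y in path_measure_all G \<mu>. y \<in> E \<longleftrightarrow> y \<in> B"
    using exit_base assms by (auto simp: is_exit_base_def)
  interpret sigma_algebra \<Omega> "exit_sets G \<mu>" by (rule sigma_algebra_exit_sets)
  have "sigma_sets \<Omega> (exit_base G \<mu>) \<subseteq> exit_sets G \<mu>"
    by (rule sigma_sets_subset) (use exit_base_subset in auto)
  then have BE: "B \<in> exit_sets G \<mu>" using B by auto
  note [measurable] = exit_sets_measurable[OF BE] exit_sets_measurable[OF assms]
  have m: "Measurable.pred (path_space G) (\<lambda>y. y \<in> E \<longleftrightarrow> y \<in> B)" by measurable
  then have "AE y in P x. y \<in> E \<longleftrightarrow> y \<in> B" if "x \<in> carrier G" for x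
    using B(2) that AE_path_measure_all[OF group_axioms countable_carrier prob_measure m] by auto
  then show thesis using B BE that by blast
qed

lemma bnd_eq_iff:
  assumes "y \<in> \<Omega>" "y' \<in> \<Omega>"
  shows "bnd G \<mu> y = bnd G \<mu> y' \<longleftrightarrow> (\<forall>A \<in> exit_base G \<mu>. y \<in> A \<longleftrightarrow> y' \<in> A)"
  using assms by (auto simp: bnd_def)

lemma sigma_base_separation:
  assumes "B \<in> sigma_sets \<Omega> (exit_base G \<mu>)" "y \<in> \<Omega>" "y' \<in> \<Omega>" "bnd G \<mu> y = bnd G \<mu> y'"
  shows "y \<in> B \<longleftrightarrow> y' \<in> B"
  using assms(1) by (induction B) (use assms(2-) bnd_eq_iff in auto)

text \<open>To be fixed by \<open>h\<close> is a measurable condition on boundary points, to which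
  \<open>boundary_AE_iff\<close> applies.\<close>

lemma fixed_paths_exit_set:
  assumes h: "h \<in> carrier G"
  shows "{y \<in> \<Omega>. bnd G \<mu> (translate G h y) = bnd G \<mu> y} \<in> exit_sets G \<mu>"
proof -
  interpret sigma_algebra \<Omega> "exit_sets G \<mu>" by (rule sigma_algebra_exit_sets)
  let ?T = "\<lambda>A. {y \<in> \<Omega>. translate G h y \<in> A \<longleftrightarrow> y \<in> A}"
  have T: "?T A \<in> exit_sets G \<mu>" if "A \<in> exit_base G \<mu>" for A
  proof -
    let ?A = "{y \<in> \<Omega>. translate G h y \<in> A}"
    have A: "?A \<in> exit_sets G \<mu>" "A \<in> exit_sets G \<mu>"
      using that h by (auto intro: exit_sets_preimage_translate exit_base_subset)
    have "?T A = (?A \<inter> A) \<union> ((\<Omega> - ?A) \<inter> (\<Omega> - A))" using exit_sets_subset[OF A(2)] by auto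
    then show ?thesis using A by (simp only: Un Int compl_sets)
  qed
  have "(\<lambda>A. ?T A) ` exit_base G \<mu> \<subseteq> exit_sets G \<mu>" using T by auto
  then have "\<Omega> \<inter> (\<Inter>A \<in> exit_base G \<mu>. ?T A) \<in> exit_sets G \<mu>"
  proof (cases "exit_base G \<mu> = {}")
    case False
    then have "(\<Inter>A \<in> exit_base G \<mu>. ?T A) \<in> exit_sets G \<mu>"
      using T by (intro countable_INT' countable_exit_base) auto
    then show ?thesis by (intro Int top)
  qed (use top in simp)
  moreover have "{y \<in> \<Omega>. bnd G \<mu> (translate G h y) = bnd G \<mu> y} = \<Omega> \<inter> (\<Inter>A \<in> exit_base G \<mu>. ?T A)"
  proof -
    have "bnd G \<mu> (translate G h y) = bnd G \<mu> y \<longleftrightarrow> (\<forall>A \<in> exit_base G \<mu>. translate G h y \<in> A \<longleftrightarrow> y \<in> A)"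
      if "y \<in> \<Omega>" for y by (rule bnd_eq_iff[OF translate_in_space[OF h that] that])
    then show ?thesis by blast
  qed
  ultimately show ?thesis by simp
qed

lemma boundary_action_bnd':
  "h \<in> carrier G \<Longrightarrow> y \<in> \<Omega> \<Longrightarrow> boundary_action G h (bnd G \<mu> y) = bnd G \<mu> (translate G h y)"
  by (intro boundary_action_bnd group_axioms countable_carrier prob_measure)

lemma boundary_AE_iff:
  assumes Q: "{y \<in> \<Omega>. Q (bnd G \<mu> y)} \<in> exit_sets G \<mu>"
  shows "boundary_AE G \<mu> Q \<longleftrightarrow> (\<forall>x \<in> carrier G. AE y in P x. Q (bnd G \<mu> y))"
proof -
  let ?B = "poisson_boundary G \<mu>"
  have spB: "space ?B = bnd G \<mu> ` \<Omega>" by (auto simp: poisson_boundary_def space_measure_of_conv)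
  \<comment> \<open>The defining family of \<open>poisson_boundary\<close> contains this set itself.\<close>
  have QB: "{\<zeta> \<in> space ?B. Q \<zeta>} \<in> sets ?B"
  proof -
    have eq: "bnd G \<mu> -` {\<zeta> \<in> bnd G \<mu> ` \<Omega>. Q \<zeta>} \<inter> \<Omega> = {y \<in> \<Omega>. Q (bnd G \<mu> y)}" by auto
    have "{\<zeta> \<in> bnd G \<mu> ` \<Omega>. Q \<zeta>} \<in> sets ?B"
      unfolding poisson_boundary_def using Q
      by (subst sets_measure_of) (auto simp only: eq intro!: sigma_sets.Basic)
    then show ?thesis by (simp add: spB)
  qed
  then have QP: "Measurable.pred ?B Q" by (simp add: pred_def)
  have bm: "bnd G \<mu> \<in> P x \<rightarrow>\<^sub>M ?B" for x by (simp add: measurable_P_cong measurable_bnd)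
  have ae: "(AE \<zeta> in Giry_Monad.bind \<theta> (harmonic_measure G \<mu>). Q \<zeta>)
      \<longleftrightarrow> (\<forall>x \<in> carrier G. AE y in P x. Q (bnd G \<mu> y))"
    if \<theta>: "prob_measure_on G \<theta>" "support G \<theta> = carrier G" for \<theta>
  proof -
    have "sets \<theta> = sets (count_space (carrier G))" using \<theta> by (simp add: prob_measure_on_def)
    then have "measurable \<theta> N = measurable (count_space (carrier G)) N" for N :: "(nat \<Rightarrow> 'a) set measure measure"
      by (rule measurable_cong_sets) simp
    then have ker: "harmonic_measure G \<mu> \<in> \<theta> \<rightarrow>\<^sub>M subprob_algebra ?B"
      using prob_space.prob_space_distr[OF prob_space_P bm]
      by (auto simp: harmonic_measure_def space_subprob_algebra prob_space_imp_subprob_space)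
    show ?thesis
      by (subst AE_bind[OF ker QP], subst AE_full_support[OF \<theta> countable_carrier])
         (simp only: harmonic_measure_def AE_distr_iff[OF bm QB])
  qed
  show ?thesis unfolding boundary_AE_def
    using ae full_support_exists[OF group_axioms countable_carrier] by blast
qed

theorem pointwise_stabilizer_iff:
  "h \<in> pointwise_stabilizer G \<mu> \<longleftrightarrow> h \<in> carrier G \<and>
    (\<forall>x \<in> carrier G. AE y in P x. bnd G \<mu> (translate G h y) = bnd G \<mu> y)"
proof (cases "h \<in> carrier G")
  case True
  have eq: "{y \<in> \<Omega>. boundary_action G h (bnd G \<mu> y) = bnd G \<mu> y} = {y \<in> \<Omega>. bnd G \<mu> (translate G h y) = bnd G \<mu> y}"
    by (rule Collect_cong, rule conj_cong[OF refl], simp only: boundary_action_bnd'[OF True])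
  have "boundary_AE G \<mu> (\<lambda>\<zeta>. boundary_action G h \<zeta> = \<zeta>) \<longleftrightarrow>
      (\<forall>x \<in> carrier G. AE y in P x. boundary_action G h (bnd G \<mu> y) = bnd G \<mu> y)"
    by (rule boundary_AE_iff) (simp add: eq fixed_paths_exit_set True)
  also have "\<dots> \<longleftrightarrow> (\<forall>x \<in> carrier G. AE y in P x. bnd G \<mu> (translate G h y) = bnd G \<mu> y)"
    by (intro ball_cong refl AE_cong) (simp add: boundary_action_bnd' True)
  finally show ?thesis using True by (simp add: pointwise_stabilizer_def)
qed (simp add: pointwise_stabilizer_def)

theorem point_stabilizer_AE_iff:
  assumes H: "H \<subseteq> carrier G"
  shows "boundary_AE G \<mu> (\<lambda>\<zeta>. point_stabilizer G \<zeta> = H) \<longleftrightarrow>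
    (\<forall>h \<in> carrier G. \<forall>x \<in> carrier G. AE y in P x. bnd G \<mu> (translate G h y) = bnd G \<mu> y \<longleftrightarrow> h \<in> H)"
proof -
  interpret sigma_algebra \<Omega> "exit_sets G \<mu>" by (rule sigma_algebra_exit_sets)
  let ?S = "\<lambda>h. {y \<in> \<Omega>. bnd G \<mu> (translate G h y) = bnd G \<mu> y}"
  have ps: "point_stabilizer G (bnd G \<mu> y) = H \<longleftrightarrow> (\<forall>h \<in> carrier G. bnd G \<mu> (translate G h y) = bnd G \<mu> y \<longleftrightarrow> h \<in> H)"
    if "y \<in> \<Omega>" for y
  proof -
    have "point_stabilizer G (bnd G \<mu> y) = {h \<in> carrier G. bnd G \<mu> (translate G h y) = bnd G \<mu> y}"
      unfolding point_stabilizer_def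
      by (rule Collect_cong, rule conj_cong[OF refl], simp only: boundary_action_bnd' that)
    then show ?thesis using H by auto
  qed
  have "(\<Inter>h \<in> carrier G. if h \<in> H then ?S h else \<Omega> - ?S h) \<in> exit_sets G \<mu>"
    using one_closed by (intro countable_INT' countable_carrier) (auto intro!: fixed_paths_exit_set compl_sets)
  moreover have "{y \<in> \<Omega>. point_stabilizer G (bnd G \<mu> y) = H} = (\<Inter>h \<in> carrier G. if h \<in> H then ?S h else \<Omega> - ?S h)"
  proof -
    define fixes_path where "fixes_path h y \<longleftrightarrow> bnd G \<mu> (translate G h y) = bnd G \<mu> y" for h y
    have "y \<in> (\<Inter>h \<in> carrier G. if h \<in> H then {y \<in> \<Omega>. fixes_path h y} else \<Omega> - {y \<in> \<Omega>. fixes_path h y})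
        \<longleftrightarrow> (\<forall>h \<in> carrier G. y \<in> \<Omega> \<and> (fixes_path h y \<longleftrightarrow> h \<in> H))" for y
      unfolding INT_iff by (rule ball_cong) auto
    then have "{y \<in> \<Omega>. \<forall>h \<in> carrier G. fixes_path h y \<longleftrightarrow> h \<in> H}
        = (\<Inter>h \<in> carrier G. if h \<in> H then {y \<in> \<Omega>. fixes_path h y} else \<Omega> - {y \<in> \<Omega>. fixes_path h y})"
      using one_closed by blast
    moreover have "{y \<in> \<Omega>. point_stabilizer G (bnd G \<mu> y) = H} = {y \<in> \<Omega>. \<forall>h \<in> carrier G. fixes_path h y \<longleftrightarrow> h \<in> H}"
      by (rule Collect_cong, rule conj_cong[OF refl]) (simp only: ps fixes_path_def)
    ultimately show ?thesis by (simp only: fixes_path_def)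
  qed
  ultimately have "boundary_AE G \<mu> (\<lambda>\<zeta>. point_stabilizer G \<zeta> = H) \<longleftrightarrow>
      (\<forall>x \<in> carrier G. AE y in P x. point_stabilizer G (bnd G \<mu> y) = H)"
    by (intro boundary_AE_iff) simp
  also have "\<dots> \<longleftrightarrow> (\<forall>x \<in> carrier G. AE y in P x. \<forall>h \<in> carrier G. bnd G \<mu> (translate G h y) = bnd G \<mu> y \<longleftrightarrow> h \<in> H)"
    by (intro ball_cong refl AE_cong) (simp add: ps)
  also have "\<dots> \<longleftrightarrow> (\<forall>x \<in> carrier G. \<forall>h \<in> carrier G. AE y in P x. bnd G \<mu> (translate G h y) = bnd G \<mu> y \<longleftrightarrow> h \<in> H)"
    by (intro ball_cong refl AE_ball_countable countable_carrier)
  finally show ?thesis by blast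
qed

theorem pointwise_stabilizer_harmonic:
  "pointwise_stabilizer G \<mu> = {h \<in> carrier G. \<forall>f. harmonic f \<longrightarrow> (\<forall>x \<in> carrier G. f (h \<otimes> x) = f x)}"
proof (intro equalityI subsetI CollectI conjI allI impI ballI)
  fix h assume h: "h \<in> pointwise_stabilizer G \<mu>"
  then show hG: "h \<in> carrier G" by (simp add: pointwise_stabilizer_iff)
  fix f x assume f: "harmonic f" "x \<in> carrier G"
  have inv: "AE y in P x. translate G h y \<in> E \<longleftrightarrow> y \<in> E" if E: "E \<in> exit_sets G \<mu>" and x: "x \<in> carrier G" for E x
  proof -
    obtain B where B: "B \<in> sigma_sets \<Omega> (exit_base G \<mu>)" "B \<in> exit_sets G \<mu>"
      and ae: "\<And>x. x \<in> carrier G \<Longrightarrow> AE y in P x. y \<in> E \<longleftrightarrow> y \<in> B"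
      using exit_set_mod_base[OF E] by blast
    note [measurable] = exit_sets_measurable[OF E] exit_sets_measurable[OF B(2)]
    have "Measurable.pred (path_space G) (\<lambda>y. y \<in> E \<longleftrightarrow> y \<in> B)" by measurable
    from AE_translate[OF this hG ae x]
    have "AE y in P x. translate G h y \<in> E \<longleftrightarrow> translate G h y \<in> B" by auto
    moreover have "AE y in P x. bnd G \<mu> (translate G h y) = bnd G \<mu> y"
      using h x by (simp add: pointwise_stabilizer_iff)
    ultimately show ?thesis using ae[OF x] AE_in_space[of x]
    proof eventually_elim
      case (elim y)
      then show ?case using sigma_base_separation[OF B(1) translate_in_space[OF hG] _ elim(2)] by simp
    qed
  qed
  show "f (h \<otimes> x) = f x" by (rule harmonic_invariant_of_exit_invariant[OF hG inv f])
next
  fix h assume "h \<in> {h \<in> carrier G. \<forall>f. harmonic f \<longrightarrow> (\<forall>x \<in> carrier G. f (h \<otimes> x) = f x)}"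
  then have hG: "h \<in> carrier G" and hf: "\<And>f x. harmonic f \<Longrightarrow> x \<in> carrier G \<Longrightarrow> f (h \<otimes> x) = f x" by auto
  have "AE y in P x. bnd G \<mu> (translate G h y) = bnd G \<mu> y" if x: "x \<in> carrier G" for x
  proof -
    have "AE y in P x. \<forall>A \<in> exit_base G \<mu>. translate G h y \<in> A \<longleftrightarrow> y \<in> A"
      unfolding AE_ball_countable[OF countable_exit_base]
      using exit_invariant_of_harmonic_invariant[OF hG hf exit_base_subset x] by blast
    with AE_in_space[of x] show ?thesis
      by eventually_elim (simp add: bnd_eq_iff translate_in_space hG)
  qed
  then show "h \<in> pointwise_stabilizer G \<mu>" using hG by (simp add: pointwise_stabilizer_iff)
qed

end

section \<open>The pointwise stabilizer: normality, amenability, and the quotient\<close>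

text \<open>By Tychonoff's theorem the sequence has a cluster point in a product of intervals; the tails
  intersected with the preimages of the neighbourhoods of this point generate the filter.\<close>

lemma simultaneous_limit:
  fixes m :: "nat \<Rightarrow> 'i \<Rightarrow> real"
  assumes m: "\<And>n i. m n i \<in> {0..1}"
  obtains L :: "'i \<Rightarrow> real" and \<U> where "\<U> \<noteq> bot" "\<U> \<le> sequentially" "\<And>i. ((\<lambda>n. m n i) \<longlongrightarrow> L i) \<U>"
proof -
  have "compactin (product_topology (\<lambda>_. euclidean) UNIV) (PiE (UNIV :: 'i set) (\<lambda>_. {0..1::real}))"
    by (simp add: compactin_PiE)
  then have "compact (PiE (UNIV :: 'i set) (\<lambda>_. {0..1::real}))"
    by (simp only: euclidean_product_topology compactin_euclidean_iff)
  moreover have "filtermap m sequentially \<noteq> bot" by (simp add: filtermap_bot_iff)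
  moreover have "eventually (\<lambda>x. x \<in> PiE UNIV (\<lambda>_. {0..1})) (filtermap m sequentially)"
    unfolding eventually_filtermap by (rule always_eventually) (use m in auto)
  ultimately obtain L where L: "inf (nhds L) (filtermap m sequentially) \<noteq> bot"
    unfolding compact_filter by blast
  define \<U> where "\<U> = inf sequentially (filtercomap m (nhds L))"
  have "\<U> \<noteq> bot"
  proof
    assume "\<U> = bot"
    then have "eventually (\<lambda>_. False) \<U>" by simp
    then obtain Q R where Q: "eventually Q sequentially" and R: "eventually R (filtercomap m (nhds L))"
      and QR: "\<And>n. Q n \<Longrightarrow> R n \<Longrightarrow> False"
      unfolding \<U>_def eventually_inf by blast
    obtain S where S: "eventually S (nhds L)" "\<And>n. S (m n) \<Longrightarrow> R n"
      using R unfolding eventually_filtercomap by blast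
    have "eventually (\<lambda>x. \<not> S x) (filtermap m sequentially)"
      unfolding eventually_filtermap using Q by eventually_elim (use QR S in blast)
    then have "eventually (\<lambda>_. False) (inf (nhds L) (filtermap m sequentially))"
      unfolding eventually_inf using S(1) by blast
    then show False using L by (simp add: trivial_limit_def)
  qed
  moreover have "\<U> \<le> sequentially" by (simp add: \<U>_def)
  moreover have "((\<lambda>n. m n i) \<longlongrightarrow> L i) \<U>" for i
  proof -
    have "(m \<longlongrightarrow> L) (filtercomap m (nhds L))" by (rule filterlim_filtercomap)
    then have mL: "(m \<longlongrightarrow> L) \<U>" by (rule tendsto_mono[rotated]) (simp add: \<U>_def)
    show ?thesis
      using continuous_on_tendsto_compose[OF continuous_on_product_coordinates[of i] mL] by simp
  qed
  ultimately show thesis using that by blast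
qed

context random_walk
begin

lemma markov_pow_const: "(markov_op ^^ k) (\<lambda>_. c) = (\<lambda>_. c)"
proof (induction k)
  case (Suc k)
  then have "(markov_op ^^ Suc k) (\<lambda>_. c) = markov_op (\<lambda>_. c)" by simp
  then show ?case by (simp add: fun_eq_iff)
qed simp

text \<open>The filter need not be countably generated, so dominated convergence for sequences does not apply. But the step
  lies in a finite set up to a small probability, and on a finite set the convergence is uniform.\<close>

lemma markov_op_tendsto:
  assumes lim: "\<And>x. x \<in> carrier G \<Longrightarrow> ((\<lambda>n. \<phi> n x) \<longlongrightarrow> \<psi> x) \<U>"
    and bound: "\<And>n x. x \<in> carrier G \<Longrightarrow> \<bar>\<phi> n x\<bar> \<le> 1" and bound': "\<And>x. x \<in> carrier G \<Longrightarrow> \<bar>\<psi> x\<bar> \<le> 1"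
    and x: "x \<in> carrier G"
  shows "((\<lambda>n :: nat. markov_op (\<phi> n) x) \<longlongrightarrow> markov_op \<psi> x) \<U>"
proof (rule tendstoI)
  fix e :: real assume e: "e > 0"
  define E where "E k = from_nat_into (carrier G) ` {..<k}" for k :: nat
  have ne: "carrier G \<noteq> {}" using one_closed by blast
  have E: "E k \<subseteq> carrier G" "finite (E k)" for k
    unfolding E_def using from_nat_into[OF ne] by auto
  have "(\<lambda>k. measure \<mu> (E k)) \<longlonglongrightarrow> measure \<mu> (\<Union>k. E k)"
    using E by (intro step.finite_Lim_measure_incseq) (auto simp: sets_step E_def incseq_def)
  moreover have "(\<Union>k. E k) = carrier G"
  proof -
    have "(\<Union>k. E k) = range (from_nat_into (carrier G))" by (auto simp: E_def)
    then show ?thesis using ne countable_carrier by (simp add: range_from_nat_into)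
  qed
  moreover have "measure \<mu> (carrier G) = 1" using step.prob_space by simp
  ultimately have "(\<lambda>k. measure \<mu> (E k)) \<longlonglongrightarrow> 1" by simp
  from order_tendstoD(1)[OF this, of "1 - e/4"] e obtain k where k: "measure \<mu> (E k) > 1 - e/4"
    by (auto simp: eventually_sequentially)
  define F where "F = E k"
  have F: "F \<subseteq> carrier G" "finite F" using E by (auto simp: F_def)
  have small: "measure \<mu> (carrier G - F) < e/4"
    using k step.prob_compl[of F] F by (simp add: F_def[symmetric] sets_step)
  have "((\<lambda>n. \<Sum>s\<in>F. \<bar>\<phi> n (x \<otimes> s) - \<psi> (x \<otimes> s)\<bar>) \<longlongrightarrow> (\<Sum>s\<in>F. \<bar>\<psi> (x \<otimes> s) - \<psi> (x \<otimes> s)\<bar>)) \<U>"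
    using F x by (intro tendsto_intros lim) auto
  then have "((\<lambda>n. \<Sum>s\<in>F. \<bar>\<phi> n (x \<otimes> s) - \<psi> (x \<otimes> s)\<bar>) \<longlongrightarrow> 0) \<U>" by simp
  from order_tendstoD(2)[OF this, of "e/2"] e
  have "eventually (\<lambda>n. (\<Sum>s\<in>F. \<bar>\<phi> n (x \<otimes> s) - \<psi> (x \<otimes> s)\<bar>) < e/2) \<U>" by simp
  then show "eventually (\<lambda>n. dist (markov_op (\<phi> n) x) (markov_op \<psi> x) < e) \<U>"
  proof eventually_elim
    case (elim n)
    let ?S = "\<Sum>s\<in>F. \<bar>\<phi> n (x \<otimes> s) - \<psi> (x \<otimes> s)\<bar>"
    have b: "bounded_fun (\<phi> n)" "bounded_fun \<psi>" using bound bound' by (auto simp: bounded_fun_def)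
    have "markov_op (\<phi> n) x - markov_op \<psi> x = (\<integral>s. \<phi> n (x \<otimes> s) - \<psi> (x \<otimes> s) \<partial>\<mu>)"
      unfolding markov_op_def using b x by (intro Bochner_Integration.integral_diff[symmetric] integrable_markov)
    also have "\<bar>\<dots>\<bar> \<le> (\<integral>s. \<bar>\<phi> n (x \<otimes> s) - \<psi> (x \<otimes> s)\<bar> \<partial>\<mu>)" by (rule integral_abs_bound)
    also have "\<dots> \<le> (\<integral>s. ?S + 2 * indicator (carrier G - F) s \<partial>\<mu>)"
    proof (rule integral_mono)
      show "integrable \<mu> (\<lambda>s. \<bar>\<phi> n (x \<otimes> s) - \<psi> (x \<otimes> s)\<bar>)"
        using b x by (intro integrable_abs Bochner_Integration.integrable_diff integrable_markov)
      show "integrable \<mu> (\<lambda>s. ?S + 2 * indicator (carrier G - F) s)"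
        by (rule integrable_step[of _ "?S + 2"]) (auto simp: indicator_def intro!: sum_nonneg add_nonneg_nonneg)
      fix s assume "s \<in> space \<mu>"
      then have s: "x \<otimes> s \<in> carrier G" "s \<in> carrier G" using x by auto
      show "\<bar>\<phi> n (x \<otimes> s) - \<psi> (x \<otimes> s)\<bar> \<le> ?S + 2 * indicator (carrier G - F) s"
      proof (cases "s \<in> F")
        case True
        then show ?thesis using member_le_sum[of s F "\<lambda>s. \<bar>\<phi> n (x \<otimes> s) - \<psi> (x \<otimes> s)\<bar>"] F by simp
      next
        case False
        have "0 \<le> ?S" by (simp add: sum_nonneg)
        moreover have "\<bar>\<phi> n (x \<otimes> s) - \<psi> (x \<otimes> s)\<bar> \<le> 1 + 1"
          using bound[OF s(1), of n] bound'[OF s(1)] by (intro order_trans[OF abs_triangle_ineq4] add_mono)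
        moreover have "indicator (carrier G - F) s = (1 :: real)" using False s by simp
        ultimately show ?thesis by linarith
      qed
    qed
    also have "\<dots> = ?S + 2 * measure \<mu> (carrier G - F)"
    proof -
      have "integrable \<mu> (\<lambda>s. 2 * indicator (carrier G - F) s :: real)"
        by (rule integrable_step[of _ 2]) (auto simp: indicator_def)
      then have "(\<integral>s. ?S + 2 * indicator (carrier G - F) s \<partial>\<mu>) = (\<integral>s. ?S \<partial>\<mu>) + (\<integral>s. 2 * indicator (carrier G - F) s \<partial>\<mu>)"
        by (intro Bochner_Integration.integral_add) auto
      also have "(\<integral>s. 2 * indicator (carrier G - F) s \<partial>\<mu>) = 2 * measure \<mu> (carrier G - F)"
        by (subst integral_mult_right_zero) (simp add: Int_absorb2)
      finally show ?thesis using step.prob_space by simp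
    qed
    also have "\<dots> < e" using elim small by simp
    finally show ?case by (simp add: dist_real_def)
  qed
qed

lemma pointwise_stabilizerD:
  "h \<in> pointwise_stabilizer G \<mu> \<Longrightarrow> harmonic f \<Longrightarrow> x \<in> carrier G \<Longrightarrow> f (h \<otimes> x) = f x"
  unfolding pointwise_stabilizer_harmonic by blast

lemma pointwise_stabilizer_subset: "pointwise_stabilizer G \<mu> \<subseteq> carrier G"
  by (auto simp: pointwise_stabilizer_def)

text \<open>The translates \<open>\<lambda>x. f (g \<otimes> x)\<close> of harmonic functions are harmonic.\<close>

lemma pointwise_stabilizer_normal:
  assumes "subgroup (pointwise_stabilizer G \<mu>) G"
  shows "pointwise_stabilizer G \<mu> \<lhd> G"
  unfolding normal_inv_iff
proof (intro conjI ballI assms)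
  fix g h assume g: "g \<in> carrier G" and h: "h \<in> pointwise_stabilizer G \<mu>"
  then have hG: "h \<in> carrier G" using pointwise_stabilizer_subset by blast
  have "f (g \<otimes> h \<otimes> inv g \<otimes> x) = f x" if f: "harmonic f" and x: "x \<in> carrier G" for f x
  proof -
    have "f (g \<otimes> h \<otimes> inv g \<otimes> x) = f (g \<otimes> (h \<otimes> (inv g \<otimes> x)))"
      using g hG x by (simp add: m_assoc)
    also have "\<dots> = f (g \<otimes> (inv g \<otimes> x))"
      by (rule pointwise_stabilizerD[OF h harmonic_left[OF f g]]) (use g x in simp)
    also have "\<dots> = f x" using g x by (simp add: m_assoc[symmetric])
    finally show ?thesis .
  qed
  then show "g \<otimes> h \<otimes> inv g \<in> pointwise_stabilizer G \<mu>"
    using g hG unfolding pointwise_stabilizer_harmonic by blast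
qed

text \<open>The mean of \<open>A\<close> is the limiting frequency of the visits to \<open>A\<close>. As a function of the starting
  point this limit is harmonic, because the Markov operator changes the \<open>n\<close>-th Cesaro average
  only by a term of order \<open>1/n\<close>; and invariance of this function is invariance of the mean.\<close>

lemma invariant_mean:
  assumes H: "H \<subseteq> carrier G"
    and inv: "\<And>h f x. h \<in> H \<Longrightarrow> harmonic f \<Longrightarrow> x \<in> carrier G \<Longrightarrow> f (h \<otimes> x) = f x"
  shows "\<exists>m :: 'a set \<Rightarrow> real. m (carrier G) = 1 \<and> (\<forall>A. 0 \<le> m A) \<and>
    (\<forall>A B. A \<inter> B = {} \<longrightarrow> m (A \<union> B) = m A + m B) \<and>
    (\<forall>h A. h \<in> H \<longrightarrow> inv h \<in> H \<longrightarrow> A \<subseteq> carrier G \<longrightarrow> m (h <# A) = m A)"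
proof -
  have bi: "bounded_fun (indicator A)" for A by (auto simp: bounded_fun_def indicator_def intro!: exI[of _ 1])
  have p0: "0 \<le> (markov_op ^^ k) (indicator A) x" and p1: "(markov_op ^^ k) (indicator A) x \<le> 1"
    if x: "x \<in> carrier G" for k A x
  proof -
    show "0 \<le> (markov_op ^^ k) (indicator A) x" "(markov_op ^^ k) (indicator A) x \<le> 1"
      using markov_pow_mono[OF bounded_fun_const[of 0] bi[of A] _ x, of k] markov_pow_mono[OF bi[of A] bounded_fun_const[of 1] _ x, of k]
      by (simp_all add: markov_pow_const indicator_def)
  qed
  define c where "c n = (\<lambda>(A, x). if x \<in> carrier G then (\<Sum>k\<le>n. (markov_op ^^ k) (indicator A) x) / real (Suc n) else 0)" for n
  have c01: "c n i \<in> {0..1}" for n i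
  proof -
    obtain A x where i: "i = (A, x)" by (cases i)
    show ?thesis
    proof (cases "x \<in> carrier G")
      case True
      have "(\<Sum>k\<le>n. (markov_op ^^ k) (indicator A) x) \<le> (\<Sum>k\<le>n. 1)" using p1[OF True] by (intro sum_mono)
      then show ?thesis using p0[OF True] True by (auto simp: i c_def divide_simps intro!: sum_nonneg)
    qed (simp add: i c_def)
  qed
  obtain L \<U> where U: "\<U> \<noteq> bot" "\<U> \<le> sequentially" and L: "\<And>i. ((\<lambda>n. c n i) \<longlongrightarrow> L i) \<U>"
    using simultaneous_limit[of c, OF c01] by blast
  have L0: "0 \<le> L i" and L1: "L i \<le> 1" for i
    using c01[of _ i] U(1) L[of i] by (auto intro: tendsto_lowerbound tendsto_upperbound)
  have harm: "harmonic (\<lambda>x. L (A, x))" for A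
    unfolding harmonic_def
  proof (intro conjI ballI)
    show "bounded_fun (\<lambda>x. L (A, x))"
      using L0 L1 by (auto simp: bounded_fun_def intro!: exI[of _ 1])
    fix x assume x: "x \<in> carrier G"
    have lim1: "((\<lambda>n. markov_op (\<lambda>x. c n (A, x)) x) \<longlongrightarrow> markov_op (\<lambda>x. L (A, x)) x) \<U>"
      using c01 L0 L1 by (intro markov_op_tendsto L x) (auto simp: abs_le_iff intro: order_trans[of _ 0])
    have shift: "markov_op (\<lambda>x. c n (A, x)) x = c n (A, x)
        + ((markov_op ^^ Suc n) (indicator A) x - indicator A x) / real (Suc n)" for n
    proof -
      have "markov_op (\<lambda>x. c n (A, x)) x = markov_op (\<lambda>x. (1 / real (Suc n)) * (\<Sum>k\<le>n. (markov_op ^^ k) (indicator A) x)) x"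
        by (rule markov_op_cong) (use x in \<open>auto simp: c_def\<close>)
      also have "\<dots> = (1 / real (Suc n)) * (markov_op ^^ 1) (\<lambda>x. \<Sum>k\<le>n. (markov_op ^^ k) (indicator A) x) x"
        by (subst markov_op_cmult) simp
      also have "(markov_op ^^ 1) (\<lambda>x. \<Sum>k\<le>n. (markov_op ^^ k) (indicator A) x) x = (\<Sum>k\<le>n. (markov_op ^^ 1) ((markov_op ^^ k) (indicator A)) x)"
        by (rule markov_pow_sum) (use x bi bounded_markov_pow in auto)
      also have "\<dots> = (\<Sum>k\<le>n. (markov_op ^^ Suc k) (indicator A) x)" by simp
      also have "\<dots> = (\<Sum>k\<le>n. (markov_op ^^ k) (indicator A) x) + ((markov_op ^^ Suc n) (indicator A) x - indicator A x)"
      proof -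
        have "(\<Sum>k\<le>Suc n. (markov_op ^^ k) (indicator A) x) = indicator A x + (\<Sum>k\<le>n. (markov_op ^^ Suc k) (indicator A) x)"
          by (subst sum.atMost_Suc_shift) simp
        then show ?thesis by simp
      qed
      finally show ?thesis using x by (simp add: c_def add_divide_distrib)
    qed
    have "(\<lambda>n. ((markov_op ^^ Suc n) (indicator A) x - indicator A x) / real (Suc n)) \<longlonglongrightarrow> 0"
    proof (rule Lim_null_comparison)
      show "(\<lambda>n. 1 / real (Suc n)) \<longlonglongrightarrow> 0" using LIMSEQ_inverse_real_of_nat by (simp add: inverse_eq_divide)
      have "\<bar>(markov_op ^^ Suc n) (indicator A) x - indicator A x\<bar> \<le> 1" for n
        using p0[OF x, of "Suc n" A] p1[OF x, of "Suc n" A] by (auto simp: indicator_def)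
      then show "eventually (\<lambda>n. norm (((markov_op ^^ Suc n) (indicator A) x - indicator A x) / real (Suc n)) \<le> 1 / real (Suc n)) sequentially"
        by (intro always_eventually allI) (simp add: divide_right_mono del: funpow.simps of_nat_Suc)
    qed
    then have "((\<lambda>n. ((markov_op ^^ Suc n) (indicator A) x - indicator A x) / real (Suc n)) \<longlongrightarrow> 0) \<U>"
      by (rule tendsto_mono[OF U(2)])
    from tendsto_add[OF L[of "(A, x)"] this]
    have "((\<lambda>n. markov_op (\<lambda>x. c n (A, x)) x) \<longlongrightarrow> L (A, x)) \<U>" by (simp only: shift add_0_right)
    then show "markov_op (\<lambda>x. L (A, x)) x = L (A, x)" using tendsto_unique[OF U(1) lim1] by simp
  qed
  show ?thesis
  proof (intro exI[of _ "\<lambda>A. L (A, \<one>)"] conjI allI impI)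
    have "c n (carrier G, \<one>) = 1" for n
    proof -
      have "(markov_op ^^ k) (indicator (carrier G)) x = 1" if "x \<in> carrier G" for k x
        using that
      proof (induction k arbitrary: x)
        case (Suc k)
        have "(markov_op ^^ Suc k) (indicator (carrier G)) x = markov_op (\<lambda>_. 1) x"
          using Suc by (auto intro!: markov_op_cong simp del: markov_op_const)
        then show ?case by simp
      qed simp
      then show ?thesis by (simp add: c_def)
    qed
    then show "L (carrier G, \<one>) = 1" using L[of "(carrier G, \<one>)"] U(1) by (simp add: tendsto_const_iff)
  next
    show "0 \<le> L (A, \<one>)" for A by (rule L0)
  next
    fix A B :: "'a set" assume AB: "A \<inter> B = {}"
    have "c n (A \<union> B, \<one>) = c n (A, \<one>) + c n (B, \<one>)" for n
    proof -
      have "(markov_op ^^ k) (indicator (A \<union> B)) \<one> = (markov_op ^^ k) (indicator A) \<one> + (markov_op ^^ k) (indicator B) \<one>" for k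
      proof -
        have "indicator (A \<union> B) = (\<lambda>x. indicator A x + (indicator B x :: real))"
          using AB by (auto simp: indicator_def fun_eq_iff)
        then show ?thesis using markov_pow_add[OF bi[of A] bi[of B] one_closed, of k] by simp
      qed
      then show ?thesis by (simp add: c_def sum.distrib add_divide_distrib)
    qed
    then show "L (A \<union> B, \<one>) = L (A, \<one>) + L (B, \<one>)"
      using tendsto_add[OF L[of "(A, \<one>)"] L[of "(B, \<one>)"]] L[of "(A \<union> B, \<one>)"] U(1)
      by (simp add: tendsto_unique)
  next
    fix h A assume h: "h \<in> H" "inv h \<in> H" and A: "A \<subseteq> carrier G"
    then have hG: "h \<in> carrier G" using H by auto
    have "c n (h <# A, \<one>) = c n (A, inv h)" for n
    proof -
      have "(markov_op ^^ k) (indicator (h <# A)) x = (markov_op ^^ k) (indicator A) (inv h \<otimes> x)"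
        if "x \<in> carrier G" for k x
        using that
      proof (induction k arbitrary: x)
        case 0
        have "x \<in> h <# A \<longleftrightarrow> inv h \<otimes> x \<in> A"
          using hG A 0 by (auto simp: l_coset_def m_assoc[symmetric] subset_iff intro!: bexI[of _ "inv h \<otimes> x"])
        then show ?case by (simp add: indicator_def)
      next
        case (Suc k)
        have "(markov_op ^^ Suc k) (indicator (h <# A)) x = markov_op (\<lambda>x. (markov_op ^^ k) (indicator A) (inv h \<otimes> x)) x"
          using Suc by (auto intro: markov_op_cong)
        also have "\<dots> = markov_op ((markov_op ^^ k) (indicator A)) (inv h \<otimes> x)"
          by (rule markov_op_left) (use hG Suc in auto)
        finally show ?case by simp
      qed
      then show ?thesis using hG by (simp add: c_def)
    qed
    then have "L (h <# A, \<one>) = L (A, inv h)"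
      using L[of "(h <# A, \<one>)"] L[of "(A, inv h)"] U(1) by (simp add: tendsto_unique)
    also have "\<dots> = L (A, \<one>)" using inv[OF h(2) harm one_closed, of A] hG by simp
    finally show "L (h <# A, \<one>) = L (A, \<one>)" .
  qed
qed

text \<open>A subset of \<open>H\<close> is measured by the elements of \<open>G\<close> whose component in \<open>H\<close>, with respect to a
  transversal of the right cosets, belongs to it.\<close>

theorem pointwise_stabilizer_amenable:
  assumes sub: "subgroup (pointwise_stabilizer G \<mu>) G"
  shows "amenable_group (G\<lparr>carrier := pointwise_stabilizer G \<mu>\<rparr>)"
proof -
  let ?H = "pointwise_stabilizer G \<mu>"
  interpret H: subgroup ?H G by (rule sub)
  have "\<exists>m :: 'a set \<Rightarrow> real. m (carrier G) = 1 \<and> (\<forall>A. 0 \<le> m A) \<and>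
      (\<forall>A B. A \<inter> B = {} \<longrightarrow> m (A \<union> B) = m A + m B) \<and>
      (\<forall>h A. h \<in> ?H \<longrightarrow> inv h \<in> ?H \<longrightarrow> A \<subseteq> carrier G \<longrightarrow> m (h <# A) = m A)"
    by (rule invariant_mean[OF H.subset]) (rule pointwise_stabilizerD)
  then obtain m :: "'a set \<Rightarrow> real" where m: "m (carrier G) = 1" "\<And>A. 0 \<le> m A" "\<And>A B. A \<inter> B = {} \<Longrightarrow> m (A \<union> B) = m A + m B"
    "\<And>h A. h \<in> ?H \<Longrightarrow> inv h \<in> ?H \<Longrightarrow> A \<subseteq> carrier G \<Longrightarrow> m (h <# A) = m A"
    by blast
  \<comment> \<open>\<open>t\<close> is constant on each right coset of \<open>H\<close>, with a value in that coset.\<close>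
  define t where "t x = (SOME y. y \<in> ?H #> x)" for x
  have t: "t x \<in> ?H #> x" if "x \<in> carrier G" for x
    unfolding t_def by (rule someI[of _ x]) (rule rcos_self[OF that sub])
  have tG: "t x \<in> carrier G" if "x \<in> carrier G" for x
    using t[OF that] r_coset_subset_G[OF H.subset that] by blast
  have xt: "x \<otimes> inv (t x) \<in> ?H" if x: "x \<in> carrier G" for x
  proof -
    obtain h where "h \<in> ?H" "t x = h \<otimes> x" using t[OF x] by (auto simp: r_coset_def)
    then show ?thesis using x H.mem_carrier by (simp add: inv_mult_group m_assoc[symmetric])
  qed
  have th: "t (h \<otimes> x) = t x" if "h \<in> ?H" "x \<in> carrier G" for h x
  proof -
    have "?H #> (h \<otimes> x) = ?H #> x"
      using that H.subset coset_mult_assoc[of ?H h x] H.rcos_const[OF is_group that(1)] by auto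
    then show ?thesis by (simp add: t_def)
  qed
  define B' where "B' B = {x \<in> carrier G. x \<otimes> inv (t x) \<in> B}" for B
  show ?thesis
    unfolding amenable_group_def
  proof (intro conjI exI[of _ "\<lambda>B. m (B' B)"] allI impI ballI)
    show "Group.group (G\<lparr>carrier := ?H\<rparr>)" by (rule H.subgroup_is_group[OF is_group])
    show "m (B' (carrier (G\<lparr>carrier := ?H\<rparr>))) = 1"
    proof -
      have "B' ?H = carrier G" using xt by (auto simp: B'_def)
      then show ?thesis using m(1) by simp
    qed
    show "0 \<le> m (B' A)" for A by (rule m(2))
  next
    fix A B :: "'a set" assume "A \<inter> B = {}"
    then have "B' A \<inter> B' B = {}" "B' (A \<union> B) = B' A \<union> B' B" by (auto simp: B'_def)
    then show "m (B' (A \<union> B)) = m (B' A) + m (B' B)" using m(3) by simp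
  next
    fix h A assume "h \<in> carrier (G\<lparr>carrier := ?H\<rparr>)" and A: "A \<subseteq> carrier (G\<lparr>carrier := ?H\<rparr>)"
    then have h: "h \<in> ?H" "h \<in> carrier G" and A: "A \<subseteq> ?H" using H.mem_carrier by auto
    have "B' (h <#\<^bsub>G\<lparr>carrier := ?H\<rparr>\<^esub> A) = h <# B' A"
    proof (intro equalityI subsetI)
      fix x assume "x \<in> B' (h <#\<^bsub>G\<lparr>carrier := ?H\<rparr>\<^esub> A)"
      then obtain a where x: "x \<in> carrier G" and a: "a \<in> A" "x \<otimes> inv (t x) = h \<otimes> a"
        by (auto simp: B'_def l_coset_def)
      have aG: "a \<in> carrier G" using a A H.subset by auto
      have "inv h \<otimes> x \<otimes> inv (t (inv h \<otimes> x)) = a"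
        using a x h aG tG[OF x] th[OF H.m_inv_closed[OF h(1)] x]
        by (simp add: m_assoc) (simp add: m_assoc[symmetric])
      then have "inv h \<otimes> x \<in> B' A" using a x h by (simp add: B'_def)
      moreover have "x = h \<otimes> (inv h \<otimes> x)" using x h by (simp add: m_assoc[symmetric])
      ultimately show "x \<in> h <# B' A" by (auto simp: l_coset_def)
    next
      fix x assume "x \<in> h <# B' A"
      then obtain y where y: "y \<in> carrier G" "y \<otimes> inv (t y) \<in> A" "x = h \<otimes> y" by (auto simp: l_coset_def B'_def)
      then have "x \<otimes> inv (t x) = h \<otimes> (y \<otimes> inv (t y))" using h tG[OF y(1)] th[OF h(1) y(1)] by (simp add: m_assoc)
      then show "x \<in> B' (h <#\<^bsub>G\<lparr>carrier := ?H\<rparr>\<^esub> A)" using y h by (auto simp: B'_def l_coset_def)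
    qed
    moreover have "B' A \<subseteq> carrier G" by (auto simp: B'_def)
    ultimately show "m (B' (h <#\<^bsub>G\<lparr>carrier := ?H\<rparr>\<^esub> A)) = m (B' A)"
      using m(4)[OF h(1) H.m_inv_closed[OF h(1)]] by simp
  qed
qed

text \<open>For a step \<open>s\<close> in the support, \<open>\<mu> {s} \<cdot> (f (x \<otimes> s) - f x)\<^sup>2\<close> is at most \<open>P f\<^sup>2 - f\<^sup>2\<close> at \<open>x\<close>. The image of
  this function under \<open>P\<^sup>n\<close> is an increment of the bounded increasing sequence \<open>P\<^sup>n f\<^sup>2\<close>, so it
  tends to zero. Left multiplication by such \<open>s\<close> preserves the property of \<open>z\<close>, which therefore passes
  to the semigroup generated by the support.\<close>

lemma harmonic_asymptotically_right_invariant: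
  assumes nd: "nondegenerate G \<mu>" and f: "harmonic f" and z: "z \<in> carrier G" and x: "x \<in> carrier G"
  shows "(\<lambda>n. (markov_op ^^ n) (\<lambda>x. (f (x \<otimes> z) - f x)\<^sup>2) x) \<longlonglongrightarrow> 0"
proof -
  have b: "bounded_fun f" using f by (simp add: harmonic_def)
  note bf = bounded_fun_diff bounded_fun_add bounded_fun_mult bounded_fun_const bounded_fun_power2
    b bounded_fun_translate[OF b] bounded_markov_op bounded_markov_pow
  define \<psi> where "\<psi> z x = (f (x \<otimes> z) - f x)\<^sup>2" for z x
  have b\<psi>: "bounded_fun (\<psi> z)" if "z \<in> carrier G" for z unfolding \<psi>_def by (intro bf that)
  have \<psi>0: "0 \<le> \<psi> z x" for z x by (simp add: \<psi>_def)
  define Z where "Z = {z \<in> carrier G. \<forall>x \<in> carrier G. (\<lambda>n. (markov_op ^^ n) (\<psi> z) x) \<longlonglongrightarrow> 0}"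
  have pow0: "0 \<le> (markov_op ^^ n) \<phi> x" if "bounded_fun \<phi>" "\<And>x. 0 \<le> \<phi> x" "x \<in> carrier G" for \<phi> n x
  proof -
    have "(markov_op ^^ n) (\<lambda>_. 0) x \<le> (markov_op ^^ n) \<phi> x"
      by (rule markov_pow_mono) (use that bounded_fun_const in auto)
    then show ?thesis by (simp add: markov_pow_const)
  qed
  have point: "measure \<mu> {s} * \<phi> (x \<otimes> s) \<le> markov_op \<phi> x"
    if "bounded_fun \<phi>" "\<And>x. 0 \<le> \<phi> x" "x \<in> carrier G" "s \<in> carrier G" for \<phi> x s
  proof -
    have "measure \<mu> {s} * \<phi> (x \<otimes> s) = (\<integral>t. indicator {s} t * \<phi> (x \<otimes> s) \<partial>\<mu>)"
      using that by simp
    also have "\<dots> \<le> markov_op \<phi> x" unfolding markov_op_def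
      using that by (intro integral_mono integrable_markov integrable_step[of _ "\<bar>\<phi> (x \<otimes> s)\<bar>"]) (auto simp: indicator_def)
    finally show ?thesis .
  qed
  have supp: "s \<in> Z" if s: "s \<in> support G \<mu>" for s
  proof -
    have sG: "s \<in> carrier G" and p: "0 < measure \<mu> {s}" using s by (auto simp: support_def)
    have D: "measure \<mu> {s} * \<psi> s x \<le> markov_op (\<lambda>x. (f x)\<^sup>2) x - (f x)\<^sup>2" if x: "x \<in> carrier G" for x
    proof -
      have "measure \<mu> {s} * \<psi> s x \<le> markov_op (\<lambda>y. (f y - f x)\<^sup>2) x"
        unfolding \<psi>_def by (rule point[of "\<lambda>y. (f y - f x)\<^sup>2"]) (use x sG in \<open>auto intro!: bf\<close>)
      also have "\<dots> = markov_op (\<lambda>y. ((f y)\<^sup>2 - (2 * f x) * f y) + (f x)\<^sup>2) x"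
        by (rule markov_op_cong) (use x in \<open>auto simp: power2_diff\<close>)
      also have "\<dots> = (markov_op (\<lambda>y. (f y)\<^sup>2) x - (2 * f x) * markov_op f x) + (f x)\<^sup>2"
        using x by (subst markov_op_add, (intro bf | assumption)+, subst markov_op_diff)
          (auto intro!: bf simp: markov_op_cmult)
      also have "\<dots> = markov_op (\<lambda>x. (f x)\<^sup>2) x - (f x)\<^sup>2"
        using harmonicD[OF f x] by (simp add: power2_eq_square)
      finally show ?thesis .
    qed
    have "(\<lambda>n. (markov_op ^^ n) (\<psi> s) x) \<longlonglongrightarrow> 0" if x: "x \<in> carrier G" for x
    proof -
      define a where "a n = (markov_op ^^ n) (\<lambda>x. (f x)\<^sup>2) x" for n
      obtain c where c: "\<And>x. x \<in> carrier G \<Longrightarrow> \<bar>(f x)\<^sup>2\<bar> \<le> c" using bounded_fun_power2[OF b] by (metis bounded_funE)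
      have "incseq a" unfolding a_def by (intro incseq_SucI markov_pow_square_mono f x) simp
      moreover have "a n \<le> c" for n unfolding a_def by (rule abs_le_D1[OF abs_markov_pow_le[OF c x]])
      ultimately obtain L where L: "a \<longlonglongrightarrow> L" by (metis incseq_convergent)
      have "(\<lambda>n. (a (Suc n) - a n) / measure \<mu> {s}) \<longlonglongrightarrow> (L - L) / measure \<mu> {s}"
        using p by (intro tendsto_intros L LIMSEQ_Suc) auto
      then have lim: "(\<lambda>n. (a (Suc n) - a n) / measure \<mu> {s}) \<longlonglongrightarrow> 0" by simp
      show ?thesis
      proof (rule tendsto_sandwich[OF _ _ tendsto_const lim])
        show "eventually (\<lambda>n. 0 \<le> (markov_op ^^ n) (\<psi> s) x) sequentially"
          using pow0[OF b\<psi>[OF sG] \<psi>0 x] by simp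
        have "(markov_op ^^ n) (\<psi> s) x \<le> (a (Suc n) - a n) / measure \<mu> {s}" for n
        proof -
          have "measure \<mu> {s} * (markov_op ^^ n) (\<psi> s) x = (markov_op ^^ n) (\<lambda>x. measure \<mu> {s} * \<psi> s x) x"
            by (simp add: markov_pow_cmult)
          also have "\<dots> \<le> (markov_op ^^ n) (\<lambda>x. markov_op (\<lambda>x. (f x)\<^sup>2) x - (f x)\<^sup>2) x"
            by (rule markov_pow_mono) (use D x in \<open>auto intro!: bf b\<psi> sG\<close>)
          also have "\<dots> = (markov_op ^^ n) (markov_op (\<lambda>x. (f x)\<^sup>2)) x - a n"
            unfolding a_def by (rule markov_pow_diff) (use x in \<open>auto intro!: bf\<close>)
          also have "(markov_op ^^ n) (markov_op (\<lambda>x. (f x)\<^sup>2)) = (markov_op ^^ Suc n) (\<lambda>x. (f x)\<^sup>2)"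
            by (simp only: funpow_Suc_right o_apply)
          finally have "measure \<mu> {s} * (markov_op ^^ n) (\<psi> s) x \<le> a (Suc n) - a n" by (simp only: a_def)
          then show ?thesis using p by (simp add: field_simps)
        qed
        then show "eventually (\<lambda>n. (markov_op ^^ n) (\<psi> s) x \<le> (a (Suc n) - a n) / measure \<mu> {s}) sequentially" by simp
      qed
    qed
    then show ?thesis using sG by (simp add: Z_def)
  qed
  have mult: "s \<otimes> z \<in> Z" if s: "s \<in> support G \<mu>" and z: "z \<in> Z" for s z
  proof -
    have sG: "s \<in> carrier G" and p: "0 < measure \<mu> {s}" using s by (auto simp: support_def)
    have zG: "z \<in> carrier G" and zlim: "\<And>x. x \<in> carrier G \<Longrightarrow> (\<lambda>n. (markov_op ^^ n) (\<psi> z) x) \<longlonglongrightarrow> 0"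
      using z by (auto simp: Z_def)
    have slim: "\<And>x. x \<in> carrier G \<Longrightarrow> (\<lambda>n. (markov_op ^^ n) (\<psi> s) x) \<longlonglongrightarrow> 0"
      using supp[OF s] by (auto simp: Z_def)
    have "(\<lambda>n. (markov_op ^^ n) (\<psi> (s \<otimes> z)) x) \<longlonglongrightarrow> 0" if x: "x \<in> carrier G" for x
    proof -
      let ?k = "2 / measure \<mu> {s}"
      have D: "\<psi> (s \<otimes> z) y \<le> ?k * markov_op (\<psi> z) y + 2 * \<psi> s y" if y: "y \<in> carrier G" for y
      proof -
        have sq: "(a + b)\<^sup>2 \<le> 2 * a\<^sup>2 + 2 * b\<^sup>2" for a b :: real
          using sum_squares_bound[of a b] by (simp add: power2_sum)
        have "\<psi> (s \<otimes> z) y = ((f (y \<otimes> s \<otimes> z) - f (y \<otimes> s)) + (f (y \<otimes> s) - f y))\<^sup>2"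
          using y sG zG by (simp add: \<psi>_def m_assoc)
        also have "\<dots> \<le> 2 * \<psi> z (y \<otimes> s) + 2 * \<psi> s y" unfolding \<psi>_def by (rule sq)
        also have "\<psi> z (y \<otimes> s) \<le> markov_op (\<psi> z) y / measure \<mu> {s}"
          using point[OF b\<psi>[OF zG] \<psi>0 y sG] p by (simp add: field_simps)
        finally show ?thesis by simp
      qed
      have bb: "bounded_fun (\<lambda>y. ?k * markov_op (\<psi> z) y)" "bounded_fun (\<lambda>y. 2 * \<psi> s y)"
        by (intro bf b\<psi> sG zG)+
      have lim: "(\<lambda>n. ?k * (markov_op ^^ Suc n) (\<psi> z) x + 2 * (markov_op ^^ n) (\<psi> s) x) \<longlonglongrightarrow> 0"
        using tendsto_add[OF tendsto_mult_left[OF LIMSEQ_Suc[OF zlim[OF x]], of ?k] tendsto_mult_left[OF slim[OF x], of 2]]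
        by simp
      show ?thesis
      proof (rule tendsto_sandwich[OF _ _ tendsto_const lim])
        show "eventually (\<lambda>n. 0 \<le> (markov_op ^^ n) (\<psi> (s \<otimes> z)) x) sequentially"
          using pow0[OF b\<psi> \<psi>0 x] sG zG by simp
        have "(markov_op ^^ n) (\<psi> (s \<otimes> z)) x \<le> ?k * (markov_op ^^ Suc n) (\<psi> z) x + 2 * (markov_op ^^ n) (\<psi> s) x" for n
        proof -
          have "(markov_op ^^ n) (\<psi> (s \<otimes> z)) x \<le> (markov_op ^^ n) (\<lambda>y. ?k * markov_op (\<psi> z) y + 2 * \<psi> s y) x"
            by (rule markov_pow_mono[OF b\<psi> bounded_fun_add[OF bb] D x]) (use sG zG in auto)
          also have "\<dots> = (markov_op ^^ n) (\<lambda>y. ?k * markov_op (\<psi> z) y) x + (markov_op ^^ n) (\<lambda>y. 2 * \<psi> s y) x"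
            by (rule markov_pow_add[OF bb x])
          also have "\<dots> = ?k * (markov_op ^^ n) (markov_op (\<psi> z)) x + 2 * (markov_op ^^ n) (\<psi> s) x"
            by (simp only: markov_pow_cmult)
          also have "(markov_op ^^ n) (markov_op (\<psi> z)) = (markov_op ^^ Suc n) (\<psi> z)"
            by (simp only: funpow_Suc_right o_apply)
          finally show ?thesis .
        qed
        then show "eventually (\<lambda>n. (markov_op ^^ n) (\<psi> (s \<otimes> z)) x
            \<le> ?k * (markov_op ^^ Suc n) (\<psi> z) x + 2 * (markov_op ^^ n) (\<psi> s) x) sequentially" by simp
      qed
    qed
    then show ?thesis using sG zG by (simp add: Z_def)
  qed
  have "w \<in> carrier G \<and> w \<in> Z \<and> (\<forall>z \<in> Z. w \<otimes> z \<in> Z)" if "w \<in> generated_semigroup G (support G \<mu>)" for w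
    using that
  proof induction
    case (incl s)
    then show ?case using supp mult by (auto simp: support_def)
  next
    case (mult a b)
    have "a \<otimes> b \<otimes> z \<in> Z" if "z \<in> Z" for z
      using mult.IH that by (simp add: m_assoc Z_def)
    then show ?case using mult.IH by auto
  qed
  then have "z \<in> Z" using nd z by (simp add: nondegenerate_def)
  then have "(\<lambda>n. (markov_op ^^ n) (\<psi> z) x) \<longlonglongrightarrow> 0" using x by (simp add: Z_def)
  moreover have "\<psi> z = (\<lambda>x. (f (x \<otimes> z) - f x)\<^sup>2)" by (simp add: \<psi>_def fun_eq_iff)
  ultimately show ?thesis by simp
qed

text \<open>Modulo the stabilizer \<open>H\<close>, a translation by an element with a finite conjugacy class is
  a right translation by an element of a finite set depending on the point, so it moves no
  bounded harmonic function.\<close>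

lemma finite_class_in_pointwise_stabilizer:
  assumes nd: "nondegenerate G \<mu>" and normal: "pointwise_stabilizer G \<mu> \<lhd> G"
    and g: "g \<in> carrier G" and C: "finite C" "C \<subseteq> carrier G"
    and conj: "\<And>x. x \<in> carrier G \<Longrightarrow> \<exists>h \<in> pointwise_stabilizer G \<mu>. \<exists>c \<in> C. inv x \<otimes> g \<otimes> x = h \<otimes> c"
  shows "g \<in> pointwise_stabilizer G \<mu>"
proof -
  let ?H = "pointwise_stabilizer G \<mu>"
  interpret H: normal ?H G by (rule normal)
  have "f (g \<otimes> x) = f x" if f: "harmonic f" and x: "x \<in> carrier G" for f x
  proof -
    have b: "bounded_fun f" using f by (simp add: harmonic_def)
    let ?u = "\<lambda>x. f (g \<otimes> x) - f x"
    have u: "harmonic ?u" by (intro harmonic_diff harmonic_left f g)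
    have le: "(?u y)\<^sup>2 \<le> (\<Sum>c\<in>C. (f (y \<otimes> c) - f y)\<^sup>2)" if y: "y \<in> carrier G" for y
    proof -
      obtain h c where h: "h \<in> ?H" and c: "c \<in> C" and e: "inv y \<otimes> g \<otimes> y = h \<otimes> c" using conj[OF y] by blast
      have hG: "h \<in> carrier G" and cG: "c \<in> carrier G" using h c C H.subset by auto
      have "g \<otimes> y = y \<otimes> (inv y \<otimes> g \<otimes> y)" using y g by (simp add: m_assoc[symmetric])
      also have "\<dots> = (y \<otimes> h \<otimes> inv y) \<otimes> (y \<otimes> c)" unfolding e using y hG cG
        by (simp add: m_assoc) (simp add: m_assoc[symmetric])
      finally have "f (g \<otimes> y) = f ((y \<otimes> h \<otimes> inv y) \<otimes> (y \<otimes> c))" by simp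
      also have "\<dots> = f (y \<otimes> c)"
        by (rule pointwise_stabilizerD[OF H.inv_op_closed2[OF y h] f]) (use y cG in simp)
      finally have "(?u y)\<^sup>2 = (f (y \<otimes> c) - f y)\<^sup>2" by simp
      also have "\<dots> \<le> (\<Sum>c\<in>C. (f (y \<otimes> c) - f y)\<^sup>2)"
        by (rule member_le_sum) (use c C in auto)
      finally show ?thesis .
    qed
    have bc: "bounded_fun (\<lambda>y. (f (y \<otimes> c) - f y)\<^sup>2)" if "c \<in> C" for c
      using that C by (intro bounded_fun_diff bounded_fun_power2 b bounded_fun_translate[OF b]) auto
    have bs: "bounded_fun (\<lambda>y. \<Sum>c\<in>C. (f (y \<otimes> c) - f y)\<^sup>2)"
    proof -
      have "bounded_fun (\<lambda>y. \<Sum>c\<in>A. (f (y \<otimes> c) - f y)\<^sup>2)" if "A \<subseteq> C" for A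
        using finite_subset[OF that C(1)] that
        by (induction A rule: finite_induct) (auto intro!: bounded_fun_const bounded_fun_add bc)
      then show ?thesis by blast
    qed
    have "(?u x)\<^sup>2 \<le> (\<Sum>c\<in>C. (markov_op ^^ n) (\<lambda>y. (f (y \<otimes> c) - f y)\<^sup>2) x)" for n
    proof -
      have "(?u x)\<^sup>2 \<le> (markov_op ^^ n) (\<lambda>y. (?u y)\<^sup>2) x"
        using markov_pow_square_mono[OF u x, of 0 n] by simp
      also have "\<dots> \<le> (markov_op ^^ n) (\<lambda>y. \<Sum>c\<in>C. (f (y \<otimes> c) - f y)\<^sup>2) x"
        by (rule markov_pow_mono) (use le x u bs in \<open>auto intro!: bounded_fun_power2 simp: harmonic_def\<close>)
      also have "\<dots> = (\<Sum>c\<in>C. (markov_op ^^ n) (\<lambda>y. (f (y \<otimes> c) - f y)\<^sup>2) x)"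
        by (rule markov_pow_sum[OF bc x])
      finally show ?thesis .
    qed
    moreover have "(\<lambda>n. \<Sum>c\<in>C. (markov_op ^^ n) (\<lambda>y. (f (y \<otimes> c) - f y)\<^sup>2) x) \<longlonglongrightarrow> 0"
      using C by (intro tendsto_null_sum harmonic_asymptotically_right_invariant[OF nd f _ x]) auto
    ultimately have "(?u x)\<^sup>2 \<le> 0"
      by (intro LIMSEQ_le_const) (auto intro!: exI[of _ 0])
    then show ?thesis by simp
  qed
  then show ?thesis using g unfolding pointwise_stabilizer_harmonic by blast
qed

theorem quotient_by_pointwise_stabilizer_icc:
  assumes nd: "nondegenerate G \<mu>" and normal: "pointwise_stabilizer G \<mu> \<lhd> G"
  shows "icc_group (G Mod pointwise_stabilizer G \<mu>)"
  unfolding icc_group_def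
proof (intro conjI ballI impI notI)
  let ?H = "pointwise_stabilizer G \<mu>"
  let ?Q = "G Mod ?H"
  interpret H: normal ?H G by (rule normal)
  show Q: "Group.group ?Q" by (rule H.factorgroup_is_group)
  fix X assume X: "X \<in> carrier ?Q" "X \<noteq> \<one>\<^bsub>?Q\<^esub>"
    and fin: "finite {Y \<otimes>\<^bsub>?Q\<^esub> X \<otimes>\<^bsub>?Q\<^esub> inv\<^bsub>?Q\<^esub> Y |Y. Y \<in> carrier ?Q}"
  obtain g where g: "g \<in> carrier G" "X = ?H #> g" using X by (auto simp: FactGroup_def RCOSETS_def)
  have gH: "g \<notin> ?H" using X(2) g H.rcos_const[OF is_group] by (auto simp: FactGroup_def)
  let ?K = "(\<lambda>x. ?H #> (inv x \<otimes> g \<otimes> x)) ` carrier G"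
  have "?K \<subseteq> {Y \<otimes>\<^bsub>?Q\<^esub> X \<otimes>\<^bsub>?Q\<^esub> inv\<^bsub>?Q\<^esub> Y |Y. Y \<in> carrier ?Q}"
  proof
    fix k assume "k \<in> ?K"
    then obtain x where x: "x \<in> carrier G" "k = ?H #> (inv x \<otimes> g \<otimes> x)" by blast
    let ?Y = "?H #> inv x"
    have Y: "?Y \<in> carrier ?Q" using x by (auto simp: FactGroup_def RCOSETS_def)
    have "inv\<^bsub>?Q\<^esub> ?Y = ?H #> x" using H.inv_FactGroup[OF Y] x H.rcos_inv[of "inv x"] by simp
    then have "k = ?Y \<otimes>\<^bsub>?Q\<^esub> X \<otimes>\<^bsub>?Q\<^esub> inv\<^bsub>?Q\<^esub> ?Y"
      using x g by (simp add: FactGroup_def H.rcos_sum)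
    then show "k \<in> {Y \<otimes>\<^bsub>?Q\<^esub> X \<otimes>\<^bsub>?Q\<^esub> inv\<^bsub>?Q\<^esub> Y |Y. Y \<in> carrier ?Q}" using Y by blast
  qed
  then have finK: "finite ?K" using fin finite_subset by blast
  define C where "C = (\<lambda>k. SOME c. c \<in> k) ` ?K"
  have mem: "(SOME c. c \<in> k) \<in> k" if k: "k \<in> ?K" for k
  proof -
    obtain x where x: "x \<in> carrier G" "k = ?H #> (inv x \<otimes> g \<otimes> x)" using k by blast
    have "inv x \<otimes> g \<otimes> x \<in> k" unfolding x(2) by (rule rcos_self[OF _ H.is_subgroup]) (use x g in auto)
    then show ?thesis by (rule someI)
  qed
  have "g \<in> ?H"
  proof (rule finite_class_in_pointwise_stabilizer[OF nd normal g(1), of C])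
    show "finite C" using finK by (simp add: C_def)
    show "C \<subseteq> carrier G"
    proof
      fix c assume "c \<in> C"
      then obtain x where x: "x \<in> carrier G" "c \<in> ?H #> (inv x \<otimes> g \<otimes> x)" using mem by (auto simp: C_def)
      then show "c \<in> carrier G" using r_coset_subset_G[OF H.subset, of "inv x \<otimes> g \<otimes> x"] g by auto
    qed
    fix x assume x: "x \<in> carrier G"
    let ?z = "inv x \<otimes> g \<otimes> x"
    let ?k = "?H #> ?z"
    have k: "?k \<in> ?K" using x by blast
    define c where "c = (SOME c. c \<in> ?k)"
    have c: "c \<in> ?k" "c \<in> C" using mem[OF k] k by (auto simp: c_def C_def)
    have zG: "?z \<in> carrier G" using x g by simp
    obtain h where h: "h \<in> ?H" "c = h \<otimes> ?z" using c by (auto simp: r_coset_def)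
    then have "?z = inv h \<otimes> c" using zG H.mem_carrier by (simp add: m_assoc[symmetric])
    then show "\<exists>h\<in>?H. \<exists>c\<in>C. ?z = h \<otimes> c" using h c by blast
  qed
  then show False using gH by blast
qed

end

section \<open>Switching elements\<close>

lemma (in group) inv_mult_cancel:
  assumes "x \<in> carrier G" "y \<in> carrier G"
  shows "inv x \<otimes> (x \<otimes> y) = y" "x \<otimes> (inv x \<otimes> y) = y"
  using assms by (simp_all add: m_assoc[symmetric])

text \<open>The elements conjugating \<open>a\<close> to \<open>b\<close> form a coset of the centralizer of \<open>a\<close>, and by a theorem of
  B. H. Neumann finitely many cosets of subgroups of infinite index do not cover a group. Here the proof is an
  induction over the set of the elements \<open>a\<close>: the cosets of the centralizer of \<open>a\<close> are infinitely many and
  disjoint, so one that is not in the list would be covered by the cosets of the other centralizers.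
  Then so would be all its translates, and \<open>a\<close> could be omitted.\<close>

lemma (in group) conjugators_do_not_cover:
  assumes "finite A" "A \<subseteq> carrier G" "\<And>a. a \<in> A \<Longrightarrow> infinite {g \<otimes> a \<otimes> inv g |g. g \<in> carrier G}"
    and "finite K" "K \<subseteq> A \<times> carrier G"
  shows "\<exists>g \<in> carrier G. \<forall>(a, b) \<in> K. g \<otimes> a \<otimes> inv g \<noteq> b"
  using assms
proof (induction A arbitrary: K rule: finite_induct)
  case empty
  then show ?case using one_closed by auto
next
  case (insert a A)
  let ?T = "\<lambda>a b. {g \<in> carrier G. g \<otimes> a \<otimes> inv g = b}"
  have aG: "a \<in> carrier G" using insert.prems by simp
  show ?case
  proof (rule ccontr)
    assume "\<not> ?thesis"
    then have cover: "\<And>g. g \<in> carrier G \<Longrightarrow> \<exists>(c, b) \<in> K. g \<in> ?T c b" by fastforce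
    let ?B = "{b. (a, b) \<in> K}"
    have "?B = snd ` (K \<inter> {a} \<times> UNIV)" by force
    then have "finite ?B" using insert.prems(3) by simp
    moreover have "infinite {g \<otimes> a \<otimes> inv g |g. g \<in> carrier G}" using insert.prems(2) by blast
    ultimately have "{g \<otimes> a \<otimes> inv g |g. g \<in> carrier G} - ?B \<noteq> {}"
      by (intro infinite_imp_nonempty Diff_infinite_finite)
    then obtain b0 where "b0 \<in> {g \<otimes> a \<otimes> inv g |g. g \<in> carrier G} - ?B" by blast
    then obtain g0 where g0: "g0 \<in> carrier G" "b0 = g0 \<otimes> a \<otimes> inv g0" and b0: "(a, b0) \<notin> K" by blast
    \<comment> \<open>\<open>w b\<close> carries the conjugators from \<open>a\<close> to \<open>b0\<close> to the conjugators from \<open>a\<close> to \<open>b\<close>.\<close>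
    define w where "w b = (SOME k. k \<in> ?T a b) \<otimes> inv g0" for b
    define K' where "K' = (K \<union> (\<lambda>((c, b), (c', b')). (c', w b \<otimes> b' \<otimes> inv (w b))) ` (K \<times> K)) \<inter> A \<times> carrier G"
    have K'fin: "finite K'" unfolding K'_def using insert.prems(3) by simp
    have K'sub: "K' \<subseteq> A \<times> carrier G" unfolding K'_def by blast
    have "\<exists>g \<in> carrier G. \<forall>(c, b) \<in> K'. g \<otimes> c \<otimes> inv g \<noteq> b"
      by (rule insert.IH[OF _ _ K'fin K'sub]) (use insert.prems in auto)
    then obtain g where g: "g \<in> carrier G" and gK: "\<And>c b. (c, b) \<in> K' \<Longrightarrow> g \<otimes> c \<otimes> inv g \<noteq> b" by blast
    obtain c b where cb: "(c, b) \<in> K" "g \<otimes> c \<otimes> inv g = b" using cover[OF g] by auto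
    have "c \<notin> A" using gK[of c b] cb insert.prems(4) by (auto simp: K'_def)
    then have ca: "c = a" using cb insert.prems(4) by auto
    define k where "k = (SOME k. k \<in> ?T a b)"
    have "g \<in> ?T a b" using g cb ca by simp
    then have k: "k \<in> carrier G" "k \<otimes> a \<otimes> inv k = b" using someI[of "\<lambda>k. k \<in> ?T a b" g] by (auto simp: k_def)
    have w: "w b \<in> carrier G" using k g0 by (simp add: w_def k_def)
    have wk: "w b = k \<otimes> inv g0" by (simp add: w_def k_def)
    define g' where "g' = inv (w b) \<otimes> g"
    have g': "g' \<in> carrier G" using w g by (simp add: g'_def)
    have gg': "g = w b \<otimes> g'" using w g by (simp add: g'_def m_assoc[symmetric])
    \<comment> \<open>\<open>g'\<close> lies in the coset of conjugators from \<open>a\<close> to \<open>b0\<close>, which is not in the list.\<close>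
    have "g' \<otimes> a \<otimes> inv g' = b0"
    proof -
      have "g' \<otimes> a \<otimes> inv g' = inv (w b) \<otimes> (g \<otimes> a \<otimes> inv g) \<otimes> w b"
        using w g aG by (simp add: g'_def inv_mult_group m_assoc)
      also have "g \<otimes> a \<otimes> inv g = k \<otimes> a \<otimes> inv k" using cb ca k by simp
      also have "inv (w b) \<otimes> (k \<otimes> a \<otimes> inv k) \<otimes> w b = g0 \<otimes> a \<otimes> inv g0"
        using k(1) g0(1) aG by (simp add: wk inv_mult_group m_assoc inv_mult_cancel)
      finally show ?thesis by (simp add: g0(2))
    qed
    moreover obtain c' b' where c'b': "(c', b') \<in> K" "g' \<otimes> c' \<otimes> inv g' = b'" using cover[OF g'] by auto
    ultimately have "c' \<noteq> a" using b0 by auto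
    then have c'A: "c' \<in> A" and b'G: "b' \<in> carrier G" using c'b' insert.prems(4) by auto
    have c'G: "c' \<in> carrier G" using c'A insert.prems by auto
    have eq: "g \<otimes> c' \<otimes> inv g = w b \<otimes> b' \<otimes> inv (w b)"
      unfolding gg' using w g' c'G c'b'(2)[symmetric] by (simp add: inv_mult_group m_assoc)
    have "(c', w b \<otimes> b' \<otimes> inv (w b)) \<in> K'"
      unfolding K'_def using cb c'b' c'A b'G w
      by (intro IntI UnI2 image_eqI[of _ _ "((c, b), (c', b'))"]) auto
    then show False using gK eq by blast
  qed
qed

lemma (in group) switching_element:
  assumes icc: "icc_group G" and nontrivial: "carrier G \<noteq> {\<one>}"
    and X: "finite X" "X \<subseteq> carrier G" and Y: "finite Y" "Y \<subseteq> carrier G"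
  shows "\<exists>g \<in> carrier G. g \<notin> Y \<and> (\<forall>a \<in> X. a \<noteq> \<one> \<longrightarrow> g \<otimes> a \<otimes> inv g \<notin> X)"
proof -
  obtain a0 where a0: "a0 \<in> carrier G" "a0 \<noteq> \<one>" using nontrivial one_closed by blast
  let ?A = "insert a0 (X - {\<one>})"
  \<comment> \<open>The pairs with \<open>a0\<close> keep \<open>g\<close> out of \<open>Y\<close>: an element of \<open>Y\<close> conjugates \<open>a0\<close> to an excluded element.\<close>
  let ?K = "(X - {\<one>}) \<times> X \<union> (\<lambda>y. (a0, y \<otimes> a0 \<otimes> inv y)) ` Y"
  have "\<exists>g \<in> carrier G. \<forall>(a, b) \<in> ?K. g \<otimes> a \<otimes> inv g \<noteq> b"
  proof (rule conjugators_do_not_cover)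
    show "infinite {g \<otimes> a \<otimes> inv g |g. g \<in> carrier G}" if "a \<in> ?A" for a
      using icc that a0 X by (auto simp: icc_group_def)
  qed (use a0 X Y in auto)
  then obtain g where g: "g \<in> carrier G" and gK: "\<And>a b. (a, b) \<in> ?K \<Longrightarrow> g \<otimes> a \<otimes> inv g \<noteq> b" by blast
  have "g \<notin> Y" using gK[of a0 "g \<otimes> a0 \<otimes> inv g"] by blast
  moreover have "g \<otimes> a \<otimes> inv g \<notin> X" if "a \<in> X" "a \<noteq> \<one>" for a
    using gK[of a "g \<otimes> a \<otimes> inv g"] that by blast
  ultimately show ?thesis using g by blast
qed

text \<open>If \<open>u \<otimes> g \<otimes> w = u' \<otimes> g \<otimes> w'\<close>, then \<open>g\<close> conjugates \<open>w' \<otimes> inv w\<close> to \<open>inv u' \<otimes> u\<close>, which a switching element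
  for the set of all such quotients does only if both are the identity.\<close>

lemma (in group) decoding_element:
  assumes icc: "icc_group G" and nontrivial: "carrier G \<noteq> {\<one>}"
    and W: "finite W" "W \<subseteq> carrier G" and Z: "finite Z" "Z \<subseteq> carrier G"
  shows "\<exists>g \<in> carrier G. (\<forall>u \<in> W. \<forall>w \<in> W. \<forall>z \<in> Z. u \<otimes> g \<otimes> w \<noteq> z) \<and>
    (\<forall>u \<in> W. \<forall>w \<in> W. \<forall>u' \<in> W. \<forall>w' \<in> W. u \<otimes> g \<otimes> w = u' \<otimes> g \<otimes> w' \<longrightarrow> u = u')"
proof -
  define X where "X = (\<lambda>(u, w). inv u \<otimes> w) ` (W \<times> W) \<union> (\<lambda>(u, w). u \<otimes> inv w) ` (W \<times> W)"
  define Y where "Y = (\<lambda>(u, z, w). inv u \<otimes> z \<otimes> inv w) ` (W \<times> Z \<times> W)"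
  have "finite X" "finite Y" using W Z by (auto simp: X_def Y_def)
  moreover have "X \<subseteq> carrier G" "Y \<subseteq> carrier G" using W Z by (auto simp: X_def Y_def subset_iff)
  ultimately obtain g where g: "g \<in> carrier G" "g \<notin> Y"
    and gX: "\<And>x. x \<in> X \<Longrightarrow> x \<noteq> \<one> \<Longrightarrow> g \<otimes> x \<otimes> inv g \<notin> X"
    using switching_element[OF icc nontrivial, of X Y] by blast
  have "u \<otimes> g \<otimes> w \<noteq> z" if u: "u \<in> W" and w: "w \<in> W" and z: "z \<in> Z" for u w z
  proof
    assume eq: "u \<otimes> g \<otimes> w = z"
    have c: "u \<in> carrier G" "w \<in> carrier G" using u w W by auto
    have "inv u \<otimes> z \<otimes> inv w = g"
      unfolding eq[symmetric] using c g(1) by (simp add: m_assoc inv_mult_cancel)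
    then have "g \<in> Y" unfolding Y_def using u w z by (intro image_eqI[of _ _ "(u, z, w)"]) auto
    then show False using g(2) by blast
  qed
  moreover have "u = u'" if u: "u \<in> W" "u' \<in> W" and w: "w \<in> W" "w' \<in> W"
    and e: "u \<otimes> g \<otimes> w = u' \<otimes> g \<otimes> w'" for u u' w w'
  proof -
    have c: "u \<in> carrier G" "w \<in> carrier G" "u' \<in> carrier G" "w' \<in> carrier G" using u w W by auto
    let ?x = "w' \<otimes> inv w"
    have "g \<otimes> ?x \<otimes> inv g = inv u' \<otimes> (u' \<otimes> g \<otimes> w') \<otimes> inv w \<otimes> inv g"
      using c g(1) by (simp add: m_assoc inv_mult_cancel)
    also have "\<dots> = inv u' \<otimes> u"
      unfolding e[symmetric] using c g(1) by (simp add: m_assoc inv_mult_cancel)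
    finally have conj: "g \<otimes> ?x \<otimes> inv g = inv u' \<otimes> u" .
    have X: "?x \<in> X" "inv u' \<otimes> u \<in> X" using u w by (auto simp: X_def)
    have "?x = \<one>" using gX[OF X(1)] conj X(2) by metis
    then have "inv u' \<otimes> u = \<one>" using conj g(1) by simp
    then show "u = u'" using c inv_mult_cancel(2)[of u' u] by simp
  qed
  ultimately show ?thesis using g(1) by blast
qed

section \<open>Foelner sets\<close>

text \<open>Rado's proof of Hall's theorem: in a minimal family of sets that satisfies the marriage condition
  all sets are singletons. Otherwise removing either of two elements of a set violates the
  condition at two index sets, and counting their union and intersection gives a
  contradiction. Since the sets are finite, intersections of chains satisfy the condition again, and Zorn's lemma gives a minimal
  family. Families are encoded as relations.\<close>

lemma marriage:
  fixes A :: "'i \<Rightarrow> 'b set"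
  assumes fin: "\<And>i. i \<in> I \<Longrightarrow> finite (A i)"
    and hall: "\<And>J. J \<subseteq> I \<Longrightarrow> finite J \<Longrightarrow> card J \<le> card (\<Union>(A ` J))"
  shows "\<exists>f. inj_on f I \<and> (\<forall>i \<in> I. f i \<in> A i)"
proof -
  define R where "R = (SIGMA i : I. A i)"
  define good where "good S \<longleftrightarrow> S \<subseteq> R \<and> (\<forall>J. J \<subseteq> I \<longrightarrow> finite J \<longrightarrow> card J \<le> card (S `` J))" for S
  have finJ: "finite (S `` J)" if "S \<subseteq> R" "J \<subseteq> I" "finite J" for S J
  proof -
    have "S `` J \<subseteq> (\<Union>(A ` J))" using that by (auto simp: R_def)
    moreover have "finite (\<Union>(A ` J))" using that fin by blast
    ultimately show ?thesis by (rule finite_subset)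
  qed
  have goodR: "good R"
  proof -
    have "R `` J = \<Union>(A ` J)" if "J \<subseteq> I" for J using that by (auto simp: R_def)
    then show ?thesis using hall by (simp add: good_def)
  qed
  \<comment> \<open>Maximal complements, because Zorn's lemma is about maximal elements.\<close>
  have "\<exists>M \<in> {C. C \<subseteq> R \<and> good (R - C)}. \<forall>X \<in> {C. C \<subseteq> R \<and> good (R - C)}. M \<subseteq> X \<longrightarrow> X = M"
  proof (rule subset_Zorn_nonempty)
    show "{C. C \<subseteq> R \<and> good (R - C)} \<noteq> {}" using goodR by (auto intro!: exI[of _ "{}"])
  next
    fix \<C> assume ne: "\<C> \<noteq> {}" and ch: "subset.chain {C. C \<subseteq> R \<and> good (R - C)} \<C>"
    have sub: "C \<subseteq> R" "good (R - C)" if "C \<in> \<C>" for C using ch that by (auto simp: subset_chain_def)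
    have lin: "C \<subseteq> D \<or> D \<subseteq> C" if "C \<in> \<C>" "D \<in> \<C>" for C D using ch that by (auto simp: subset_chain_def)
    have "card J \<le> card ((R - \<Union>\<C>) `` J)" if J: "J \<subseteq> I" "finite J" for J
    proof -
      let ?r = "\<lambda>C. (R - C) \<inter> J \<times> UNIV"
      have finr: "finite (?r C)" for C
      proof (rule finite_subset)
        show "?r C \<subseteq> (SIGMA i : J. A i)" by (auto simp: R_def)
        show "finite (SIGMA i : J. A i)" using J fin by auto
      qed
      obtain C where C: "C \<in> \<C>" "\<And>D. D \<in> \<C> \<Longrightarrow> card (?r C) \<le> card (?r D)"
        using ne ex_has_least_nat[of "\<lambda>C. C \<in> \<C>" _ "\<lambda>C. card (?r C)"] by (metis ex_in_conv)
      have "?r C \<subseteq> ?r D" if D: "D \<in> \<C>" for D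
      proof (cases "C \<subseteq> D")
        case True
        then have "?r D \<subseteq> ?r C" by auto
        then have "?r D = ?r C" using C(2)[OF D] finr by (intro card_subset_eq) (auto intro: le_antisym card_mono)
        then show ?thesis by simp
      next
        case False
        then show ?thesis using lin[OF C(1) D] by auto
      qed
      then have "(R - \<Union>\<C>) `` J = (R - C) `` J" using C(1) by blast
      then show ?thesis using sub(2)[OF C(1)] J by (simp add: good_def)
    qed
    then show "\<Union>\<C> \<in> {C. C \<subseteq> R \<and> good (R - C)}" using sub by (auto simp: good_def)
  qed
  then obtain M where M': "M \<in> {C. C \<subseteq> R \<and> good (R - C)}"
    and max': "\<forall>X \<in> {C. C \<subseteq> R \<and> good (R - C)}. M \<subseteq> X \<longrightarrow> X = M" by (rule bexE)
  have M: "M \<subseteq> R" "good (R - M)" using M' by simp_all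
  have max: "X = M" if "X \<subseteq> R" "good (R - X)" "M \<subseteq> X" for X using max' that by simp
  define S where "S = R - M"
  have S: "good S" using M by (simp add: S_def)
  have SR: "S \<subseteq> R" by (auto simp: S_def)
  have min: "S' = S" if "S' \<subseteq> S" "good S'" for S'
  proof -
    have "R - (R - S') = S'" "M \<subseteq> R - S'" using that M(1) by (auto simp: S_def)
    then have "R - S' = M" using max[of "R - S'"] that by auto
    then show ?thesis using \<open>R - (R - S') = S'\<close> by (auto simp: S_def)
  qed
  have Hall: "card J \<le> card (S `` J)" if "J \<subseteq> I" "finite J" for J using S that by (simp add: good_def)
  have uniq: "x = y" if xy: "(i, x) \<in> S" "(i, y) \<in> S" for i x y
  proof (rule ccontr)
    assume "x \<noteq> y"
    have iI: "i \<in> I" using xy SR by (auto simp: R_def)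
    have fail: "\<exists>J. J \<subseteq> I \<and> finite J \<and> i \<notin> J \<and> card (S `` J \<union> (S `` {i} - {z})) \<le> card J"
      if z: "(i, z) \<in> S" for z
    proof -
      have "\<not> good (S - {(i, z)})" using min[of "S - {(i, z)}"] z by blast
      then obtain J where J: "J \<subseteq> I" "finite J" "card ((S - {(i, z)}) `` J) < card J"
        using SR by (auto simp: good_def not_le)
      have iJ: "i \<in> J"
      proof (rule ccontr)
        assume "i \<notin> J"
        then have "(S - {(i, z)}) `` J = S `` J" by auto
        then show False using Hall[OF J(1,2)] J(3) by simp
      qed
      have "(S - {(i, z)}) `` J = S `` (J - {i}) \<union> (S `` {i} - {z})" using iJ by auto
      moreover have "card (J - {i}) = card J - 1" using iJ J by simp
      ultimately show ?thesis using J by (intro exI[of _ "J - {i}"]) auto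
    qed
    obtain J where J: "J \<subseteq> I" "finite J" "i \<notin> J" "card (S `` J \<union> (S `` {i} - {x})) \<le> card J" using fail[OF xy(1)] by blast
    obtain K where K: "K \<subseteq> I" "finite K" "i \<notin> K" "card (S `` K \<union> (S `` {i} - {y})) \<le> card K" using fail[OF xy(2)] by blast
    let ?U = "S `` J \<union> (S `` {i} - {x})" and ?V = "S `` K \<union> (S `` {i} - {y})"
    have fU: "finite ?U" and fV: "finite ?V" using finJ[OF SR] J K iI by auto
    have "S `` insert i (J \<union> K) = ?U \<union> ?V" using \<open>x \<noteq> y\<close> by auto
    then have "card (insert i (J \<union> K)) \<le> card (?U \<union> ?V)" using Hall[of "insert i (J \<union> K)"] J K iI by simp
    moreover have "card (insert i (J \<union> K)) = Suc (card (J \<union> K))" using J K by simp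
    moreover have "card (J \<inter> K) \<le> card (?U \<inter> ?V)"
    proof -
      have "card (J \<inter> K) \<le> card (S `` (J \<inter> K))" using J K by (intro Hall) auto
      also have "\<dots> \<le> card (?U \<inter> ?V)" using fU by (intro card_mono) auto
      finally show ?thesis .
    qed
    moreover have "card (?U \<union> ?V) + card (?U \<inter> ?V) = card ?U + card ?V" using card_Un_Int[OF fU fV] by simp
    moreover have "card (J \<union> K) + card (J \<inter> K) = card J + card K" using card_Un_Int[OF J(2) K(2)] by simp
    ultimately show False using J(4) K(4) by linarith
  qed
  have ex: "\<exists>x. (i, x) \<in> S" if "i \<in> I" for i
    using Hall[of "{i}"] that by (auto simp: Suc_le_eq card_gt_0_iff)
  define f where "f i = (SOME x. (i, x) \<in> S)" for i
  have f: "(i, f i) \<in> S" if "i \<in> I" for i unfolding f_def using ex[OF that] by (rule someI_ex)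
  have "inj_on f I"
  proof (rule inj_onI, rule ccontr)
    fix i j assume ij: "i \<in> I" "j \<in> I" "f i = f j" "i \<noteq> j"
    have "S `` {i, j} \<subseteq> {f i}" using f[OF ij(1)] f[OF ij(2)] uniq ij(3) by auto
    then have "card (S `` {i, j}) \<le> 1" using card_mono[of "{f i}"] by simp
    then show False using Hall[of "{i, j}"] ij by simp
  qed
  then show ?thesis using f SR by (intro exI[of _ f]) (auto simp: R_def)
qed

lemma finitely_additive_sum:
  fixes m :: "'a set \<Rightarrow> real"
  assumes add: "\<And>A B. A \<subseteq> X \<Longrightarrow> B \<subseteq> X \<Longrightarrow> A \<inter> B = {} \<Longrightarrow> m (A \<union> B) = m A + m B"
    and "finite J" "\<And>j. j \<in> J \<Longrightarrow> A j \<subseteq> X" "disjoint_family_on A J"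
  shows "m (\<Union>j\<in>J. A j) = (\<Sum>j\<in>J. m (A j))"
  using assms(2-)
proof (induction J rule: finite_induct)
  case empty
  then show ?case using add[of "{}" "{}"] by simp
next
  case (insert j J)
  have "A j \<inter> (\<Union>i\<in>J. A i) = {}" using insert.prems(2) insert.hyps by (auto simp: disjoint_family_on_def)
  then have "m (\<Union>i\<in>insert j J. A i) = m (A j) + m (\<Union>i\<in>J. A i)"
    using insert.prems by (simp add: add UN_least)
  also have "m (\<Union>i\<in>J. A i) = (\<Sum>i\<in>J. m (A i))"
    using insert by (intro insert.IH) (auto simp: disjoint_family_on_def)
  finally show ?case using insert by simp
qed

text \<open>If \<open>card (T F) \<ge> 2 card F\<close> for all finite \<open>F\<close>, the marriage theorem gives a 2-to-1 matching
  within translates by \<open>T\<close>, that is, a paradoxical decomposition of the group.\<close>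

lemma (in group) amenable_no_doubling:
  assumes am: "amenable_group G" and T: "finite T" "T \<subseteq> carrier G"
  shows "\<exists>F. finite F \<and> F \<subseteq> carrier G \<and> card (\<Union>x\<in>F. (\<lambda>t. t \<otimes> x) ` T) < 2 * card F"
proof (rule ccontr)
  assume "\<not> ?thesis"
  then have double: "\<And>F. finite F \<Longrightarrow> F \<subseteq> carrier G \<Longrightarrow> 2 * card F \<le> card (\<Union>x\<in>F. (\<lambda>t. t \<otimes> x) ` T)"
    by (simp add: not_less)
  obtain m :: "'a set \<Rightarrow> real" where m: "m (carrier G) = 1 \<and> (\<forall>A. A \<subseteq> carrier G \<longrightarrow> 0 \<le> m A) \<and>
      (\<forall>A B. A \<subseteq> carrier G \<longrightarrow> B \<subseteq> carrier G \<longrightarrow> A \<inter> B = {} \<longrightarrow> m (A \<union> B) = m A + m B) \<and>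
      (\<forall>g \<in> carrier G. \<forall>A. A \<subseteq> carrier G \<longrightarrow> m (g <# A) = m A)"
    using am[unfolded amenable_group_def, THEN conjunct2] by (rule exE)
  have m1: "m (carrier G) = 1" using m by simp
  have m0: "0 \<le> m A" if "A \<subseteq> carrier G" for A using m that by simp
  have add: "m (A \<union> B) = m A + m B" if "A \<subseteq> carrier G" "B \<subseteq> carrier G" "A \<inter> B = {}" for A B using m that by simp
  have inv: "m (g <# A) = m A" if "g \<in> carrier G" "A \<subseteq> carrier G" for g A using m that by simp
  let ?I = "carrier G \<times> (UNIV :: bool set)"
  have "\<exists>f. inj_on f ?I \<and> (\<forall>i \<in> ?I. f i \<in> (\<lambda>t. t \<otimes> fst i) ` T)"
  proof (rule marriage)
    fix J assume J: "J \<subseteq> ?I" "finite J"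
    have "card J \<le> card (fst ` J \<times> (UNIV :: bool set))"
      using J by (intro card_mono) (auto intro: rev_image_eqI)
    also have "\<dots> = 2 * card (fst ` J)" by (simp add: card_cartesian_product)
    also have "\<dots> \<le> card (\<Union>x\<in>fst ` J. (\<lambda>t. t \<otimes> x) ` T)" using J by (intro double) auto
    finally show "card J \<le> card (\<Union>((\<lambda>i. (\<lambda>t. t \<otimes> fst i) ` T) ` J))" by (simp add: image_image)
  qed (use T in auto)
  then obtain f where inj: "inj_on f ?I" and f: "\<And>i. i \<in> ?I \<Longrightarrow> f i \<in> (\<lambda>t. t \<otimes> fst i) ` T" by blast
  define X where "X = (\<lambda>(b, t). {x \<in> carrier G. f (x, b) = t \<otimes> x})"
  let ?J = "(UNIV :: bool set) \<times> T"
  have XG: "X j \<subseteq> carrier G" for j by (auto simp: X_def)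
  have part: "(\<Sum>t\<in>T. m (X (b, t))) = 1" for b
  proof -
    have "(\<Union>t\<in>T. X (b, t)) = carrier G" using f T by (fastforce simp: X_def)
    moreover have "m (\<Union>t\<in>T. X (b, t)) = (\<Sum>t\<in>T. m (X (b, t)))"
    proof (rule finitely_additive_sum[OF add T(1)])
      show "disjoint_family_on (\<lambda>t. X (b, t)) T"
        using T by (auto simp: disjoint_family_on_def X_def right_cancel subset_iff)
    qed (use XG in auto)
    ultimately show ?thesis using m1 by simp
  qed
  have tX: "snd j <# X j \<subseteq> carrier G" if "j \<in> ?J" for j
    using that T by (intro l_coset_subset_G XG) auto
  have "disjoint_family_on (\<lambda>j. snd j <# X j) ?J"
  proof (unfold disjoint_family_on_def, intro ballI impI, rule ccontr)
    fix i j assume ij: "i \<in> ?J" "j \<in> ?J" "i \<noteq> j" and ne: "(snd i <# X i) \<inter> (snd j <# X j) \<noteq> {}"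
    obtain b t c s where bt: "i = (b, t)" "j = (c, s)" by (cases i, cases j)
    obtain x y where x: "x \<in> carrier G" "f (x, b) = t \<otimes> x" and y: "y \<in> carrier G" "f (y, c) = s \<otimes> y"
      and "t \<otimes> x = s \<otimes> y"
      using ne by (auto simp: bt X_def l_coset_def)
    then have "(x, b) = (y, c)" using inj_onD[OF inj, of "(x, b)" "(y, c)"] by simp
    then have "t = s" using \<open>t \<otimes> x = s \<otimes> y\<close> x T ij bt by (auto simp: right_cancel subset_iff)
    then show False using ij bt \<open>(x, b) = (y, c)\<close> by simp
  qed
  then have "m (\<Union>j\<in>?J. snd j <# X j) = (\<Sum>j\<in>?J. m (snd j <# X j))"
    using T tX by (intro finitely_additive_sum[OF add]) auto
  also have "\<dots> = (\<Sum>j\<in>?J. m (X j))" using T XG by (intro sum.cong refl inv) auto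
  also have "\<dots> = (\<Sum>b\<in>UNIV. \<Sum>t\<in>T. m (X (b, t)))" by (simp add: sum.cartesian_product)
  also have "\<dots> = 2" by (simp add: part)
  finally have two: "m (\<Union>j\<in>?J. snd j <# X j) = 2" .
  have U: "(\<Union>j\<in>?J. snd j <# X j) \<subseteq> carrier G" using tX by blast
  have "m (carrier G) = m (\<Union>j\<in>?J. snd j <# X j) + m (carrier G - (\<Union>j\<in>?J. snd j <# X j))"
    using U by (subst add[symmetric]) (auto simp: Un_absorb1)
  moreover have "0 \<le> m (carrier G - (\<Union>j\<in>?J. snd j <# X j))" by (rule m0) auto
  ultimately show False using two m1 by linarith
qed

text \<open>Otherwise multiplication by \<open>S\<close> together with the identity would enlarge all finite sets by the factor \<open>1 + e\<close>,
  and a power of it would double them.\<close>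

theorem (in group) foelner_sets:
  fixes e :: real
  assumes am: "amenable_group G" and S: "finite S" "S \<subseteq> carrier G" and e: "0 < e"
  shows "\<exists>F. finite F \<and> F \<noteq> {} \<and> F \<subseteq> carrier G \<and> (\<forall>s \<in> S. card ((\<lambda>x. s \<otimes> x) ` F - F) \<le> e * card F)"
proof (rule ccontr)
  assume no: "\<not> ?thesis"
  define S' where "S' = insert \<one> S"
  define mult where "mult F = (\<Union>x\<in>F. (\<lambda>t. t \<otimes> x) ` S')" for F
  have S': "finite S'" "S' \<subseteq> carrier G" "\<one> \<in> S'" using S by (auto simp: S'_def)
  have multG: "finite F \<Longrightarrow> F \<subseteq> carrier G \<Longrightarrow> finite (mult F) \<and> mult F \<subseteq> carrier G" for F
    using S' by (auto simp: mult_def subset_iff)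
  have grow: "(1 + e) * card F \<le> card (mult F)" if F: "finite F" "F \<subseteq> carrier G" for F
  proof (cases "F = {}")
    case False
    then obtain s where s: "s \<in> S" "e * card F < card ((\<lambda>x. s \<otimes> x) ` F - F)" using no F by (auto simp: not_le)
    have "card F + card ((\<lambda>x. s \<otimes> x) ` F - F) = card (F \<union> ((\<lambda>x. s \<otimes> x) ` F - F))"
      using F by (intro card_Un_disjoint[symmetric]) auto
    also have "\<dots> \<le> card (mult F)"
    proof (rule card_mono)
      show "finite (mult F)" using multG F by blast
      have "x \<in> mult F" if "x \<in> F" for x
      proof -
        have "x = \<one> \<otimes> x" using that F by auto
        then show ?thesis using that S' unfolding mult_def by blast
      qed
      then show "F \<union> ((\<lambda>x. s \<otimes> x) ` F - F) \<subseteq> mult F" using s by (auto simp: mult_def S'_def)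
    qed
    finally have "real (card F) + real (card ((\<lambda>x. s \<otimes> x) ` F - F)) \<le> card (mult F)" by linarith
    then show ?thesis using s by (simp add: algebra_simps)
  qed simp
  have pow: "finite ((mult ^^ k) F) \<and> (mult ^^ k) F \<subseteq> carrier G \<and> (1 + e)^k * card F \<le> card ((mult ^^ k) F)"
    if F: "finite F" "F \<subseteq> carrier G" for F k
  proof (induction k)
    case (Suc k)
    have "(1 + e) ^ Suc k * card F = (1 + e) * ((1 + e)^k * card F)" by simp
    also have "\<dots> \<le> (1 + e) * card ((mult ^^ k) F)" using Suc e by (intro mult_left_mono) auto
    also have "\<dots> \<le> card (mult ((mult ^^ k) F))" using Suc by (intro grow) auto
    finally show ?case using Suc multG by simp
  qed (use F in simp)
  obtain k where k: "2 < (1 + e)^k" using e real_arch_pow[of "1 + e" 2] by auto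
  define T where "T = (mult ^^ k) {\<one>}"
  have T: "finite T" "T \<subseteq> carrier G" using pow[of "{\<one>}" k] by (auto simp: T_def)
  have mult_T: "(mult ^^ k) F = (\<Union>x\<in>F. (\<lambda>t. t \<otimes> x) ` ((mult ^^ k) {\<one>}))" if F: "F \<subseteq> carrier G" for F k
  proof (induction k)
    case 0
    have "\<one> \<otimes> x = x" if "x \<in> F" for x using that F by auto
    then show ?case by simp
  next
    case (Suc k)
    have kG: "(mult ^^ k) {\<one>} \<subseteq> carrier G" using pow[of "{\<one>}" k] by auto
    have "mult (\<Union>x\<in>F. (\<lambda>t. t \<otimes> x) ` ((mult ^^ k) {\<one>})) = (\<Union>x\<in>F. (\<lambda>t. t \<otimes> x) ` mult ((mult ^^ k) {\<one>}))"
    proof (intro equalityI subsetI)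
      fix z assume "z \<in> mult (\<Union>x\<in>F. (\<lambda>t. t \<otimes> x) ` ((mult ^^ k) {\<one>}))"
      then obtain x t s where *: "x \<in> F" "t \<in> (mult ^^ k) {\<one>}" "s \<in> S'" "z = s \<otimes> (t \<otimes> x)" by (auto simp: mult_def)
      then have "z = (s \<otimes> t) \<otimes> x" using kG F S' by (auto simp: m_assoc subset_iff)
      moreover have "s \<otimes> t \<in> mult ((mult ^^ k) {\<one>})" using * by (auto simp: mult_def)
      ultimately show "z \<in> (\<Union>x\<in>F. (\<lambda>t. t \<otimes> x) ` mult ((mult ^^ k) {\<one>}))" using * by blast
    next
      fix z assume "z \<in> (\<Union>x\<in>F. (\<lambda>t. t \<otimes> x) ` mult ((mult ^^ k) {\<one>}))"
      then obtain x t s where *: "x \<in> F" "t \<in> (mult ^^ k) {\<one>}" "s \<in> S'" "z = (s \<otimes> t) \<otimes> x" by (auto simp: mult_def)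
      then have "z = s \<otimes> (t \<otimes> x)" using kG F S' by (auto simp: m_assoc subset_iff)
      then show "z \<in> mult (\<Union>x\<in>F. (\<lambda>t. t \<otimes> x) ` ((mult ^^ k) {\<one>}))" using * by (auto simp: mult_def)
    qed
    then show ?case using Suc by simp
  qed
  obtain F where F: "finite F" "F \<subseteq> carrier G" "card (\<Union>x\<in>F. (\<lambda>t. t \<otimes> x) ` T) < 2 * card F"
    using amenable_no_doubling[OF am T] by blast
  have "2 * real (card F) \<le> (1 + e)^k * card F" using k by (intro mult_right_mono) auto
  also have "\<dots> \<le> card ((mult ^^ k) F)" using pow F by blast
  also have "\<dots> = card (\<Union>x\<in>F. (\<lambda>t. t \<otimes> x) ` T)" using mult_T[OF F(2)] by (simp add: T_def)
  finally show False using F(3) by linarith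
qed

section \<open>The design of the steps\<close>

text \<open>A level above \<open>n\<close> has probability \<open>1 / (n + 2)\<close>; with this number of trials it fails to occur only
  with the summable probability \<open>exp (- n - 2)\<close>.\<close>

definition horizon :: "nat \<Rightarrow> nat" where
  "horizon n = (n + 2)\<^sup>2"

text \<open>Throughout, \<open>a\<close> enumerates the group and \<open>f k = (g k, \<Lambda> k)\<close> are the data of the level \<open>k\<close>.\<close>

definition (in monoid) step_set :: "(nat \<Rightarrow> 'a) \<Rightarrow> (nat \<Rightarrow> 'a \<times> 'a set) \<Rightarrow> nat \<Rightarrow> 'a set" where
  "step_set a f k = insert (a k) ((\<otimes>) (fst (f k)) ` snd (f k))"

definition (in monoid) low_steps :: "(nat \<Rightarrow> 'a) \<Rightarrow> (nat \<Rightarrow> 'a \<times> 'a set) \<Rightarrow> nat \<Rightarrow> 'a set" where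
  "low_steps a f n = (\<Union>k<n. step_set a f k)"

definition (in monoid) extend :: "'a set \<Rightarrow> 'a set \<Rightarrow> 'a set" where
  "extend S X = X \<union> (\<lambda>(x, s). x \<otimes> s) ` (X \<times> S)"

definition (in monoid) words :: "(nat \<Rightarrow> 'a) \<Rightarrow> (nat \<Rightarrow> 'a \<times> 'a set) \<Rightarrow> nat \<Rightarrow> nat \<Rightarrow> 'a set" where
  "words a f n i = (extend (low_steps a f n) ^^ i) (insert \<one> (a ` {..n}))"

text \<open>The window of \<open>n\<close> contains the positions before a record step of level \<open>n\<close> and, since \<open>\<one>\<close> is among
  the initial elements, the products of the steps from there to the next record. It depends only
  on the data of the levels below \<open>n\<close>.\<close>

abbreviation (in monoid) window :: "(nat \<Rightarrow> 'a) \<Rightarrow> (nat \<Rightarrow> 'a \<times> 'a set) \<Rightarrow> nat \<Rightarrow> 'a set" where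
  "window a f n \<equiv> words a f n (horizon n)"

text \<open>What is needed to read off from the coset of \<open>u \<otimes> g \<otimes> w\<close>, in this order: the coset of \<open>u\<close>, the level, and
  that it is not the coset of an element of the window, so that levels decrease from a position to
  its prefix.\<close>

definition (in monoid) switching ::
  "'a set \<Rightarrow> (nat \<Rightarrow> 'a) \<Rightarrow> (nat \<Rightarrow> 'a \<times> 'a set) \<Rightarrow> nat \<Rightarrow> 'a \<Rightarrow> bool" where
  "switching H a f n g \<longleftrightarrow>
    (\<forall>u \<in> window a f n. \<forall>w \<in> window a f n.
      (\<forall>u' \<in> window a f n. \<forall>w' \<in> window a f n. H #> (u \<otimes> g \<otimes> w) = H #> (u' \<otimes> g \<otimes> w') \<longrightarrow> H #> u = H #> u') \<and>
      (\<forall>k<n. \<forall>u' \<in> window a f k. \<forall>w' \<in> window a f k. H #> (u \<otimes> g \<otimes> w) \<noteq> H #> (u' \<otimes> fst (f k) \<otimes> w')) \<and>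
      (\<forall>v \<in> window a f n. H #> (u \<otimes> g \<otimes> w) \<noteq> H #> v))"

text \<open>The conjugates are those that appear when \<open>h\<close> is moved to the right of \<open>u \<otimes> g\<close>.\<close>

definition (in monoid) foelner ::
  "'a set \<Rightarrow> (nat \<Rightarrow> 'a) \<Rightarrow> (nat \<Rightarrow> 'a \<times> 'a set) \<Rightarrow> nat \<Rightarrow> 'a \<Rightarrow> 'a set \<Rightarrow> bool" where
  "foelner H a f n g \<Lambda> \<longleftrightarrow> finite \<Lambda> \<and> \<Lambda> \<noteq> {} \<and> \<Lambda> \<subseteq> H \<and>
    (\<forall>h \<in> H \<inter> a ` {..n}. \<forall>u \<in> window a f n.
      card ((\<lambda>l. (inv (u \<otimes> g) \<otimes> h \<otimes> (u \<otimes> g)) \<otimes> l) ` \<Lambda> - \<Lambda>) \<le> (1 / (real n + 2)) * card \<Lambda>)"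

locale step_design = normal H G for H and G (structure) +
  fixes a :: "nat \<Rightarrow> 'a" and f :: "nat \<Rightarrow> 'a \<times> 'a set"
  assumes range_a: "range a = carrier G"
    and g_closed: "fst (f n) \<in> carrier G"
    and switching: "H \<noteq> carrier G \<Longrightarrow> switching H a f n (fst (f n))"
    and foelner: "foelner H a f n (fst (f n)) (snd (f n))"

context group
begin

lemma extend_mono: "S \<subseteq> S' \<Longrightarrow> X \<subseteq> X' \<Longrightarrow> extend S X \<subseteq> extend S' X'"
  by (auto simp: extend_def)

lemma words_Suc: "words a f n (Suc i) = extend (low_steps a f n) (words a f n i)"
  by (simp add: words_def)

lemma words_mono: "i \<le> j \<Longrightarrow> words a f n i \<subseteq> words a f n j"
  by (rule lift_Suc_mono_le[of "words a f n"]) (auto simp: words_Suc extend_def)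

lemma words_step: "x \<in> words a f n i \<Longrightarrow> s \<in> low_steps a f n \<Longrightarrow> x \<otimes> s \<in> words a f n (Suc i)"
  by (force simp: words_Suc extend_def)

lemma words_mono_level: "n \<le> m \<Longrightarrow> words a f n i \<subseteq> words a f m i"
proof (induction i)
  case 0
  then show ?case by (auto simp: words_def)
next
  case (Suc i)
  have "low_steps a f n \<subseteq> low_steps a f m" using Suc by (fastforce simp: low_steps_def)
  then show ?case using Suc by (simp add: words_Suc extend_mono)
qed

lemma window_mono: "n \<le> m \<Longrightarrow> window a f n \<subseteq> window a f m"
  using words_mono_level[of n m a f "horizon n"] words_mono[of "horizon n" "horizon m" a f m]
  by (auto simp: horizon_def)

lemma one_in_words: "\<one> \<in> words a f n i"
  using words_mono[of 0 i a f n] by (auto simp: words_def)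

lemma initial_in_words: "k \<le> n \<Longrightarrow> a k \<in> words a f n i"
  using words_mono[of 0 i a f n] by (auto simp: words_def)

lemma words_cong: "(\<And>k. k < n \<Longrightarrow> f k = f' k) \<Longrightarrow> words a f n i = words a f' n i"
proof -
  assume "\<And>k. k < n \<Longrightarrow> f k = f' k"
  then have "low_steps a f n = low_steps a f' n" by (simp add: low_steps_def step_set_def)
  then show ?thesis by (simp add: words_def)
qed

lemma words_finite_closed:
  assumes "range a \<subseteq> carrier G" "\<And>k. k < n \<Longrightarrow> fst (f k) \<in> carrier G \<and> finite (snd (f k)) \<and> snd (f k) \<subseteq> carrier G"
  shows "finite (words a f n i) \<and> words a f n i \<subseteq> carrier G"
proof -
  have S: "finite (low_steps a f n)" "low_steps a f n \<subseteq> carrier G"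
    using assms by (fastforce simp: low_steps_def step_set_def)+
  show ?thesis
  proof (induction i)
    case 0
    then show ?case using assms(1) by (auto simp: words_def)
  next
    case (Suc i)
    then show ?case using S by (auto simp: words_Suc extend_def subset_iff)
  qed
qed

lemma switching_exists:
  assumes H: "H \<lhd> G" and icc: "icc_group (G Mod H)" and HG: "H \<noteq> carrier G"
    and fin: "\<And>k. k \<le> n \<Longrightarrow> finite (window a f k) \<and> window a f k \<subseteq> carrier G"
    and fG: "\<And>k. k < n \<Longrightarrow> fst (f k) \<in> carrier G"
  shows "\<exists>g \<in> carrier G. switching H a f n g"
proof -
  interpret H: normal H G by (rule H)
  let ?Q = "G Mod H"
  interpret Q: group ?Q by (rule H.factorgroup_is_group)
  let ?r = "\<lambda>x. H #> x"
  have hom: "?r (x \<otimes> y) = ?r x \<otimes>\<^bsub>?Q\<^esub> ?r y" if "x \<in> carrier G" "y \<in> carrier G" for x y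
    using H.rcos_sum[OF that] by (simp add: FactGroup_def)
  have rQ: "?r x \<in> carrier ?Q" if "x \<in> carrier G" for x using that by (auto simp: FactGroup_def RCOSETS_def)
  have "carrier ?Q \<noteq> {\<one>\<^bsub>?Q\<^esub>}"
  proof
    assume triv: "carrier ?Q = {\<one>\<^bsub>?Q\<^esub>}"
    have "x \<in> H" if x: "x \<in> carrier G" for x
    proof -
      have "?r x = H" using rQ[OF x] triv by (simp add: FactGroup_def)
      then show ?thesis using rcos_self[OF x H.is_subgroup] by simp
    qed
    then show False using HG H.subset by blast
  qed
  define W where "W = window a f n"
  have W: "finite W" "W \<subseteq> carrier G" using fin[of n] by (auto simp: W_def)
  define Z where "Z = W \<union> (\<Union>k<n. (\<lambda>(u, w). u \<otimes> fst (f k) \<otimes> w) ` (window a f k \<times> window a f k))"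
  have Z: "finite Z" "Z \<subseteq> carrier G"
  proof -
    have 1: "(\<lambda>(u, w). u \<otimes> fst (f k) \<otimes> w) ` (window a f k \<times> window a f k) \<subseteq> carrier G" if "k < n" for k
    proof -
      have "window a f k \<subseteq> carrier G" "fst (f k) \<in> carrier G" using that fin[of k] fG by auto
      then show ?thesis by (auto simp: subset_iff)
    qed
    show "Z \<subseteq> carrier G" unfolding Z_def using W 1 by blast
    show "finite Z" unfolding Z_def using W fin by auto
  qed
  have "\<exists>q \<in> carrier ?Q. (\<forall>u \<in> ?r ` W. \<forall>w \<in> ?r ` W. \<forall>z \<in> ?r ` Z. u \<otimes>\<^bsub>?Q\<^esub> q \<otimes>\<^bsub>?Q\<^esub> w \<noteq> z) \<and>
      (\<forall>u \<in> ?r ` W. \<forall>w \<in> ?r ` W. \<forall>u' \<in> ?r ` W. \<forall>w' \<in> ?r ` W.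
        u \<otimes>\<^bsub>?Q\<^esub> q \<otimes>\<^bsub>?Q\<^esub> w = u' \<otimes>\<^bsub>?Q\<^esub> q \<otimes>\<^bsub>?Q\<^esub> w' \<longrightarrow> u = u')"
    by (rule Q.decoding_element[OF icc \<open>carrier ?Q \<noteq> {\<one>\<^bsub>?Q\<^esub>}\<close>]) (use W Z rQ in auto)
  then obtain q where q: "q \<in> carrier ?Q"
    and qZ: "\<forall>u \<in> ?r ` W. \<forall>w \<in> ?r ` W. \<forall>z \<in> ?r ` Z. u \<otimes>\<^bsub>?Q\<^esub> q \<otimes>\<^bsub>?Q\<^esub> w \<noteq> z"
    and qW: "\<forall>u \<in> ?r ` W. \<forall>w \<in> ?r ` W. \<forall>u' \<in> ?r ` W. \<forall>w' \<in> ?r ` W.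
        u \<otimes>\<^bsub>?Q\<^esub> q \<otimes>\<^bsub>?Q\<^esub> w = u' \<otimes>\<^bsub>?Q\<^esub> q \<otimes>\<^bsub>?Q\<^esub> w' \<longrightarrow> u = u'" by (elim bexE conjE)
  obtain g where g: "g \<in> carrier G" "q = ?r g" using q by (auto simp: FactGroup_def RCOSETS_def)
  have r3: "?r (u \<otimes> g \<otimes> w) = ?r u \<otimes>\<^bsub>?Q\<^esub> q \<otimes>\<^bsub>?Q\<^esub> ?r w" if "u \<in> W" "w \<in> W" for u w
  proof -
    have "u \<in> carrier G" "w \<in> carrier G" using that W by auto
    then show ?thesis by (simp only: hom m_closed g)
  qed
  have avoid: "?r (u \<otimes> g \<otimes> w) \<noteq> ?r z" if "u \<in> W" "w \<in> W" "z \<in> Z" for u w z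
    unfolding r3[OF that(1,2)] by (rule qZ[rule_format]) (use that in auto)
  have inj: "?r u = ?r u'" if "u \<in> W" "u' \<in> W" "w \<in> W" "w' \<in> W"
    and "?r (u \<otimes> g \<otimes> w) = ?r (u' \<otimes> g \<otimes> w')" for u u' w w'
    using that(5) unfolding r3[OF that(1,3)] r3[OF that(2,4)] by (rule qW[rule_format, rotated 4]) (use that in auto)
  have "switching H a f n g"
    unfolding switching_def W_def[symmetric]
  proof (intro ballI conjI allI impI)
    fix u w u' w' assume "u \<in> W" "w \<in> W" "u' \<in> W" "w' \<in> W" "?r (u \<otimes> g \<otimes> w) = ?r (u' \<otimes> g \<otimes> w')"
    then show "?r u = ?r u'" using inj by blast
  next
    fix u w k u' w' assume *: "u \<in> W" "w \<in> W" "k < n" "u' \<in> window a f k" "w' \<in> window a f k"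
    have "u' \<otimes> fst (f k) \<otimes> w' \<in> Z" unfolding Z_def using * by force
    then show "?r (u \<otimes> g \<otimes> w) \<noteq> ?r (u' \<otimes> fst (f k) \<otimes> w')" using avoid * by blast
  next
    fix u w v assume *: "u \<in> W" "w \<in> W" "v \<in> W"
    then show "?r (u \<otimes> g \<otimes> w) \<noteq> ?r v" using avoid by (auto simp: Z_def)
  qed
  then show ?thesis using g by blast
qed

lemma foelner_exists:
  assumes H: "H \<lhd> G" and am: "amenable_group (G\<lparr>carrier := H\<rparr>)" and g: "g \<in> carrier G"
    and fin: "finite (window a f n)" "window a f n \<subseteq> carrier G"
  shows "\<exists>\<Lambda>. foelner H a f n g \<Lambda>"
proof -
  interpret H: normal H G by (rule H)
  let ?K = "G\<lparr>carrier := H\<rparr>"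
  interpret K: group ?K by (rule H.subgroup_is_group[OF is_group])
  let ?c = "\<lambda>(h, u). inv (u \<otimes> g) \<otimes> h \<otimes> (u \<otimes> g)"
  let ?S = "?c ` ((H \<inter> a ` {..n}) \<times> window a f n)"
  have "\<exists>F. finite F \<and> F \<noteq> {} \<and> F \<subseteq> carrier ?K \<and>
      (\<forall>s \<in> ?S. card ((\<lambda>x. s \<otimes>\<^bsub>?K\<^esub> x) ` F - F) \<le> (1 / (real n + 2)) * card F)"
  proof (rule K.foelner_sets[OF am])
    show "finite ?S" using fin by (intro finite_imageI finite_cartesian_product) auto
    show "?S \<subseteq> carrier ?K"
    proof
      fix s assume "s \<in> ?S"
      then obtain h u where "h \<in> H" "u \<in> window a f n" "s = inv (u \<otimes> g) \<otimes> h \<otimes> (u \<otimes> g)" by auto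
      then show "s \<in> carrier ?K" using H.inv_op_closed1[of "u \<otimes> g" h] fin g by auto
    qed
  qed auto
  then obtain F where "finite F" "F \<noteq> {}" "F \<subseteq> H" "\<forall>s \<in> ?S. card ((\<lambda>x. s \<otimes> x) ` F - F) \<le> (1 / (real n + 2)) * card F"
    by auto
  then show ?thesis unfolding foelner_def by (intro exI[of _ F]) fastforce
qed

text \<open>The requirements at \<open>n\<close> refer to the lower levels only through finite sets, so the data can be
  chosen one level after the other, and \<open>\<Lambda> n\<close> after \<open>g n\<close>.\<close>

theorem step_design_exists:
  assumes H: "H \<lhd> G" and am: "amenable_group (G\<lparr>carrier := H\<rparr>)" and icc: "icc_group (G Mod H)"
    and a: "range a = carrier G"
  shows "\<exists>f. step_design H G a f"
proof -
  interpret H: normal H G by (rule H)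
  define ok where "ok f n r \<longleftrightarrow> fst r \<in> carrier G \<and> (H \<noteq> carrier G \<longrightarrow> switching H a f n (fst r)) \<and>
    foelner H a f n (fst r) (snd r)" for f n and r :: "'a \<times> 'a set"
  have "\<exists>f. \<forall>n. ok f n (f n)"
  proof (rule dependent_wf_choice[of "{(x, y :: nat). x < y}"])
    show "wf {(x, y :: nat). x < y}" by (rule wf)
  next
    fix f f' :: "nat \<Rightarrow> 'a \<times> 'a set" and n r assume "\<And>z. (z, n) \<in> {(x, y). x < y} \<Longrightarrow> f z = f' z"
    then have eq: "\<And>k. k < n \<Longrightarrow> f k = f' k" by simp
    have "words a f k i = words a f' k i" if "k \<le> n" for k i
      using eq that by (intro words_cong) auto
    then show "ok f n r = ok f' n r"
      unfolding ok_def switching_def foelner_def using eq by simp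
  next
    fix n f assume "\<And>k. (k, n) \<in> {(x, y). x < y} \<Longrightarrow> ok f k (f k)"
    then have prev: "fst (f k) \<in> carrier G \<and> finite (snd (f k)) \<and> snd (f k) \<subseteq> carrier G" if "k < n" for k
      using that H.subset by (fastforce simp: ok_def foelner_def)
    have fin: "finite (window a f k) \<and> window a f k \<subseteq> carrier G" if "k \<le> n" for k
      using that prev a by (intro words_finite_closed) auto
    obtain g where g: "g \<in> carrier G" "H \<noteq> carrier G \<longrightarrow> switching H a f n g"
    proof (cases "H = carrier G")
      case True
      then show thesis using that[of \<one>] by simp
    next
      case False
      then show thesis using that switching_exists[OF H icc False, of n a f] fin prev by blast
    qed
    moreover obtain \<Lambda> where "foelner H a f n g \<Lambda>" using foelner_exists[OF H am g(1), of a f n] fin by blast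
    ultimately show "\<exists>r. ok f n r" by (intro exI[of _ "(g, \<Lambda>)"]) (simp add: ok_def)
  qed
  then obtain f where f: "\<And>n. ok f n (f n)" by blast
  then have "step_design H G a f"
    by (unfold_locales) (use a f in \<open>auto simp: ok_def\<close>)
  then show ?thesis by blast
qed

end

section \<open>Decoding the record steps\<close>

context step_design
begin

abbreviation "g n \<equiv> fst (f n)"
abbreviation "\<Lambda> n \<equiv> snd (f n)"
abbreviation "W \<equiv> window a f"

lemma a_closed: "a n \<in> carrier G"
  using range_a by auto

lemma \<Lambda>: "finite (\<Lambda> n)" "\<Lambda> n \<noteq> {}" "\<Lambda> n \<subseteq> H"
  using foelner by (auto simp: foelner_def)

lemma words_closed: "finite (words a f n i)" "words a f n i \<subseteq> carrier G"
proof -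
  have "finite (words a f n i) \<and> words a f n i \<subseteq> carrier G"
    by (rule words_finite_closed) (use range_a g_closed \<Lambda> subset in blast)+
  then show "finite (words a f n i)" "words a f n i \<subseteq> carrier G" by simp_all
qed

lemma step_set_closed: "step_set a f n \<subseteq> carrier G"
  using a_closed g_closed \<Lambda>(3)[of n] subset by (auto simp: step_set_def)

text \<open>Here \<open>u\<close> stands for the position before the last record step, of level \<open>n\<close>, and \<open>w\<close> for the steps after
  it; the component of that step in \<open>\<Lambda> n\<close> is invisible modulo \<open>H\<close>.\<close>

definition code :: "'a \<Rightarrow> 'a \<Rightarrow> nat \<Rightarrow> bool" where
  "code x u n \<longleftrightarrow> u \<in> W n \<and> (\<exists>w \<in> W n. H #> x = H #> (u \<otimes> g n \<otimes> w))"

inductive ancestor :: "'a \<Rightarrow> 'a set \<Rightarrow> nat \<Rightarrow> bool" where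
  base: "code x u n \<Longrightarrow> ancestor x (H #> u) n"
| step: "code x u n \<Longrightarrow> ancestor u q k \<Longrightarrow> ancestor x q k"

lemma code_cong: "H #> x = H #> x' \<Longrightarrow> code x u n \<longleftrightarrow> code x' u n"
  by (simp add: code_def)

lemma ancestor_cong: "ancestor x q k \<Longrightarrow> H #> x = H #> x' \<Longrightarrow> ancestor x' q k"
  by (erule ancestor.cases) (metis code_cong ancestor.intros)+

context
  assumes proper: "H \<noteq> carrier G"
begin

lemma code_unique:
  assumes "code x u n" "code x u' n'"
  shows "n = n' \<and> H #> u = H #> u'"
proof -
  have less: False if "code x u n" "code x u' n'" "n' < n" for u u' n n'
    using that switching[OF proper, of n] unfolding code_def switching_def by metis
  have "n = n'" using less[of u n u' n'] less[of u' n' u n] assms by (metis linorder_neqE_nat)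
  then show ?thesis
    using assms switching[OF proper, of n] unfolding code_def switching_def by metis
qed

lemma code_level_less:
  assumes "x \<in> W n" "code x u k"
  shows "k < n"
proof (rule ccontr)
  assume "\<not> k < n"
  then have "x \<in> W k" using window_mono[of n k] assms by auto
  then show False
    using assms(2) switching[OF proper, of k] unfolding code_def switching_def by metis
qed

lemma ancestor_level_less: "ancestor x q k \<Longrightarrow> x \<in> W n \<Longrightarrow> k < n"
proof (induction arbitrary: n rule: ancestor.induct)
  case (base x u k)
  then show ?case by (simp add: code_level_less)
next
  case (step x u m q k)
  have "u \<in> W m" using step.hyps by (simp add: code_def)
  then show ?case using step code_level_less by (meson less_trans)
qed

lemma ancestor_code_cases:
  assumes "ancestor x q k" "code x u n"
  shows "(k = n \<and> q = H #> u) \<or> ancestor u q k"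
  using assms(1)
proof (cases rule: ancestor.cases)
  case (base u')
  then show ?thesis using code_unique[OF assms(2)] by metis
next
  case (step u' n')
  then show ?thesis using code_unique[OF assms(2) step(1)] ancestor_cong by metis
qed

text \<open>The levels decrease along the chain of ancestors.\<close>

lemma ancestor_unique: "ancestor x q k \<Longrightarrow> ancestor x q' k \<Longrightarrow> q = q'"
proof (induction rule: ancestor.induct)
  case (base x u k)
  then show ?case
    using ancestor_code_cases[OF base(2,1)] ancestor_level_less[of u q' k k] by (auto simp: code_def)
next
  case (step x u n q k)
  have "k < n" using ancestor_level_less[OF step(2)] step(1) by (auto simp: code_def)
  then show ?case using ancestor_code_cases[OF step(4,1)] step.IH by auto
qed

end

lemma coset_mult_H: "x \<in> carrier G \<Longrightarrow> l \<in> H \<Longrightarrow> z \<in> carrier G \<Longrightarrow> H #> (x \<otimes> l \<otimes> z) = H #> (x \<otimes> z)"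
proof -
  assume x: "x \<in> carrier G" and l: "l \<in> H" and z: "z \<in> carrier G"
  have lG: "l \<in> carrier G" using l subset by auto
  have h: "x \<otimes> l \<otimes> inv x \<in> H" by (rule inv_op_closed2[OF x l])
  have "x \<otimes> l \<otimes> z = (x \<otimes> l \<otimes> inv x) \<otimes> (x \<otimes> z)"
    using x lG z by (simp add: m_assoc inv_mult_cancel)
  then have "H #> (x \<otimes> l \<otimes> z) = H #> (x \<otimes> l \<otimes> inv x) #> (x \<otimes> z)"
    using x z lG subset by (simp add: coset_mult_assoc)
  then show ?thesis by (simp add: rcos_const[OF is_group h])
qed

text \<open>The level \<open>n\<close> is surpassed within its horizon; and if it becomes a record, then by a regular
  step and, until it is surpassed, only once.\<close>

definition good :: "(nat \<Rightarrow> nat \<times> 'a) \<Rightarrow> nat \<Rightarrow> bool" where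
  "good \<omega> n \<longleftrightarrow> (\<exists>i < horizon n. n < fst (\<omega> i)) \<and>
    (\<forall>i. fst (\<omega> i) = n \<longrightarrow> (\<forall>j<i. fst (\<omega> j) \<le> n) \<longrightarrow> snd (\<omega> i) \<in> (\<otimes>) (g n) ` \<Lambda> n) \<and>
    (\<forall>i j. i < j \<longrightarrow> fst (\<omega> i) = n \<longrightarrow> fst (\<omega> j) = n \<longrightarrow> (\<exists>k<j. n < fst (\<omega> k)))"

lemma walk_closed:
  assumes "x \<in> carrier G" "\<And>i. s i \<in> carrier G"
  shows "walk G x s i \<in> carrier G"
  by (induction i) (use assms in auto)

lemma walk_left:
  assumes "h \<in> carrier G" "x \<in> carrier G" "\<And>i. s i \<in> carrier G"
  shows "walk G (h \<otimes> x) s i = h \<otimes> walk G x s i"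
  by (induction i) (use assms walk_closed[of x s] in \<open>auto simp: m_assoc\<close>)

lemma walk_add:
  assumes "x \<in> carrier G" "\<And>i. s i \<in> carrier G"
  shows "walk G x s (i + j) = walk G x s i \<otimes> walk G \<one> (\<lambda>k. s (i + k)) j"
  by (induction j) (use assms walk_closed[of x s] walk_closed[of \<one> "\<lambda>k. s (i + k)"] in \<open>auto simp: m_assoc\<close>)

lemma walk_in_words:
  assumes "x \<in> words a f n 0" "\<And>j. j < i \<Longrightarrow> s j \<in> low_steps a f n"
  shows "walk G x s i \<in> words a f n i"
  using assms(2) by (induction i) (use assms(1) words_step in auto)

lemma walk_in_window:
  assumes "x \<in> words a f n 0" "\<And>j. j < i \<Longrightarrow> s j \<in> low_steps a f n" "i \<le> horizon n"
  shows "walk G x s i \<in> W n"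
  by (rule subsetD[OF words_mono[OF assms(3)] walk_in_words[OF assms(1)]]) (rule assms(2))

text \<open>As \<open>n\<close> has not been surpassed, the horizon bounds the number of steps so far, and all of them but the record step have
  levels below \<open>n\<close>; so the two parts of the path before and after the record step lie in the window.\<close>

lemma good_code:
  assumes good: "good \<omega> n" and x: "x \<in> words a f n 0"
    and steps: "\<And>i. snd (\<omega> i) \<in> step_set a f (fst (\<omega> i))"
    and i: "i < m" "fst (\<omega> i) = n" and max: "\<And>j. j < m \<Longrightarrow> fst (\<omega> j) \<le> n"
  shows "code (walk G x (\<lambda>i. snd (\<omega> i)) m) (walk G x (\<lambda>i. snd (\<omega> i)) i) n"
    and "\<And>j. j < m \<Longrightarrow> fst (\<omega> j) = n \<Longrightarrow> j = i"
proof -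
  let ?s = "\<lambda>i. snd (\<omega> i)"
  have sG: "?s i \<in> carrier G" for i using steps step_set_closed by blast
  have xG: "x \<in> carrier G" using x words_closed by blast
  obtain i0 where i0: "i0 < horizon n" "n < fst (\<omega> i0)" using good by (auto simp: good_def)
  have m: "m \<le> horizon n" using i0 max[of i0] by (meson leD leI less_imp_le order_trans)
  show uniq: "j = i" if "j < m" "fst (\<omega> j) = n" for j
  proof (rule ccontr)
    assume "j \<noteq> i"
    have later: "\<exists>k<j'. n < fst (\<omega> k)" if "i' < j'" "fst (\<omega> i') = n" "fst (\<omega> j') = n" for i' j'
      using good that unfolding good_def by blast
    have "\<exists>k<m. n < fst (\<omega> k)"
    proof (cases "i < j")
      case True
      then show ?thesis using later[OF True i(2) that(2)] that(1) less_trans by blast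
    next
      case False
      then have "j < i" using \<open>j \<noteq> i\<close> by simp
      then show ?thesis using later[OF _ that(2) i(2)] i(1) less_trans by blast
    qed
    then show False using max leD by blast
  qed
  have low: "?s j \<in> low_steps a f n" if "j < m" "j \<noteq> i" for j
  proof -
    have "fst (\<omega> j) \<noteq> n" using uniq[OF that(1)] that(2) by blast
    then have "fst (\<omega> j) < n" using max[OF that(1)] by simp
    then show ?thesis using steps[of j] by (auto simp: low_steps_def)
  qed
  let ?u = "walk G x ?s i"
  have u: "?u \<in> W n"
    by (rule walk_in_window[OF x]) (use low i m in auto)
  define d where "d = m - Suc i"
  have md: "m = Suc i + d" using i by (simp add: d_def)
  let ?w = "walk G \<one> (\<lambda>k. ?s (Suc i + k)) d"
  have w: "?w \<in> W n"
    by (rule walk_in_window[OF one_in_words]) (use low md m in auto)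
  have uG: "?u \<in> carrier G" by (rule subsetD[OF words_closed(2) u])
  have wG: "?w \<in> carrier G" by (rule subsetD[OF words_closed(2) w])
  have "\<forall>j<i. fst (\<omega> j) \<le> n" using max i(1) less_trans by blast
  then have "?s i \<in> (\<otimes>) (g n) ` \<Lambda> n" using good i(2) unfolding good_def by blast
  then obtain l where l: "l \<in> \<Lambda> n" "?s i = g n \<otimes> l" by blast
  have lH: "l \<in> H" "l \<in> carrier G" using l \<Lambda>(3) subset by auto
  have "walk G x ?s m = ?u \<otimes> ?s i \<otimes> ?w"
    unfolding md using walk_add[of x ?s "Suc i" d] xG sG by simp
  also have "\<dots> = (?u \<otimes> g n) \<otimes> l \<otimes> ?w" using uG g_closed lH l by (simp add: m_assoc)
  finally have "H #> walk G x ?s m = H #> (?u \<otimes> g n \<otimes> ?w)"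
    using coset_mult_H[of "?u \<otimes> g n" l ?w] uG wG g_closed lH by simp
  then show "code (walk G x ?s m) ?u n" using u w by (auto simp: code_def)
qed

text \<open>An ancestor is never lost: a later record step starts from a position that already has it.\<close>

lemma record_is_ancestor:
  assumes good: "\<And>n. n0 \<le> n \<Longrightarrow> good \<omega> n" and x: "\<And>n. n0 \<le> n \<Longrightarrow> x \<in> words a f n 0"
    and steps: "\<And>i. snd (\<omega> i) \<in> step_set a f (fst (\<omega> i))"
    and i: "i < M" "n0 \<le> fst (\<omega> i)" and max: "\<And>j. j < M \<Longrightarrow> fst (\<omega> j) \<le> fst (\<omega> i)"
    and "M \<le> m"
  shows "ancestor (walk G x (\<lambda>i. snd (\<omega> i)) m) (H #> walk G x (\<lambda>i. snd (\<omega> i)) i) (fst (\<omega> i))"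
  using \<open>M \<le> m\<close>
proof (induction m rule: less_induct)
  case (less m)
  let ?N = "Max ((\<lambda>j. fst (\<omega> j)) ` {..<m})"
  have "i \<in> {..<m}" using i(1) less.prems by simp
  then have ne: "{..<m} \<noteq> {}" by blast
  have le: "fst (\<omega> j) \<le> ?N" if "j < m" for j using that by (intro Max_ge) auto
  have "?N \<in> (\<lambda>j. fst (\<omega> j)) ` {..<m}" using ne by (intro Max_in) auto
  then obtain j where j: "j < m" "fst (\<omega> j) = ?N" by auto
  have iN: "fst (\<omega> i) \<le> ?N" using le[of i] i less.prems by auto
  then have N: "n0 \<le> ?N" using i by auto
  note gc = good_code[OF good[OF N] x[OF N] steps j le]
  show ?case
  proof (cases "?N = fst (\<omega> i)")
    case True
    then have "i = j" using gc(2)[of i] i less.prems by auto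
    then show ?thesis using ancestor.base[OF gc(1)] True by simp
  next
    case False
    have "M \<le> j"
    proof (rule ccontr)
      assume "\<not> M \<le> j"
      then have "fst (\<omega> j) \<le> fst (\<omega> i)" by (intro max) auto
      then show False using j iN False by auto
    qed
    then show ?thesis using ancestor.step[OF gc(1)] less.IH[OF j(1)] by blast
  qed
qed

text \<open>The path \<open>h \<otimes> y\<close> has the same steps as \<open>y\<close>, hence the same record levels, but its ancestor of a given
  level is the translate by \<open>h\<close> of that of \<open>y\<close>, and so a different coset of \<open>H\<close>.\<close>

theorem translate_changes_ancestors:
  assumes proper: "H \<noteq> carrier G" and good: "\<And>n. n0 \<le> n \<Longrightarrow> good \<omega> n"
    and steps: "\<And>i. snd (\<omega> i) \<in> step_set a f (fst (\<omega> i))"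
    and x: "x \<in> carrier G" and h: "h \<in> carrier G" "h \<notin> H"
  defines "y \<equiv> walk G x (\<lambda>i. snd (\<omega> i))"
  shows "\<exists>v \<in> carrier G. \<exists>k M. (\<forall>m\<ge>M. ancestor (y m) (H #> v) k) \<and> (\<forall>m\<ge>M. \<not> ancestor (h \<otimes> y m) (H #> v) k)"
proof -
  have sG: "snd (\<omega> i) \<in> carrier G" for i using steps step_set_closed by blast
  obtain k1 k2 where k: "x = a k1" "h \<otimes> x = a k2" using range_a x h by (metis m_closed imageE)
  define n1 where "n1 = Max {n0, k1, k2}"
  have n1: "n0 \<le> n1" "k1 \<le> n1" "k2 \<le> n1" by (auto simp: n1_def)
  have xw: "x \<in> words a f n 0" "h \<otimes> x \<in> words a f n 0" if "n1 \<le> n" for n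
    using n1 that initial_in_words[of k1 n a f 0] initial_in_words[of k2 n a f 0] k by auto
  obtain i0 where i0: "n1 < fst (\<omega> i0)" using good[OF n1(1)] by (auto simp: good_def)
  define M where "M = Suc i0"
  let ?N = "Max ((\<lambda>j. fst (\<omega> j)) ` {..<M})"
  have le: "fst (\<omega> j) \<le> ?N" if "j < M" for j using that by (intro Max_ge) auto
  have "?N \<in> (\<lambda>j. fst (\<omega> j)) ` {..<M}" by (intro Max_in) (auto simp: M_def)
  then obtain i where i: "i < M" "fst (\<omega> i) = ?N" by auto
  have "fst (\<omega> i0) \<le> ?N" by (rule le) (simp add: M_def)
  then have iN: "n1 \<le> fst (\<omega> i)" unfolding i(2) using i0 by linarith
  have anc: "ancestor (walk G z (\<lambda>i. snd (\<omega> i)) m) (H #> walk G z (\<lambda>i. snd (\<omega> i)) i) (fst (\<omega> i))"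
    if "M \<le> m" "\<And>n. n1 \<le> n \<Longrightarrow> z \<in> words a f n 0" for z m
  proof (rule record_is_ancestor[of n1 \<omega> z i M m])
    show "good \<omega> n" if "n1 \<le> n" for n using good n1 that by simp
    show "fst (\<omega> j) \<le> fst (\<omega> i)" if "j < M" for j unfolding i(2) by (rule le[OF that])
  qed (use that steps i(1) iN in auto)
  have yG: "y m \<in> carrier G" for m unfolding y_def by (rule walk_closed[OF x sG])
  have hy: "walk G (h \<otimes> x) (\<lambda>i. snd (\<omega> i)) m = h \<otimes> y m" for m
    unfolding y_def by (rule walk_left[OF h(1) x sG])
  have anc1: "ancestor (y m) (H #> y i) (fst (\<omega> i))" if "M \<le> m" for m
    unfolding y_def by (rule anc[OF that xw(1)])
  have anc2: "ancestor (h \<otimes> y m) (H #> (h \<otimes> y i)) (fst (\<omega> i))" if "M \<le> m" for m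
    using anc[OF that xw(2)] by (simp add: hy)
  have "H #> (h \<otimes> y i) \<noteq> H #> y i"
  proof
    assume "H #> (h \<otimes> y i) = H #> y i"
    then have "h \<otimes> y i \<in> H #> y i" using rcos_self[of "h \<otimes> y i" H] h yG is_subgroup by auto
    then obtain h' where "h' \<in> H" "h \<otimes> y i = h' \<otimes> y i" by (auto simp: r_coset_def)
    then have "h = h'" using h yG subset by auto
    then show False using h \<open>h' \<in> H\<close> by simp
  qed
  then have "\<not> ancestor (h \<otimes> y m) (H #> y i) (fst (\<omega> i))" if "M \<le> m" for m
    using ancestor_unique[OF proper anc2[OF that]] by metis
  then show ?thesis using anc1 yG by blast
qed

end

section \<open>Records of independent samples\<close>

locale iid_pmf =
  fixes J :: "'b pmf"
begin

sublocale product_prob_space "\<lambda>_. measure_pmf J" "UNIV :: nat set"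
  by unfold_locales

abbreviation "M \<equiv> (\<Pi>\<^sub>M i \<in> (UNIV :: nat set). measure_pmf J)"

lemma space_M [simp]: "space M = UNIV"
  by (simp add: space_PiM)

lemma sets_component [measurable]: "{\<omega>. \<omega> i \<in> A} \<in> sets M"
proof -
  have "(\<lambda>\<omega>. \<omega> i) -` A \<inter> space M \<in> sets M"
    by (rule measurable_sets[of _ _ "measure_pmf J"]) auto
  then show ?thesis by (simp add: vimage_def)
qed

lemma sets_initial: "{\<omega>. \<forall>k\<in>K. \<omega> k \<in> X k} \<in> sets M" for K :: "nat set"
proof -
  have "{\<omega> \<in> space M. \<forall>k\<in>K. \<omega> k \<in> X k} \<in> sets M"
    by (rule sets.sets_Collect_countable_Ball) (use sets_component in auto)
  then show ?thesis by simp
qed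

lemma prob_initial:
  assumes "finite K"
  shows "prob {\<omega>. \<forall>k\<in>K. \<omega> k \<in> X k} = (\<Prod>k\<in>K. measure_pmf.prob J (X k))"
proof -
  have "emeasure M {\<omega> \<in> space M. \<forall>k\<in>K. \<omega> k \<in> X k} = (\<Prod>k\<in>K. emeasure (measure_pmf J) (X k))"
    by (rule emeasure_PiM_Collect) (use assms in auto)
  then have "ennreal (prob {\<omega>. \<forall>k\<in>K. \<omega> k \<in> X k}) = ennreal (\<Prod>k\<in>K. measure_pmf.prob J (X k))"
    by (simp add: emeasure_eq_measure measure_pmf.emeasure_eq_measure prod_ennreal)
  then show ?thesis by (simp add: prod_nonneg)
qed

lemma AE_support: "AE \<omega> in M. \<forall>i. \<omega> i \<in> set_pmf J"
  unfolding AE_all_countable by (intro allI AE_component) (auto simp: AE_measure_pmf)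

text \<open>A union bound over the time of the hit, which gives a geometric series.\<close>

lemma prob_hit_before:
  assumes E: "measure_pmf.prob J E > 0"
  shows "{\<omega>. \<exists>i :: nat. \<omega> i \<in> D \<and> (\<forall>j<i. \<omega> j \<notin> E)} \<in> sets M"
    and "prob {\<omega>. \<exists>i :: nat. \<omega> i \<in> D \<and> (\<forall>j<i. \<omega> j \<notin> E)} \<le> measure_pmf.prob J D / measure_pmf.prob J E"
proof -
  let ?d = "measure_pmf.prob J D" and ?q = "measure_pmf.prob J (- E)"
  have q: "?q = 1 - measure_pmf.prob J E" using measure_pmf.prob_compl[of E J] by (simp add: Compl_eq_Diff_UNIV)
  have q1: "0 \<le> ?q" "?q < 1" using E q by auto
  define A where "A i = {\<omega>. \<forall>k\<in>{..i}. \<omega> k \<in> (if k = i then D else - E)}" for i :: nat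
  have eq: "{\<omega>. \<exists>i :: nat. \<omega> i \<in> D \<and> (\<forall>j<i. \<omega> j \<notin> E)} = (\<Union>i. A i)"
  proof -
    have "A i = {\<omega>. \<omega> i \<in> D \<and> (\<forall>j<i. \<omega> j \<notin> E)}" for i by (auto simp: A_def le_less)
    then show ?thesis by auto
  qed
  have Am: "A i \<in> sets M" for i unfolding A_def by (rule sets_initial)
  then show "{\<omega>. \<exists>i :: nat. \<omega> i \<in> D \<and> (\<forall>j<i. \<omega> j \<notin> E)} \<in> sets M" unfolding eq by auto
  have pA: "prob (A i) = ?q ^ i * ?d" for i
  proof -
    have "prob (A i) = (\<Prod>k\<in>{..i}. measure_pmf.prob J (if k = i then D else - E))"
      unfolding A_def by (rule prob_initial) simp
    also have "{..i} = insert i {..<i}" by auto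
    also have "(\<Prod>k\<in>insert i {..<i}. measure_pmf.prob J (if k = i then D else - E)) = ?d * (\<Prod>k<i. ?q)"
      by (subst prod.insert) auto
    finally show ?thesis by simp
  qed
  have sums: "(\<lambda>i. prob (A i)) sums (1 / (1 - ?q) * ?d)"
    unfolding pA using q1 by (intro sums_mult2 geometric_sums) auto
  have "prob (\<Union>i. A i) \<le> (\<Sum>i. prob (A i))"
    using Am sums by (intro finite_measure_subadditive_countably) (auto simp: sums_iff)
  also have "\<dots> = ?d / measure_pmf.prob J E" using sums q by (simp add: sums_iff)
  finally show "prob {\<omega>. \<exists>i :: nat. \<omega> i \<in> D \<and> (\<forall>j<i. \<omega> j \<notin> E)} \<le> ?d / measure_pmf.prob J E" by (simp only: eq)
qed

text \<open>A union bound over the times of both hits; the sum over the first one gives the factor of the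
  differentiated geometric series.\<close>

lemma prob_hit_twice_before:
  assumes E: "measure_pmf.prob J E > 0"
  shows "{\<omega>. \<exists>i j :: nat. i < j \<and> \<omega> i \<in> D \<and> \<omega> j \<in> D \<and> (\<forall>k<j. \<omega> k \<notin> E)} \<in> sets M"
    and "prob {\<omega>. \<exists>i j :: nat. i < j \<and> \<omega> i \<in> D \<and> \<omega> j \<in> D \<and> (\<forall>k<j. \<omega> k \<notin> E)}
      \<le> (measure_pmf.prob J D / measure_pmf.prob J E)\<^sup>2"
proof -
  let ?d = "measure_pmf.prob J D" and ?q = "measure_pmf.prob J (- E)"
  let ?B = "{\<omega>. \<exists>i j :: nat. i < j \<and> \<omega> i \<in> D \<and> \<omega> j \<in> D \<and> (\<forall>k<j. \<omega> k \<notin> E)}"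
  have q: "?q = 1 - measure_pmf.prob J E" using measure_pmf.prob_compl[of E J] by (simp add: Compl_eq_Diff_UNIV)
  have q1: "0 \<le> ?q" "?q < 1" using E q by auto
  define A where "A i j = {\<omega>. \<forall>k\<in>{..Suc j}. \<omega> k \<in> (if k = Suc j then D else if k = i then D - E else - E)}" for i j :: nat
  define U where "U j = (\<Union>i\<in>{..j}. A i j)" for j
  have eq: "?B = (\<Union>j. U j)"
  proof (intro equalityI subsetI)
    fix \<omega> assume "\<omega> \<in> ?B"
    then obtain i j where ij: "i < j" "\<omega> i \<in> D" "\<omega> j \<in> D" "\<forall>k<j. \<omega> k \<notin> E" by blast
    obtain j' where j': "j = Suc j'" using ij(1) by (cases j) auto
    have "\<omega> \<in> A i j'" using ij unfolding A_def j' by (auto simp: le_Suc_eq)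
    then have "\<omega> \<in> U j'" using ij(1) unfolding U_def j' by auto
    then show "\<omega> \<in> (\<Union>j. U j)" by blast
  next
    fix \<omega> assume "\<omega> \<in> (\<Union>j. U j)"
    then obtain i j where ij: "i \<le> j" "\<omega> \<in> A i j" by (auto simp: U_def)
    have k: "\<omega> k \<in> (if k = Suc j then D else if k = i then D - E else - E)" if "k \<le> Suc j" for k
      using ij(2) that by (simp add: A_def)
    have "\<omega> i \<in> D" "\<omega> (Suc j) \<in> D" using k[of i] k[of "Suc j"] ij(1) by (auto split: if_splits)
    moreover have "\<omega> k \<notin> E" if "k < Suc j" for k using k[of k] that by (auto split: if_splits)
    ultimately show "\<omega> \<in> ?B" using ij(1) by (intro CollectI exI[of _ i] exI[of _ "Suc j"]) auto
  qed
  have Am: "A i j \<in> sets M" for i j unfolding A_def by (rule sets_initial)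
  have Um: "U j \<in> sets M" for j unfolding U_def using Am by auto
  then show "?B \<in> sets M" unfolding eq by auto
  have pA: "prob (A i j) \<le> ?d\<^sup>2 * ?q ^ j" if "i \<le> j" for i j
  proof -
    have "prob (A i j) = (\<Prod>k\<in>{..Suc j}. measure_pmf.prob J (if k = Suc j then D else if k = i then D - E else - E))"
      unfolding A_def by (rule prob_initial) simp
    also have "\<dots> \<le> (\<Prod>k\<in>{..Suc j}. if k = Suc j then ?d else if k = i then ?d else ?q)"
      by (intro prod_mono) (auto intro: measure_pmf.finite_measure_mono)
    also have "{..Suc j} = insert (Suc j) (insert i ({..j} - {i}))" using that by auto
    also have "(\<Prod>k\<in>insert (Suc j) (insert i ({..j} - {i})). if k = Suc j then ?d else if k = i then ?d else ?q)
        = ?d * (?d * (\<Prod>k\<in>{..j} - {i}. ?q))"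
    proof -
      have "(\<Prod>k\<in>insert i ({..j} - {i}). if k = Suc j then ?d else if k = i then ?d else ?q)
          = ?d * (\<Prod>k\<in>{..j} - {i}. if k = Suc j then ?d else if k = i then ?d else ?q)"
        using that by (subst prod.insert) auto
      also have "(\<Prod>k\<in>{..j} - {i}. if k = Suc j then ?d else if k = i then ?d else ?q) = (\<Prod>k\<in>{..j} - {i}. ?q)"
        by (intro prod.cong) auto
      finally show ?thesis using that by (subst prod.insert) auto
    qed
    also have "\<dots> = ?d\<^sup>2 * ?q ^ j" using that by (simp add: power2_eq_square)
    finally show ?thesis .
  qed
  have pU: "prob (U j) \<le> real (Suc j) * ?q ^ j * ?d\<^sup>2" for j
  proof -
    have "prob (U j) \<le> (\<Sum>i\<in>{..j}. prob (A i j))"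
      unfolding U_def using Am by (intro finite_measure_subadditive_finite) auto
    also have "\<dots> \<le> (\<Sum>i\<in>{..j}. ?d\<^sup>2 * ?q ^ j)" using pA by (intro sum_mono) auto
    also have "\<dots> = real (Suc j) * ?q ^ j * ?d\<^sup>2" by simp
    finally show ?thesis .
  qed
  have sums: "(\<lambda>j. real (Suc j) * ?q ^ j * ?d\<^sup>2) sums (1 / (1 - ?q)\<^sup>2 * ?d\<^sup>2)"
    using geometric_deriv_sums[of ?q] q1 by (intro sums_mult2) auto
  have summ: "summable (\<lambda>j. prob (U j))"
    by (rule summable_comparison_test'[OF sums_summable[OF sums], of 0]) (use pU in auto)
  have "prob (\<Union>j. U j) \<le> (\<Sum>j. prob (U j))"
    using Um summ by (intro finite_measure_subadditive_countably) auto
  also have "\<dots> \<le> (\<Sum>j. real (Suc j) * ?q ^ j * ?d\<^sup>2)"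
    using pU summ sums_summable[OF sums] by (rule suminf_le)
  also have "\<dots> = (?d / measure_pmf.prob J E)\<^sup>2" using sums q by (simp add: sums_iff power_divide)
  finally show "prob ?B \<le> (?d / measure_pmf.prob J E)\<^sup>2" by (simp only: eq)
qed

end

text \<open>The tails are \<open>P (k \<ge> n) = 1 / (n + 1)\<close>. So \<open>n\<close> becomes a record with probability \<open>1 / (n + 2)\<close>, and twice
  before it is surpassed with a probability of order \<open>1 / n\<^sup>2\<close>, which is summable.\<close>

definition level_pmf :: "nat pmf" where
  "level_pmf = embed_pmf (\<lambda>n. 1 / ((real n + 1) * (real n + 2)))"

lemma pmf_level: "pmf level_pmf n = 1 / ((real n + 1) * (real n + 2))"
  unfolding level_pmf_def
proof (rule pmf_embed_pmf)
  have "(\<lambda>n. 1 / (real n + 1) - 1 / (real (Suc n) + 1)) sums (1 / (real 0 + 1) - 0)"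
    by (rule telescope_sums') real_asymp
  moreover have "1 / (real n + 1) - 1 / (real (Suc n) + 1) = 1 / ((real n + 1) * (real n + 2))" for n
    by (simp add: field_simps)
  ultimately have s: "(\<lambda>n. 1 / ((real n + 1) * (real n + 2))) sums 1" by simp
  have "(\<integral>\<^sup>+ n. ennreal (1 / ((real n + 1) * (real n + 2))) \<partial>count_space UNIV)
      = (\<Sum>n. ennreal (1 / ((real n + 1) * (real n + 2))))" by (rule nn_integral_count_space_nat)
  also have "\<dots> = ennreal 1"
    using s by (subst suminf_ennreal2) (auto simp: sums_iff)
  finally show "(\<integral>\<^sup>+ n. ennreal (1 / ((real n + 1) * (real n + 2))) \<partial>count_space UNIV) = 1" by simp
qed simp

lemma prob_level_less: "measure_pmf.prob level_pmf {..<n} = 1 - 1 / (real n + 1)"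
proof -
  have "measure_pmf.prob level_pmf {..<n} = (\<Sum>k<n. 1 / ((real k + 1) * (real k + 2)))"
    by (simp add: measure_measure_pmf_finite pmf_level)
  also have "\<dots> = (\<Sum>k<n. 1 / (real k + 1) - 1 / (real (Suc k) + 1))"
    by (intro sum.cong refl) (simp add: field_simps)
  also have "\<dots> = 1 - 1 / (real n + 1)" by (induction n) simp_all
  finally show ?thesis .
qed

lemma prob_level_ge: "measure_pmf.prob level_pmf {n..} = 1 / (real n + 1)"
proof -
  have "{n..} = UNIV - {..<n}" by auto
  then show ?thesis using measure_pmf.prob_compl[of "{..<n}" level_pmf] by (simp add: prob_level_less)
qed

lemma power_horizon_bound: "(1 - 1 / (real n + 2)) ^ horizon n \<le> exp (-1) ^ (n + 2)"
proof -
  have "1 - 1 / (real n + 2) \<le> exp (- (1 / (real n + 2)))"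
    using exp_ge_add_one_self[of "- (1 / (real n + 2))"] by simp
  then have "(1 - 1 / (real n + 2)) ^ horizon n \<le> exp (- (1 / (real n + 2))) ^ horizon n"
    by (intro power_mono) (auto simp: field_simps)
  also have "\<dots> = exp (real (horizon n) * - (1 / (real n + 2)))"
    by (rule exp_of_nat_mult[symmetric])
  also have "real (horizon n) * - (1 / (real n + 2)) = real (n + 2) * - 1"
    by (simp add: horizon_def power2_eq_square field_simps)
  also have "exp (real (n + 2) * - 1) = exp (-1) ^ (n + 2)" by (rule exp_of_nat_mult)
  finally show ?thesis .
qed

context step_design
begin

text \<open>The exceptional steps \<open>a n\<close> make the step distribution non-degenerate. Their weight \<open>1 / (n + 2)\<close> is small enough
  that only finitely many of them occur as record steps.\<close>

definition step_pmf :: "nat \<Rightarrow> 'a pmf" where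
  "step_pmf n = bind_pmf (bernoulli_pmf (1 / (real n + 2)))
    (\<lambda>b. if b then return_pmf (a n) else map_pmf ((\<otimes>) (g n)) (pmf_of_set (\<Lambda> n)))"

definition joint_pmf :: "(nat \<times> 'a) pmf" where
  "joint_pmf = bind_pmf level_pmf (\<lambda>n. map_pmf (Pair n) (step_pmf n))"

text \<open>The default value occurs with probability zero; it puts the steps into the group everywhere, as measurability of
  the paths requires.\<close>

definition step_of :: "nat \<times> 'a \<Rightarrow> 'a" where
  "step_of z = (if snd z \<in> carrier G then snd z else \<one>)"

definition \<mu> :: "'a measure" where
  "\<mu> = distr (measure_pmf joint_pmf) (count_space (carrier G)) step_of"

lemma step_of_closed: "step_of z \<in> carrier G"
  by (simp add: step_of_def)

lemma measurable_step_of: "step_of \<in> measure_pmf joint_pmf \<rightarrow>\<^sub>M count_space (carrier G)"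
  using step_of_closed by auto

lemma set_step_pmf: "set_pmf (step_pmf n) = step_set a f n"
proof -
  have "set_pmf (bernoulli_pmf (1 / (real n + 2))) = UNIV" by (rule set_pmf_bernoulli) auto
  then show ?thesis using \<Lambda>[of n] by (simp add: step_pmf_def step_set_def UNIV_bool Un_commute)
qed

lemma set_joint_pmf: "set_pmf joint_pmf = {(n, x). x \<in> step_set a f n}"
proof -
  have "set_pmf level_pmf = UNIV" by (auto simp: set_pmf_iff pmf_level add_eq_0_iff)
  then show ?thesis by (auto simp: joint_pmf_def set_step_pmf)
qed

lemma step_of_joint: "z \<in> set_pmf joint_pmf \<Longrightarrow> step_of z = snd z"
  using step_set_closed[of "fst z"] by (auto simp: set_joint_pmf step_of_def)

lemma prob_level_joint: "measure_pmf.prob joint_pmf {z. fst z \<in> A} = measure_pmf.prob level_pmf A"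
proof -
  have "map_pmf fst joint_pmf = level_pmf"
    by (simp add: joint_pmf_def map_bind_pmf pmf.map_comp o_def bind_return_pmf')
  then have "measure_pmf.prob level_pmf A = measure_pmf.prob joint_pmf (fst -` A)"
    by (metis measure_map_pmf)
  then show ?thesis by (simp add: vimage_def)
qed

lemma prob_bad_step:
  "measure_pmf.prob joint_pmf {z. fst z = n \<and> snd z \<notin> (\<otimes>) (g n) ` \<Lambda> n} \<le> pmf level_pmf n * (1 / (real n + 2))"
proof -
  let ?A = "{z. fst z = n \<and> snd z \<notin> (\<otimes>) (g n) ` \<Lambda> n}"
  let ?e = "1 / (real n + 2)"
  have nu: "emeasure (step_pmf n) {x. x \<notin> (\<otimes>) (g n) ` \<Lambda> n} \<le> ennreal ?e"
  proof -
    have z: "emeasure (map_pmf ((\<otimes>) (g n)) (pmf_of_set (\<Lambda> n))) {x. x \<notin> (\<otimes>) (g n) ` \<Lambda> n} = 0"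
      using \<Lambda>[of n] by (auto simp: measure_pmf.emeasure_eq_measure measure_pmf_zero_iff)
    have "emeasure (step_pmf n) {x. x \<notin> (\<otimes>) (g n) ` \<Lambda> n}
        \<le> (\<integral>\<^sup>+ b. indicator {True} b \<partial>bernoulli_pmf ?e)"
      unfolding step_pmf_def emeasure_bind_pmf
    proof (rule nn_integral_mono)
      fix b
      show "emeasure (if b then return_pmf (a n) else map_pmf ((\<otimes>) (g n)) (pmf_of_set (\<Lambda> n))) {x. x \<notin> (\<otimes>) (g n) ` \<Lambda> n}
          \<le> indicator {True} b"
        using z by (cases b) (simp_all del: emeasure_map_pmf emeasure_return_pmf add: measure_pmf.emeasure_le_1)
    qed
    also have "\<dots> = ennreal ?e" by (simp add: emeasure_pmf_single)
    finally show ?thesis .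
  qed
  have "emeasure joint_pmf ?A = (\<integral>\<^sup>+ k. emeasure (step_pmf k) (Pair k -` ?A) \<partial>level_pmf)"
    by (simp add: joint_pmf_def)
  also have "\<dots> \<le> (\<integral>\<^sup>+ k. ennreal ?e * indicator {n} k \<partial>level_pmf)"
  proof (rule nn_integral_mono)
    fix k
    have "Pair n -` ?A = {x. x \<notin> (\<otimes>) (g n) ` \<Lambda> n}" by auto
    then show "emeasure (step_pmf k) (Pair k -` ?A) \<le> ennreal ?e * indicator {n} k"
      using nu by (cases "k = n") auto
  qed
  also have "\<dots> = ennreal ?e * emeasure level_pmf {n}"
    by (rule nn_integral_cmult_indicator) simp
  also have "\<dots> = ennreal (pmf level_pmf n * ?e)"
    unfolding emeasure_pmf_single by (subst mult.commute) (simp add: ennreal_mult'' del: times_divide_eq_right)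
  finally show ?thesis by (simp add: measure_pmf.emeasure_eq_measure)
qed

interpretation seq: iid_pmf joint_pmf .

text \<open>The Borel-Cantelli lemma: the three ways in which \<open>n\<close> can fail to be good have probabilities at most
  \<open>exp (- n - 2)\<close>, \<open>1 / (n + 1)\<^sup>2\<close> and \<open>1 / (n + 1)\<^sup>2\<close>.\<close>

theorem AE_eventually_good: "AE \<omega> in seq.M. eventually (good \<omega>) sequentially"
proof -
  define E where "E n = {z :: nat \<times> 'a. n < fst z}" for n
  define D where "D n = {z :: nat \<times> 'a. fst z = n}" for n
  define B where "B n = {z :: nat \<times> 'a. fst z = n \<and> snd z \<notin> (\<otimes>) (g n) ` \<Lambda> n}" for n
  have pE: "measure_pmf.prob joint_pmf (E n) = 1 / (real n + 2)" for n
  proof -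
    have "E n = {z. fst z \<in> {Suc n..}}" by (auto simp: E_def)
    then show ?thesis using prob_level_joint[of "{Suc n..}"] prob_level_ge[of "Suc n"] by (simp add: add.commute)
  qed
  have pD: "measure_pmf.prob joint_pmf (D n) = pmf level_pmf n" for n
    using prob_level_joint[of "{n}"] by (simp add: D_def measure_pmf_single)
  have pB: "measure_pmf.prob joint_pmf (B n) \<le> pmf level_pmf n * (1 / (real n + 2))" for n
    unfolding B_def by (rule prob_bad_step)
  define X1 where "X1 n = {\<omega> :: nat \<Rightarrow> nat \<times> 'a. \<forall>i\<in>{..<horizon n}. \<omega> i \<in> - E n}" for n
  define X2 where "X2 n = {\<omega> :: nat \<Rightarrow> nat \<times> 'a. \<exists>i. \<omega> i \<in> B n \<and> (\<forall>j<i. \<omega> j \<notin> E n)}" for n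
  define X3 where "X3 n = {\<omega> :: nat \<Rightarrow> nat \<times> 'a. \<exists>i j :: nat. i < j \<and> \<omega> i \<in> D n \<and> \<omega> j \<in> D n \<and> (\<forall>k<j. \<omega> k \<notin> E n)}" for n
  define X where "X n = X1 n \<union> X2 n \<union> X3 n" for n
  have bad: "\<omega> \<in> X n" if "\<not> good \<omega> n" for \<omega> n
  proof (rule ccontr)
    assume "\<omega> \<notin> X n"
    then have n: "\<omega> \<notin> X1 n" "\<omega> \<notin> X2 n" "\<omega> \<notin> X3 n" by (auto simp: X_def)
    have "\<exists>i<horizon n. n < fst (\<omega> i)" using n(1) by (auto simp: X1_def E_def)
    moreover have "snd (\<omega> i) \<in> (\<otimes>) (g n) ` \<Lambda> n" if "fst (\<omega> i) = n" "\<forall>j<i. fst (\<omega> j) \<le> n" for i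
      using n(2) that by (force simp: X2_def B_def E_def not_less)
    moreover have "\<exists>k<j. n < fst (\<omega> k)" if "i < j" "fst (\<omega> i) = n" "fst (\<omega> j) = n" for i j
      using n(3) that by (force simp: X3_def D_def E_def)
    ultimately show False using that unfolding good_def by blast
  qed
  have E0: "0 < measure_pmf.prob joint_pmf (E n)" for n by (simp add: pE)
  have m: "X1 n \<in> sets seq.M" "X2 n \<in> sets seq.M" "X3 n \<in> sets seq.M" for n
    unfolding X1_def X2_def X3_def by (intro seq.sets_initial seq.prob_hit_before(1) seq.prob_hit_twice_before(1) E0)+
  have p1: "seq.prob (X1 n) \<le> exp (-1) ^ (n + 2)" for n
  proof -
    have "seq.prob (X1 n) = (1 - 1 / (real n + 2)) ^ horizon n"
      unfolding X1_def using measure_pmf.prob_compl[of "E n" joint_pmf]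
      by (subst seq.prob_initial) (simp_all add: pE Compl_eq_Diff_UNIV)
    then show ?thesis using power_horizon_bound by simp
  qed
  have p2: "seq.prob (X2 n) \<le> inverse (real (Suc n) ^ 2)" for n
  proof -
    have "seq.prob (X2 n) \<le> measure_pmf.prob joint_pmf (B n) / measure_pmf.prob joint_pmf (E n)"
      unfolding X2_def by (rule seq.prob_hit_before(2)[OF E0])
    also have "\<dots> \<le> (pmf level_pmf n * (1 / (real n + 2))) / measure_pmf.prob joint_pmf (E n)"
      by (intro divide_right_mono pB) simp
    also have "\<dots> = 1 / ((real n + 1) * (real n + 2))" by (simp add: pE pmf_level)
    also have "\<dots> \<le> 1 / ((real n + 1) * (real n + 1))" by (intro divide_left_mono mult_left_mono) auto
    finally show ?thesis by (simp add: power2_eq_square inverse_eq_divide add.commute)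
  qed
  have p3: "seq.prob (X3 n) \<le> inverse (real (Suc n) ^ 2)" for n
  proof -
    have "seq.prob (X3 n) \<le> (measure_pmf.prob joint_pmf (D n) / measure_pmf.prob joint_pmf (E n))\<^sup>2"
      unfolding X3_def by (rule seq.prob_hit_twice_before(2)[OF E0])
    also have "measure_pmf.prob joint_pmf (D n) / measure_pmf.prob joint_pmf (E n) = 1 / (real n + 1)"
      by (simp add: pD pE pmf_level)
    finally show ?thesis by (simp add: power_divide inverse_eq_divide add.commute)
  qed
  have pX: "seq.prob (X n) \<le> exp (-1) ^ (n + 2) + 2 * inverse (real (Suc n) ^ 2)" for n
  proof -
    have "seq.prob (X n) \<le> seq.prob (X1 n \<union> X2 n) + seq.prob (X3 n)"
      unfolding X_def using m by (intro measure_Un_le) auto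
    also have "seq.prob (X1 n \<union> X2 n) \<le> seq.prob (X1 n) + seq.prob (X2 n)"
      using m by (intro measure_Un_le) auto
    finally show ?thesis using p1[of n] p2[of n] p3[of n] by linarith
  qed
  have "AE \<omega> in seq.M. eventually (\<lambda>n. \<omega> \<in> space seq.M - X n) sequentially"
  proof (rule borel_cantelli_AE1)
    show "X n \<in> sets seq.M" for n unfolding X_def using m by auto
    show "emeasure seq.M (X n) < \<infinity>" for n by (simp add: seq.emeasure_eq_measure)
    show "summable (\<lambda>n. seq.prob (X n))"
    proof (rule summable_comparison_test'[where N = 0])
      have "summable (\<lambda>n. inverse (real n ^ 2))" by (rule inverse_power_summable) simp
      then have "summable (\<lambda>n. inverse (real (Suc n) ^ 2))" by (subst summable_Suc_iff)
      moreover have "summable (\<lambda>n. exp (-1 :: real) ^ (n + 2))"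
        by (subst summable_iff_shift) (rule summable_geometric, simp)
      ultimately show "summable (\<lambda>n. exp (-1) ^ (n + 2) + 2 * inverse (real (Suc n) ^ 2))"
        by (intro summable_add summable_mult)
    qed (use pX in auto)
  qed
  then show ?thesis
    by eventually_elim (auto elim!: eventually_mono intro: ccontr dest: bad)
qed

lemma countable_carrier_G: "countable (carrier G)"
  unfolding range_a[symmetric] by (intro countable_image) simp

lemma prob_measure_\<mu>: "prob_measure_on G \<mu>"
  unfolding prob_measure_on_def \<mu>_def
  using measure_pmf.prob_space_distr[OF measurable_step_of] by simp

sublocale random_walk G \<mu>
  by unfold_locales (rule countable_carrier_G prob_measure_\<mu>)+

lemma integral_\<mu>: "(\<integral>s. \<phi> s \<partial>\<mu>) = (\<integral>z. \<phi> (step_of z) \<partial>measure_pmf joint_pmf)" for \<phi> :: "'a \<Rightarrow> real"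
  unfolding \<mu>_def by (rule integral_distr[OF measurable_step_of]) simp

lemma nondegenerate_\<mu>: "nondegenerate G \<mu>"
proof -
  have supp: "x \<in> support G \<mu>" if x: "x \<in> carrier G" for x
  proof -
    obtain n where n: "x = a n" using range_a x by auto
    have "(n, x) \<in> set_pmf joint_pmf" by (simp add: set_joint_pmf step_set_def n)
    then have "0 < measure_pmf.prob joint_pmf {(n, x)}" by (simp add: measure_pmf_single pmf_positive)
    also have "\<dots> \<le> measure_pmf.prob joint_pmf (step_of -` {x})"
      using x by (intro measure_pmf.finite_measure_mono) (auto simp: step_of_def)
    also have "\<dots> = measure \<mu> {x}"
      unfolding \<mu>_def using x by (subst measure_distr[OF measurable_step_of]) auto
    finally show ?thesis using x by (simp add: support_def)
  qed
  have "carrier G \<subseteq> generated_semigroup G (support G \<mu>)"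
    by (rule subsetI) (rule generated_semigroup.incl[OF supp])
  moreover have "w \<in> carrier G" if "w \<in> generated_semigroup G (support G \<mu>)" for w
    using that by induction (auto simp: support_def)
  ultimately have "generated_semigroup G (support G \<mu>) = carrier G" by blast
  then show ?thesis using prob_measure_\<mu> by (simp add: nondegenerate_def)
qed

lemma measurable_samples: "(\<lambda>\<omega> i. step_of (\<omega> i)) \<in> seq.M \<rightarrow>\<^sub>M (\<Pi>\<^sub>M i \<in> (UNIV :: nat set). \<mu>)"
proof (rule measurable_PiM_single')
  fix i
  have "(\<lambda>\<omega>. \<omega> i) \<in> seq.M \<rightarrow>\<^sub>M measure_pmf joint_pmf" by (rule measurable_component_singleton) simp
  moreover have "step_of \<in> measure_pmf joint_pmf \<rightarrow>\<^sub>M \<mu>" using step_of_closed by (auto simp: \<mu>_def)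
  ultimately show "(\<lambda>\<omega>. step_of (\<omega> i)) \<in> seq.M \<rightarrow>\<^sub>M \<mu>" by (rule measurable_compose)
qed (auto intro: step_of_closed)

lemma steps_distr: "(\<Pi>\<^sub>M i \<in> (UNIV :: nat set). \<mu>) = distr seq.M (\<Pi>\<^sub>M i \<in> (UNIV :: nat set). \<mu>) (\<lambda>\<omega> i. step_of (\<omega> i))"
proof -
  note m = measurable_samples
  show ?thesis
  proof (rule steps.PiM_eq[symmetric])
    fix K :: "nat set" and F assume K: "finite K" and F: "\<And>j. j \<in> K \<Longrightarrow> F j \<in> sets \<mu>"
    let ?X = "prod_emb UNIV (\<lambda>_. \<mu>) K (\<Pi>\<^sub>E j\<in>K. F j)"
    have X: "?X \<in> sets (\<Pi>\<^sub>M i \<in> (UNIV :: nat set). \<mu>)" using K F by (intro sets_PiM_I) auto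
    have "emeasure (distr seq.M (\<Pi>\<^sub>M i \<in> (UNIV :: nat set). \<mu>) (\<lambda>\<omega> i. step_of (\<omega> i))) ?X
        = emeasure seq.M {\<omega>. \<forall>k\<in>K. \<omega> k \<in> step_of -` F k}"
      using step_of_closed by (subst emeasure_distr[OF m X]) (auto simp: prod_emb_def PiE_iff intro: step_of_closed intro!: arg_cong[where f = "emeasure seq.M"])
    also have "\<dots> = ennreal (\<Prod>k\<in>K. measure_pmf.prob joint_pmf (step_of -` F k))"
      unfolding seq.emeasure_eq_measure seq.prob_initial[OF K] ..
    also have "\<dots> = (\<Prod>k\<in>K. emeasure (measure_pmf joint_pmf) (step_of -` F k))"
      by (simp add: measure_pmf.emeasure_eq_measure prod_ennreal)
    also have "\<dots> = (\<Prod>j\<in>K. emeasure \<mu> (F j))"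
    proof (rule prod.cong[OF refl])
      fix k assume "k \<in> K"
      then have "F k \<subseteq> carrier G" using F sets_step by auto
      then show "emeasure (measure_pmf joint_pmf) (step_of -` F k) = emeasure \<mu> (F k)"
        unfolding \<mu>_def by (subst emeasure_distr[OF measurable_step_of]) auto
    qed
    finally show "emeasure (distr seq.M (\<Pi>\<^sub>M i \<in> (UNIV :: nat set). \<mu>) (\<lambda>\<omega> i. step_of (\<omega> i))) ?X = (\<Prod>j\<in>K. emeasure \<mu> (F j))" .
  qed simp
qed

lemma AE_P_of_samples:
  assumes Q: "Measurable.pred (path_space G) Q" and x: "x \<in> carrier G"
    and ae: "AE \<omega> in seq.M. Q (walk G x (\<lambda>i. step_of (\<omega> i)))"
  shows "AE y in P x. Q y"
proof -
  note m = measurable_samples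
  have eq: "P x = distr seq.M (path_space G) (walk G x \<circ> (\<lambda>\<omega> i. step_of (\<omega> i)))"
    unfolding path_measure_def by (subst steps_distr) (rule distr_distr[OF measurable_walk'[OF x] m])
  show ?thesis
    unfolding eq using Q ae measurable_comp[OF m measurable_walk'[OF x]]
    by (subst AE_distr_iff) (auto simp: pred_def)
qed

end

section \<open>The stabilizers for the designed step distribution\<close>

text \<open>A boundary point sees an exit set only through a set of the \<open>\<sigma>\<close>-algebra generated by the base that equals it
  modulo a null set, and countably many null sets can be discarded.\<close>

lemma (in random_walk) separated_paths_not_fixed:
  assumes I: "countable I" and E: "\<And>i. i \<in> I \<Longrightarrow> E i \<in> exit_sets G \<mu>" and h: "h \<in> carrier G" and x: "x \<in> carrier G"
    and sep: "AE y in P x. \<exists>i \<in> I. y \<in> E i \<and> translate G h y \<notin> E i"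
  shows "AE y in P x. bnd G \<mu> (translate G h y) \<noteq> bnd G \<mu> y"
proof -
  have "AE y in P x. \<forall>i \<in> I. bnd G \<mu> (translate G h y) = bnd G \<mu> y \<longrightarrow> (translate G h y \<in> E i \<longleftrightarrow> y \<in> E i)"
    unfolding AE_ball_countable[OF I]
  proof
    fix i assume i: "i \<in> I"
    obtain B where B: "B \<in> sigma_sets \<Omega> (exit_base G \<mu>)" "B \<in> exit_sets G \<mu>"
      and ae: "\<And>x. x \<in> carrier G \<Longrightarrow> AE y in P x. y \<in> E i \<longleftrightarrow> y \<in> B"
      using exit_set_mod_base[OF E[OF i]] by blast
    note [measurable] = exit_sets_measurable[OF E[OF i]] exit_sets_measurable[OF B(2)]
    have "Measurable.pred (path_space G) (\<lambda>y. y \<in> E i \<longleftrightarrow> y \<in> B)" by measurable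
    from AE_translate[OF this h ae x]
    have "AE y in P x. translate G h y \<in> E i \<longleftrightarrow> translate G h y \<in> B" by auto
    with ae[OF x] AE_in_space[of x]
    show "AE y in P x. bnd G \<mu> (translate G h y) = bnd G \<mu> y \<longrightarrow> (translate G h y \<in> E i \<longleftrightarrow> y \<in> E i)"
    proof eventually_elim
      case (elim y)
      then show ?case using sigma_base_separation[OF B(1) translate_in_space[OF h elim(2)] elim(2)] by simp
    qed
  qed
  with sep show ?thesis by eventually_elim blast
qed

lemma integral_bind_pmf_bounded:
  fixes \<phi> :: "'b \<Rightarrow> real"
  assumes "\<And>x. \<bar>\<phi> x\<bar> \<le> B"
  shows "(\<integral>x. \<phi> x \<partial>bind_pmf M N) = (\<integral>y. (\<integral>x. \<phi> x \<partial>N y) \<partial>measure_pmf M)"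
  unfolding measure_pmf_bind
proof (rule integral_bind[where K = "count_space UNIV" and B = B and B' = 1])
  show "(\<lambda>x. measure_pmf (N x)) \<in> measure_pmf M \<rightarrow>\<^sub>M subprob_algebra (count_space UNIV)"
    using measurable_measure_pmf[of N] by simp
  show "finite_measure (measure_pmf M)" by (rule measure_pmf.finite_measure_axioms)
qed (use assms in auto)

lemma abs_integral_pmf_le:
  fixes \<phi> :: "'b \<Rightarrow> real"
  assumes b: "\<And>x. \<bar>\<phi> x\<bar> \<le> B" and le: "\<And>x. x \<in> set_pmf M \<Longrightarrow> \<bar>\<phi> x\<bar> \<le> c"
  shows "\<bar>\<integral>x. \<phi> x \<partial>measure_pmf M\<bar> \<le> c"
proof -
  have i: "integrable (measure_pmf M) (\<lambda>x. \<bar>\<phi> x\<bar>)"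
    by (rule measure_pmf.integrable_const_bound[of _ B]) (use b in auto)
  have "\<bar>\<integral>x. \<phi> x \<partial>measure_pmf M\<bar> \<le> (\<integral>x. \<bar>\<phi> x\<bar> \<partial>measure_pmf M)" by (rule integral_abs_bound)
  also have "\<dots> \<le> c"
    by (rule measure_pmf.integral_le_const[OF i]) (use le in \<open>auto simp: AE_measure_pmf_iff\<close>)
  finally show ?thesis .
qed

lemma abs_sum_diff_le:
  fixes \<psi> :: "'b \<Rightarrow> real"
  assumes "finite A" "finite B" "card A = card B" and bound: "\<And>x. x \<in> A \<union> B \<Longrightarrow> \<bar>\<psi> x\<bar> \<le> c"
  shows "\<bar>sum \<psi> A - sum \<psi> B\<bar> \<le> 2 * c * card (A - B)"
proof -
  have "sum \<psi> A = sum \<psi> (A - B) + sum \<psi> (A \<inter> B)" "sum \<psi> B = sum \<psi> (B - A) + sum \<psi> (A \<inter> B)"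
    using sum.Int_Diff[OF assms(1), of \<psi> B] sum.Int_Diff[OF assms(2), of \<psi> A] by (simp_all add: Int_commute)
  then have "sum \<psi> A - sum \<psi> B = sum \<psi> (A - B) - sum \<psi> (B - A)" by simp
  also have "\<bar>\<dots>\<bar> \<le> (\<Sum>x\<in>A - B. \<bar>\<psi> x\<bar>) + (\<Sum>x\<in>B - A. \<bar>\<psi> x\<bar>)"
    by (intro order_trans[OF abs_triangle_ineq4] add_mono sum_abs)
  also have "\<dots> \<le> (\<Sum>x\<in>A - B. c) + (\<Sum>x\<in>B - A. c)"
    using bound by (intro add_mono sum_mono) auto
  also have "card (B - A) = card (A - B)"
    using assms(1-3) by (simp add: card_Diff_subset_Int Int_commute)
  then have "(\<Sum>x\<in>A - B. c) + (\<Sum>x\<in>B - A. c) = 2 * c * card (A - B)" by simp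
  finally show ?thesis .
qed

context step_design
begin

interpretation seq: iid_pmf joint_pmf .

lemma eventual_ancestor_exit_set:
  "{y \<in> \<Omega>. \<exists>M. \<forall>m\<ge>M. ancestor (y m) q k} \<in> exit_sets G \<mu>"
  unfolding exit_sets_iff
proof (intro conjI ballI)
  have "{y \<in> \<Omega>. ancestor (y m) q k} \<in> sets (path_space G)" for m
  proof -
    have "(\<lambda>y. y m) -` {x \<in> carrier G. ancestor x q k} \<inter> \<Omega> \<in> sets (path_space G)"
      by (intro measurable_sets[OF measurable_path_space_component]) auto
    also have "(\<lambda>y. y m) -` {x \<in> carrier G. ancestor x q k} \<inter> \<Omega> = {y \<in> \<Omega>. ancestor (y m) q k}"
      using path_in_carrier by auto
    finally show ?thesis .
  qed
  then show "{y \<in> \<Omega>. \<exists>M. \<forall>m\<ge>M. ancestor (y m) q k} \<in> sets (path_space G)"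
    by (intro sets.sets_Collect_countable_Ex sets.sets_Collect_countable_All sets.sets_Collect_imp) auto
next
  fix x
  have tail: "(\<exists>M. \<forall>m\<ge>M. ancestor (shift y m) q k) \<longleftrightarrow> (\<exists>M. \<forall>m\<ge>M. ancestor (y m) q k)" for y
    unfolding shift_def using eventually_sequentially_Suc[of "\<lambda>m. ancestor (y m) q k"]
    by (simp add: eventually_sequentially)
  show "AE y in P x. y \<in> {y \<in> \<Omega>. \<exists>M. \<forall>m\<ge>M. ancestor (y m) q k}
      \<longleftrightarrow> shift y \<in> {y \<in> \<Omega>. \<exists>M. \<forall>m\<ge>M. ancestor (y m) q k}"
    using AE_in_space[of x] by eventually_elim (simp add: shift_in_space tail)
qed

text \<open>To have a given ancestor eventually is an exit event, and the translation changes the eventual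
  ancestors of almost every path.\<close>

theorem outside_elements_move_boundary_points:
  assumes h: "h \<in> carrier G" "h \<notin> H" and x: "x \<in> carrier G"
  shows "AE y in P x. bnd G \<mu> (translate G h y) \<noteq> bnd G \<mu> y"
proof (rule separated_paths_not_fixed[of "carrier G \<times> UNIV"
      "\<lambda>(v, k). {y \<in> \<Omega>. \<exists>M. \<forall>m\<ge>M. ancestor (y m) (H #> v) k}"])
  let ?E = "\<lambda>(v, k). {y \<in> \<Omega>. \<exists>M. \<forall>m\<ge>M. ancestor (y m) (H #> v) k}"
  show cnt: "countable (carrier G \<times> (UNIV :: nat set))" using countable_carrier by simp
  show E: "?E i \<in> exit_sets G \<mu>" for i by (cases i) (simp add: eventual_ancestor_exit_set)
  have proper: "H \<noteq> carrier G" using h by blast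
  have meas: "Measurable.pred (path_space G) (\<lambda>y. \<exists>i \<in> carrier G \<times> UNIV. y \<in> ?E i \<and> translate G h y \<notin> ?E i)"
  proof -
    have "{y \<in> \<Omega>. y \<in> ?E i \<and> translate G h y \<notin> ?E i} \<in> sets (path_space G)" for i
    proof -
      note [measurable] = exit_sets_measurable[OF E[of i]] measurable_translate_P[OF h(1)]
      show ?thesis by measurable
    qed
    then have "(\<Union>i \<in> carrier G \<times> UNIV. {y \<in> \<Omega>. y \<in> ?E i \<and> translate G h y \<notin> ?E i}) \<in> sets (path_space G)"
      by (intro sets.countable_UN' cnt) auto
    moreover have "{y \<in> \<Omega>. \<exists>i \<in> carrier G \<times> UNIV. y \<in> ?E i \<and> translate G h y \<notin> ?E i}
        = (\<Union>i \<in> carrier G \<times> UNIV. {y \<in> \<Omega>. y \<in> ?E i \<and> translate G h y \<notin> ?E i})" by blast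
    ultimately show ?thesis unfolding pred_def by simp
  qed
  have "AE \<omega> in seq.M. \<exists>i \<in> carrier G \<times> UNIV. walk G x (\<lambda>i. step_of (\<omega> i)) \<in> ?E i
      \<and> translate G h (walk G x (\<lambda>i. step_of (\<omega> i))) \<notin> ?E i"
    using AE_eventually_good seq.AE_support
  proof eventually_elim
    case (elim \<omega>)
    then obtain n0 where n0: "\<And>n. n0 \<le> n \<Longrightarrow> good \<omega> n" by (auto simp: eventually_sequentially)
    have s: "step_of (\<omega> i) = snd (\<omega> i)" for i using elim(2) by (simp add: step_of_joint)
    have steps: "snd (\<omega> i) \<in> step_set a f (fst (\<omega> i))" for i
      using elim(2) by (auto simp: set_joint_pmf split_beta)
    let ?y = "walk G x (\<lambda>i. snd (\<omega> i))"
    obtain v k M where v: "v \<in> carrier G" and M: "\<And>m. M \<le> m \<Longrightarrow> ancestor (?y m) (H #> v) k"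
      "\<And>m. M \<le> m \<Longrightarrow> \<not> ancestor (h \<otimes> ?y m) (H #> v) k"
      using translate_changes_ancestors[OF proper n0 steps x h] by blast
    have sG: "snd (\<omega> i) \<in> carrier G" for i using steps step_set_closed by blast
    have "?y m \<in> carrier G" for m by (rule walk_closed[OF x]) (rule sG)
    then have "?y \<in> \<Omega>" by (auto simp: space_path_space PiE_iff)
    moreover have "\<not> (\<exists>M'. \<forall>m\<ge>M'. ancestor (translate G h ?y m) (H #> v) k)"
      using M(2) unfolding translate_def by (meson max.cobounded1 max.cobounded2)
    ultimately show ?case unfolding s using v M(1) by (intro bexI[of _ "(v, k)"]) auto
  qed
  then show "AE y in P x. \<exists>i \<in> carrier G \<times> UNIV. y \<in> ?E i \<and> translate G h y \<notin> ?E i"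
    by (rule AE_P_of_samples[OF meas x])
qed (use h x in auto)

text \<open>A step of a high level \<open>k\<close> from a point of the window almost equalizes a function and its
  \<open>h\<close>-translate: \<open>h \<otimes> x \<otimes> g k \<otimes> l = x \<otimes> g k \<otimes> (h' \<otimes> l)\<close> where \<open>h' \<in> H\<close> is one of the finitely many
  conjugates for which \<open>\<Lambda> k\<close> was chosen to be almost invariant.\<close>

lemma high_step_bound:
  assumes bound: "\<And>x. x \<in> carrier G \<Longrightarrow> \<bar>\<phi> x\<bar> \<le> c" and h: "h \<in> H" "h \<in> a ` {..k}" and x: "x \<in> W k"
  defines "u \<equiv> \<lambda>x. if x \<in> carrier G then \<phi> (h \<otimes> x) - \<phi> x else 0"
  shows "\<bar>\<integral>s. u (x \<otimes> s) \<partial>step_pmf k\<bar> \<le> 4 * c / (real k + 2)"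
proof -
  let ?e = "1 / (real k + 2)"
  have c0: "0 \<le> c" using bound[OF one_closed] by (meson abs_ge_zero order_trans)
  have hG: "h \<in> carrier G" using h(1) subset by auto
  have xG: "x \<in> carrier G" by (rule subsetD[OF words_closed(2) x])
  have ub: "\<bar>u y\<bar> \<le> 2 * c" for y
    using bound[of "h \<otimes> y"] bound[of y] hG c0 by (auto simp: u_def)
  let ?v = "x \<otimes> g k"
  let ?h = "inv ?v \<otimes> h \<otimes> ?v"
  have vG: "?v \<in> carrier G" using xG g_closed by simp
  have h'H: "?h \<in> H" by (rule inv_op_closed1[OF vG h(1)])
  then have h'G: "?h \<in> carrier G" using subset by auto
  have lG: "l \<in> carrier G" if "l \<in> \<Lambda> k" for l using that \<Lambda>(3) subset by auto
  have card0: "0 < card (\<Lambda> k)" using \<Lambda>[of k] by (simp add: card_gt_0_iff)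
  have inj: "inj_on ((\<otimes>) ?h) (\<Lambda> k)" using h'G lG by (auto intro!: inj_onI)
  have "(\<Sum>l\<in>\<Lambda> k. u (x \<otimes> (g k \<otimes> l))) = (\<Sum>l\<in>\<Lambda> k. \<phi> (?v \<otimes> (?h \<otimes> l)) - \<phi> (?v \<otimes> l))"
  proof (rule sum.cong[OF refl])
    fix l assume l: "l \<in> \<Lambda> k"
    have "x \<otimes> (g k \<otimes> l) = ?v \<otimes> l" using xG g_closed lG[OF l] by (simp add: m_assoc)
    moreover have "h \<otimes> (?v \<otimes> l) = ?v \<otimes> (?h \<otimes> l)"
      using vG hG lG[OF l] by (simp add: m_assoc inv_mult_cancel del: m_assoc[of x])
    ultimately show "u (x \<otimes> (g k \<otimes> l)) = \<phi> (?v \<otimes> (?h \<otimes> l)) - \<phi> (?v \<otimes> l)"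
      using vG lG[OF l] by (simp add: u_def)
  qed
  also have "\<dots> = sum (\<lambda>l. \<phi> (?v \<otimes> l)) ((\<otimes>) ?h ` \<Lambda> k) - sum (\<lambda>l. \<phi> (?v \<otimes> l)) (\<Lambda> k)"
    by (simp add: sum_subtractf sum.reindex[OF inj] o_def)
  also have "\<bar>\<dots>\<bar> \<le> 2 * c * card ((\<otimes>) ?h ` \<Lambda> k - \<Lambda> k)"
    by (rule abs_sum_diff_le) (use \<Lambda>(1)[of k] card_image[OF inj] vG h'G lG in \<open>auto intro!: bound\<close>)
  also have "\<dots> \<le> 2 * c * (?e * card (\<Lambda> k))"
    using foelner[of k] h x c0 by (intro mult_left_mono) (auto simp: foelner_def)
  finally have sum: "\<bar>\<Sum>l\<in>\<Lambda> k. u (x \<otimes> (g k \<otimes> l))\<bar> \<le> 2 * c * ?e * card (\<Lambda> k)" by simp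
  have "(\<integral>s. u (x \<otimes> s) \<partial>step_pmf k) = (\<integral>b. (\<integral>s. u (x \<otimes> s) \<partial>(if b then return_pmf (a k)
      else map_pmf ((\<otimes>) (g k)) (pmf_of_set (\<Lambda> k)))) \<partial>bernoulli_pmf ?e)"
    unfolding step_pmf_def by (rule integral_bind_pmf_bounded[of _ "2 * c"]) (rule ub)
  also have "\<dots> = u (x \<otimes> a k) * ?e + ((\<Sum>l\<in>\<Lambda> k. u (x \<otimes> (g k \<otimes> l))) / card (\<Lambda> k)) * (1 - ?e)"
    using \<Lambda>[of k] by (simp add: integral_pmf_of_set)
  also have "\<bar>\<dots>\<bar> \<le> 2 * c * ?e + 2 * c * ?e * 1"
  proof (intro order_trans[OF abs_triangle_ineq] add_mono)
    show "\<bar>u (x \<otimes> a k) * ?e\<bar> \<le> 2 * c * ?e"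
      using ub[of "x \<otimes> a k"] unfolding abs_mult by (intro mult_mono) auto
    have "\<bar>(\<Sum>l\<in>\<Lambda> k. u (x \<otimes> (g k \<otimes> l))) / card (\<Lambda> k)\<bar> \<le> 2 * c * ?e"
      using sum card0 by (simp add: divide_le_eq)
    then show "\<bar>((\<Sum>l\<in>\<Lambda> k. u (x \<otimes> (g k \<otimes> l))) / card (\<Lambda> k)) * (1 - ?e)\<bar> \<le> 2 * c * ?e * 1"
      unfolding abs_mult by (intro mult_mono) (use c0 in auto)
  qed
  also have "\<dots> = 4 * c / (real k + 2)" by simp
  finally show ?thesis .
qed

text \<open>Up to a small probability, a step of level at least \<open>n\<close> occurs within the horizon of \<open>n\<close>. The first such step starts
  from a point of the window of \<open>n\<close>, so \<open>high_step_bound\<close> applies to it.\<close>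

theorem harmonic_H_invariant:
  assumes \<phi>: "harmonic \<phi>" and h: "h \<in> H" and x: "x \<in> carrier G"
  shows "\<phi> (h \<otimes> x) = \<phi> x"
proof -
  have b: "bounded_fun \<phi>" using \<phi> by (simp add: harmonic_def)
  then obtain c where c0: "0 < c" and c: "\<And>x. x \<in> carrier G \<Longrightarrow> \<bar>\<phi> x\<bar> \<le> c" by (metis bounded_funE)
  have hG: "h \<in> carrier G" using h subset by auto
  define u where "u y = (if y \<in> carrier G then \<phi> (h \<otimes> y) - \<phi> y else 0)" for y
  have ub: "\<bar>u y\<bar> \<le> 2 * c" for y
    using c[of "h \<otimes> y"] c[of y] hG c0 by (auto simp: u_def)
  have harm: "u y = (\<integral>k. (\<integral>s. u (y \<otimes> s) \<partial>step_pmf k) \<partial>level_pmf)" if y: "y \<in> carrier G" for y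
  proof -
    have "u y = markov_op (\<lambda>x. \<phi> (h \<otimes> x) - \<phi> x) y"
      using harmonicD[OF harmonic_diff[OF harmonic_left[OF \<phi> hG] \<phi>] y] y by (simp add: u_def)
    also have "\<dots> = markov_op u y" by (rule markov_op_cong) (use y in \<open>auto simp: u_def\<close>)
    also have "\<dots> = (\<integral>z. u (y \<otimes> step_of z) \<partial>joint_pmf)" unfolding markov_op_def integral_\<mu> ..
    also have "\<dots> = (\<integral>z. u (y \<otimes> snd z) \<partial>joint_pmf)"
      by (rule integral_cong_AE) (auto simp: AE_measure_pmf_iff step_of_joint)
    also have "\<dots> = (\<integral>k. (\<integral>z. u (y \<otimes> snd z) \<partial>map_pmf (Pair k) (step_pmf k)) \<partial>level_pmf)"
      unfolding joint_pmf_def by (rule integral_bind_pmf_bounded[of _ "2 * c"]) (rule ub)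
    finally show ?thesis by simp
  qed
  \<comment> \<open>With \<open>j\<close> steps left until the horizon, the power of \<open>1 - 1 / (n + 1)\<close> is the probability that all of them have levels below \<open>n\<close>.\<close>
  have iter: "\<bar>u y\<bar> \<le> (1 - 1 / (real n + 1)) ^ j * (2 * c) + 4 * c / (real n + 2)"
    if hn: "h \<in> a ` {..n}" and "i + j = horizon n" "y \<in> words a f n i" for n i j y
    using that(2-)
  proof (induction j arbitrary: i y)
    case 0
    then show ?case using ub[of y] c0 by (simp add: add_increasing2)
  next
    case (Suc j)
    let ?q = "1 - 1 / (real n + 1)"
    let ?b = "?q ^ j * (2 * c)" and ?d = "4 * c / (real n + 2)"
    let ?w = "\<lambda>k. \<integral>s. u (y \<otimes> s) \<partial>step_pmf k"
    have b0: "0 \<le> ?b" using c0 by (intro mult_nonneg_nonneg zero_le_power) (auto simp: field_simps)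
    have yG: "y \<in> carrier G" using Suc.prems words_closed by blast
    have low: "\<bar>?w k\<bar> \<le> ?b + ?d" if k: "k < n" for k
    proof (rule abs_integral_pmf_le[OF ub])
      fix s assume "s \<in> set_pmf (step_pmf k)"
      then have "s \<in> low_steps a f n" using k by (auto simp: set_step_pmf low_steps_def)
      then have "y \<otimes> s \<in> words a f n (Suc i)" using Suc.prems by (intro words_step)
      then show "\<bar>u (y \<otimes> s)\<bar> \<le> ?b + ?d" using Suc.prems by (intro Suc.IH[of "Suc i"]) auto
    qed
    have high: "\<bar>?w k\<bar> \<le> ?d" if k: "n \<le> k" for k
    proof -
      have "y \<in> W n" using Suc.prems words_mono[of i "horizon n" a f n] by auto
      then have "y \<in> W k" using window_mono[OF k] by blast
      moreover have "h \<in> a ` {..k}" using hn k by force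
      ultimately have "\<bar>?w k\<bar> \<le> 4 * c / (real k + 2)"
        unfolding u_def using high_step_bound[of \<phi> c h k y] c h by blast
      also have "\<dots> \<le> ?d" using k c0 by (intro divide_left_mono) auto
      finally show ?thesis .
    qed
    have wb: "\<bar>?w k\<bar> \<le> ?b * indicator {..<n} k + ?d" for k
      using low[of k] high[of k] by (cases "k < n") auto
    have i1: "integrable level_pmf ?w"
      by (rule measure_pmf.integrable_const_bound[of _ "2 * c"]) (use abs_integral_pmf_le[OF ub ub] in auto)
    have i2: "integrable level_pmf (\<lambda>k. ?b * indicator {..<n} k + ?d)"
      by (rule measure_pmf.integrable_const_bound[of _ "?b + ?d"]) (use b0 c0 in \<open>auto simp: indicator_def\<close>)
    have "\<bar>u y\<bar> = \<bar>\<integral>k. ?w k \<partial>level_pmf\<bar>" using harm[OF yG] by simp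
    also have "\<dots> \<le> (\<integral>k. \<bar>?w k\<bar> \<partial>level_pmf)" by (rule integral_abs_bound)
    also have "\<dots> \<le> (\<integral>k. ?b * indicator {..<n} k + ?d \<partial>level_pmf)"
      using i1 i2 wb by (intro integral_mono integrable_abs) auto
    also have "\<dots> = ?b * measure_pmf.prob level_pmf {..<n} + ?d"
      by (subst Bochner_Integration.integral_add) (auto simp: measure_pmf.emeasure_eq_measure)
    also have "\<dots> = ?q ^ Suc j * (2 * c) + ?d" by (simp add: prob_level_less)
    finally show ?case .
  qed
  have bound: "\<bar>u x\<bar> \<le> exp (-1) ^ (n + 2) * (2 * c) + 4 * c / (real n + 2)" if n: "h \<in> a ` {..n}" "x \<in> a ` {..n}" for n
  proof -
    have "\<bar>u x\<bar> \<le> (1 - 1 / (real n + 1)) ^ horizon n * (2 * c) + 4 * c / (real n + 2)"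
      by (rule iter[OF n(1), of 0]) (use n(2) initial_in_words[of _ n a f 0] in auto)
    also have "(1 - 1 / (real n + 1)) ^ horizon n \<le> (1 - 1 / (real n + 2)) ^ horizon n"
      by (intro power_mono) (auto simp: field_simps)
    also have "\<dots> \<le> exp (-1) ^ (n + 2)" by (rule power_horizon_bound)
    finally show ?thesis using c0 by (simp add: mult_right_mono)
  qed
  obtain k1 k2 where k: "h = a k1" "x = a k2" using range_a hG x by (metis imageE)
  have "(\<lambda>n. exp (-1) ^ (n + 2) * (2 * c) + 4 * c / (real n + 2)) \<longlonglongrightarrow> 0" by real_asymp
  moreover have "\<exists>N. \<forall>n\<ge>N. \<bar>u x\<bar> \<le> exp (-1) ^ (n + 2) * (2 * c) + 4 * c / (real n + 2)"
    by (intro exI[of _ "max k1 k2"] allI impI bound) (auto simp: k)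
  ultimately have "\<bar>u x\<bar> \<le> 0" by (rule LIMSEQ_le_const)
  then show ?thesis using x by (simp add: u_def)
qed

theorem point_stabilizers_\<mu>: "boundary_AE G \<mu> (\<lambda>\<zeta>. point_stabilizer G \<zeta> = H)"
  unfolding point_stabilizer_AE_iff[OF subset]
proof (intro ballI)
  fix h x assume h: "h \<in> carrier G" and x: "x \<in> carrier G"
  show "AE y in P x. bnd G \<mu> (translate G h y) = bnd G \<mu> y \<longleftrightarrow> h \<in> H"
  proof (cases "h \<in> H")
    case True
    then have "h \<in> pointwise_stabilizer G \<mu>"
      unfolding pointwise_stabilizer_harmonic using harmonic_H_invariant h by blast
    then show ?thesis using True x by (simp add: pointwise_stabilizer_iff)
  next
    case False
    then show ?thesis using outside_elements_move_boundary_points[OF h False x] by simp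
  qed
qed

end

section \<open>The characterization\<close>

lemma (in random_walk) pointwise_stabilizer_of_point_stabilizers:
  assumes H: "H \<subseteq> carrier G" and AE: "boundary_AE G \<mu> (\<lambda>\<zeta>. point_stabilizer G \<zeta> = H)"
  shows "pointwise_stabilizer G \<mu> = H"
proof -
  have ae: "AE y in P x. bnd G \<mu> (translate G h y) = bnd G \<mu> y \<longleftrightarrow> h \<in> H"
    if "h \<in> carrier G" "x \<in> carrier G" for h x
    using AE that unfolding point_stabilizer_AE_iff[OF H] by blast
  have "h \<in> pointwise_stabilizer G \<mu> \<longleftrightarrow> h \<in> H" if h: "h \<in> carrier G" for h
  proof
    assume "h \<in> H"
    then show "h \<in> pointwise_stabilizer G \<mu>"
      using ae[OF h] h by (auto simp: pointwise_stabilizer_iff)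
  next
    assume "h \<in> pointwise_stabilizer G \<mu>"
    then have "AE y in P \<one>. bnd G \<mu> (translate G h y) = bnd G \<mu> y"
      by (simp add: pointwise_stabilizer_iff)
    with ae[OF h one_closed] have "AE y in P \<one>. h \<in> H" by eventually_elim simp
    then show "h \<in> H" using prob_space.AE_const[OF prob_space_P[OF one_closed]] by simp
  qed
  then show ?thesis using H pointwise_stabilizer_subset by blast
qed

lemma trivial_quotient_icc:
  assumes "H \<lhd> G" "carrier (G Mod H) = {\<one>\<^bsub>G Mod H\<^esub>}"
  shows "icc_group (G Mod H)"
  using assms normal.factorgroup_is_group[OF assms(1)] by (auto simp: icc_group_def)

theorem theoremB:
  fixes G :: "('a, 'b) monoid_scheme" and H :: "'a set"
  assumes "group G" and "countable (carrier G)" and "subgroup H G"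
  shows "((\<exists>\<mu>. nondegenerate G \<mu> \<and> boundary_AE G \<mu> (\<lambda>\<zeta>. point_stabilizer G \<zeta> = H))
            \<longleftrightarrow> (\<exists>\<mu>. nondegenerate G \<mu> \<and> pointwise_stabilizer G \<mu> = H))
       \<and> ((\<exists>\<mu>. nondegenerate G \<mu> \<and> pointwise_stabilizer G \<mu> = H)
            \<longleftrightarrow> (H \<lhd> G \<and> amenable_group (G\<lparr>carrier := H\<rparr>)
                 \<and> (icc_group (G Mod H) \<or> carrier (G Mod H) = {\<one>\<^bsub>G Mod H\<^esub>})))"
    (is "(?A \<longleftrightarrow> ?B) \<and> (?B \<longleftrightarrow> ?C)")
proof -
  interpret group G by fact
  have walk: "random_walk G \<mu>" if "nondegenerate G \<mu>" for \<mu>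
    by unfold_locales (use that assms(2) in \<open>auto simp: nondegenerate_def\<close>)
  have "?A \<Longrightarrow> ?B"
    using random_walk.pointwise_stabilizer_of_point_stabilizers[OF walk subgroup.subset[OF assms(3)]] by blast
  moreover have "?B \<Longrightarrow> ?C"
  proof -
    assume ?B
    then obtain \<mu> where nd: "nondegenerate G \<mu>" and eq: "pointwise_stabilizer G \<mu> = H" by blast
    interpret random_walk G \<mu> by (rule walk[OF nd])
    have sub: "subgroup (pointwise_stabilizer G \<mu>) G" unfolding eq by fact
    show ?C
      using pointwise_stabilizer_normal[OF sub] pointwise_stabilizer_amenable[OF sub]
        quotient_by_pointwise_stabilizer_icc[OF nd pointwise_stabilizer_normal[OF sub]]
      unfolding eq by blast
  qed
  moreover have "?C \<Longrightarrow> ?A"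
  proof -
    assume C: ?C
    then have icc: "icc_group (G Mod H)" using trivial_quotient_icc by blast
    have "range (from_nat_into (carrier G)) = carrier G"
      using assms(2) one_closed by (intro range_from_nat_into) auto
    then have "\<exists>f. step_design H G (from_nat_into (carrier G)) f"
      using C icc by (intro step_design_exists) auto
    then obtain f where "step_design H G (from_nat_into (carrier G)) f" by (rule exE)
    then interpret step_design H G "from_nat_into (carrier G)" f .
    show ?A using nondegenerate_\<mu> point_stabilizers_\<mu> by blast
  qed
  ultimately show ?thesis by blast
qed

end
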